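(* There exists a dense subset of $H(\mathbb{D})$ all of whose elements $f$ have the following property: for every compact set $K\subset\mathbb{C}\setminus\mathbb{D}$ with connected complement and every non-empty open set $U$ of $A(K)$, $$\underline{d}_{\log}\left(\left\{n\in\mathbb{N}:\ S_n^{(K)}(f)\in U\right\}\right)>0.$$ In other words, the set of functions $f\in H(\mathbb{D})$ that are $K$-frequently universal Taylor series with respect to the logarithmic density simultaneously for all such $K$ is dense in $H(\mathbb{D})$.
   Context: $\mathbb{D}=\{z\in\mathbb{C}:|z|<1\}$ is the open unit disc, and $\mathbb{N}$ is the set of non-negative integers. $H(\mathbb{D})$ is the Fréchet space of holomorphic functions on $\mathbb{D}$ with the topology of locally uniform convergence. For a compact set $K\subset\mathbb{C}$, $A(K)$ is the Banach space of complex functions continuous on $K$ and holomorphic in the interior of $K$, with the supremum norm $\|\cdot\|_K$. "Connected complement" means $\mathbb{C}\setminus K$ is connected. For $f=\sum_{k\ge 0}a_kz^k\in H(\mathbb{D})$, $S_n^{(K)}(f)\in A(K)$ is the restriction to $K$ of the polynomial $\sum_{k=0}^n a_kz^k$. For $E\subset\mathbb{N}$, the lower logarithmic density is $$\underline{d}_{\log}(E)=\liminf_{n\to\infty}\frac{\sum_{1\le k\le n,\ k\in E}1/k}{\sum_{k=1}^n 1/k}.$$ *)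

theory Defs
  imports "HOL-Analysis.Analysis" "HOL-Complex_Analysis.Complex_Analysis"
begin

text \<open>
  Functions on a set \<open>S\<close> are total functions that are \<open>undefined\<close> outside \<open>S\<close>
  (\<open>extensional S\<close>), so that equality in the spaces below is equality on \<open>S\<close>.
\<close>

definition holo_space :: "complex set \<Rightarrow> (complex \<Rightarrow> complex) set" where
  "holo_space S = {f \<in> extensional S. f holomorphic_on S}"

text \<open>
  For open \<open>S\<close> this is the topology of locally uniform convergence: the sets
  \<open>{g. \<forall>z\<in>L. dist (g z) (f z) < e}\<close>, for \<open>L \<subseteq> S\<close> compact and \<open>e > 0\<close>,
  form a neighbourhood base at \<open>f\<close>.
\<close>

definition holo_topology :: "complex set \<Rightarrow> (complex \<Rightarrow> complex) topology" where
  "holo_topology S = topology (\<lambda>\<U>. \<U> \<subseteq> holo_space S \<and>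
     (\<forall>f\<in>\<U>. \<exists>L e. compact L \<and> L \<subseteq> S \<and> 0 < e \<and>
        {g \<in> holo_space S. \<forall>z\<in>L. dist (g z) (f z) < e} \<subseteq> \<U>))"

lemma openin_holo_topology:
  "openin (holo_topology S) \<U> \<longleftrightarrow> \<U> \<subseteq> holo_space S \<and>
     (\<forall>f\<in>\<U>. \<exists>L e. compact L \<and> L \<subseteq> S \<and> 0 < e \<and>
        {g \<in> holo_space S. \<forall>z\<in>L. dist (g z) (f z) < e} \<subseteq> \<U>)"
proof -
  define N where "N = (\<lambda>f L e. {g \<in> holo_space S. \<forall>z\<in>L. dist (g z) (f z) < e})"
  define nbhd where
    "nbhd = (\<lambda>f \<U>. \<exists>L e. compact L \<and> L \<subseteq> S \<and> 0 < e \<and> N f L e \<subseteq> \<U>)"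
  have nbhd_mono: "nbhd f \<V>" if "nbhd f \<U>" "\<U> \<subseteq> \<V>" for f \<U> \<V>
    using that unfolding nbhd_def by (meson order_trans)
  have nbhd_Int: "nbhd f (\<U> \<inter> \<V>)" if U: "nbhd f \<U>" and V: "nbhd f \<V>" for f \<U> \<V>
  proof -
    obtain L e where L: "compact L" "L \<subseteq> S" "0 < e" "N f L e \<subseteq> \<U>"
      using U unfolding nbhd_def by meson
    obtain L' e' where L': "compact L'" "L' \<subseteq> S" "0 < e'" "N f L' e' \<subseteq> \<V>"
      using V unfolding nbhd_def by meson
    have "N f (L \<union> L') (min e e') \<subseteq> N f L e" "N f (L \<union> L') (min e e') \<subseteq> N f L' e'"
      unfolding N_def by auto
    then have "N f (L \<union> L') (min e e') \<subseteq> \<U> \<inter> \<V>"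
      using L(4) L'(4) by (meson Int_greatest order_trans)
    moreover have "compact (L \<union> L')" "L \<union> L' \<subseteq> S" "0 < min e e'"
      using L L' by (simp_all add: compact_Un)
    ultimately show ?thesis
      unfolding nbhd_def by meson
  qed
  have "istopology (\<lambda>\<U>. \<U> \<subseteq> holo_space S \<and> (\<forall>f\<in>\<U>. nbhd f \<U>))"
    unfolding istopology_def
  proof (intro conjI allI impI ballI)
    fix \<K> f
    assume K: "\<forall>K\<in>\<K>. K \<subseteq> holo_space S \<and> (\<forall>f\<in>K. nbhd f K)" and "f \<in> \<Union>\<K>"
    then obtain U where U: "f \<in> U" "U \<in> \<K>"
      by (meson UnionE)
    then have "nbhd f U"
      using K by (meson bspec)
    then show "nbhd f (\<Union>\<K>)"
      by (rule nbhd_mono) (rule Union_upper[OF U(2)])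
  qed (use nbhd_Int in blast)+
  from topology_inverse'[OF this] show ?thesis
    unfolding holo_topology_def nbhd_def N_def by (rule fun_cong)
qed

lemma topspace_holo_topology [simp]: "topspace (holo_topology S) = holo_space S"
proof
  show "topspace (holo_topology S) \<subseteq> holo_space S"
    using openin_holo_topology[of S "topspace (holo_topology S)"] by auto
  have "openin (holo_topology S) (holo_space S)"
    unfolding openin_holo_topology
    by (intro conjI ballI exI[of _ "{}"] exI[of _ 1]) auto
  then show "holo_space S \<subseteq> topspace (holo_topology S)"
    by (rule openin_subset)
qed

lemma in_closure_of_holo_topology:
  "f \<in> holo_topology S closure_of X \<longleftrightarrow> f \<in> holo_space S \<and>
     (\<forall>L e. compact L \<and> L \<subseteq> S \<and> 0 < e \<longrightarrow>
        (\<exists>g \<in> X \<inter> holo_space S. \<forall>z\<in>L. dist (g z) (f z) < e))"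
proof -
  have op: "openin (holo_topology S) {g \<in> holo_space S. \<forall>z\<in>L. dist (g z) (f z) < e}"
    if f: "f \<in> holo_space S" and L: "compact L" "L \<subseteq> S" "0 < e" for L e
    unfolding openin_holo_topology
  proof (intro conjI ballI)
    fix g assume "g \<in> {g \<in> holo_space S. \<forall>z\<in>L. dist (g z) (f z) < e}"
    then have g: "g \<in> holo_space S" and lt: "\<And>z. z \<in> L \<Longrightarrow> dist (g z) (f z) < e"
      by auto
    have "continuous_on L (\<lambda>z. dist (g z) (f z))"
      using f g L unfolding holo_space_def
      by (auto intro!: continuous_on_dist holomorphic_on_imp_continuous_on
               intro: holomorphic_on_subset)
    then obtain m where m: "m < e" "\<And>z. z \<in> L \<Longrightarrow> dist (g z) (f z) \<le> m"
    proof (cases "L = {}")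
      case True
      then show ?thesis using that[of "e - 1"] by simp
    next
      case False
      then show ?thesis
        using continuous_attains_sup[OF \<open>compact L\<close> False \<open>continuous_on L _\<close>] lt that by blast
    qed
    have "dist (h z) (f z) < e" if "z \<in> L" "dist (h z) (g z) < e - m" for h z
      using m(2)[OF that(1)] that(2) dist_triangle[of "h z" "f z" "g z"] by linarith
    then show "\<exists>K d. compact K \<and> K \<subseteq> S \<and> 0 < d \<and>
        {h \<in> holo_space S. \<forall>z\<in>K. dist (h z) (g z) < d}
          \<subseteq> {g \<in> holo_space S. \<forall>z\<in>L. dist (g z) (f z) < e}"
      using m L by (intro exI[of _ L] exI[of _ "e - m"]) auto
  qed auto
  show ?thesis
    unfolding in_closure_of topspace_holo_topology
  proof (rule conj_cong[OF refl], rule iffI; intro allI impI)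
    fix L e
    assume f: "f \<in> holo_space S"
      and cl: "\<forall>T. f \<in> T \<and> openin (holo_topology S) T \<longrightarrow> (\<exists>y. y \<in> X \<and> y \<in> T)"
      and L: "compact L \<and> L \<subseteq> S \<and> (0::real) < e"
    then show "\<exists>g \<in> X \<inter> holo_space S. \<forall>z\<in>L. dist (g z) (f z) < e"
      using cl[rule_format, of "{g \<in> holo_space S. \<forall>z\<in>L. dist (g z) (f z) < e}"]
        op[OF f, of L e] by auto
  next
    fix T
    assume a: "\<forall>L e. compact L \<and> L \<subseteq> S \<and> 0 < e \<longrightarrow>
        (\<exists>g \<in> X \<inter> holo_space S. \<forall>z\<in>L. dist (g z) (f z) < e)"
      and T: "f \<in> T \<and> openin (holo_topology S) T"
    then obtain L e where L: "compact L" "L \<subseteq> S" "0 < e"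
      "{g \<in> holo_space S. \<forall>z\<in>L. dist (g z) (f z) < e} \<subseteq> T"
      unfolding openin_holo_topology by blast
    then obtain g where "g \<in> X" "g \<in> holo_space S" "\<forall>z\<in>L. dist (g z) (f z) < e"
      using a by blast
    then show "\<exists>y. y \<in> X \<and> y \<in> T"
      using L(4) by blast
  qed
qed

text \<open>
  \<open>cfunspace\<close> carries the supremum metric; its elements are extensional on \<open>K\<close>,
  so the space is a single point when \<open>K\<close> is empty.
\<close>

definition A_space :: "complex set \<Rightarrow> (complex \<Rightarrow> complex) metric" where
  "A_space K = submetric (cfunspace (top_of_set K) euclidean_metric)
                         {f. f holomorphic_on interior K}"

lemma mspace_A_space:
  assumes "compact K"
  shows "mspace (A_space K) =
    {f \<in> extensional K. continuous_on K f \<and> f holomorphic_on interior K}"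
proof -
  have "compactin (top_of_set K) (topspace (top_of_set K))"
    using assms by (simp add: compactin_subtopology)
  from compactin_mspace_cfunspace[OF this, of euclidean_metric] show ?thesis
    unfolding A_space_def by auto
qed

lemma mdist_A_space:
  assumes "compact K" "K \<noteq> {}" "f \<in> mspace (A_space K)" "g \<in> mspace (A_space K)"
  shows "mdist (A_space K) f g = (SUP z\<in>K. norm (f z - g z))"
proof -
  have "f \<in> Met_TC.fspace K" "g \<in> Met_TC.fspace K"
    using assms(3,4) by (auto simp: A_space_def Met_TC.fspace_def)
  then show ?thesis
    using assms(2) by (simp add: A_space_def mdist_cfunspace_eq_mdist_funspace Met_TC.fdist_def dist_norm)
qed

text \<open>
  The coefficients of \<open>fps_expansion f 0\<close> are \<open>(deriv ^^ k) f 0 / fact k\<close>.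
\<close>

definition taylor_sum :: "complex set \<Rightarrow> nat \<Rightarrow> (complex \<Rightarrow> complex) \<Rightarrow> (complex \<Rightarrow> complex)" where
  "taylor_sum K n f = restrict (\<lambda>z. \<Sum>k\<le>n. fps_nth (fps_expansion f 0) k * z ^ k) K"

lemma taylor_sum_in_A_space:
  assumes "compact K"
  shows "taylor_sum K n f \<in> mspace (A_space K)"
proof -
  let ?p = "\<lambda>z. \<Sum>k\<le>n. fps_nth (fps_expansion f 0) k * z ^ k"
  have "continuous_on K (taylor_sum K n f)"
    by (rule continuous_on_eq[of _ ?p]) (auto simp: taylor_sum_def intro!: continuous_intros)
  moreover have "taylor_sum K n f holomorphic_on interior K"
    by (rule holomorphic_transform[of ?p])
       (use interior_subset in \<open>auto simp: taylor_sum_def intro!: holomorphic_intros\<close>)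
  ultimately show ?thesis
    by (simp add: mspace_A_space[OF assms]) (simp add: taylor_sum_def)
qed

text \<open>
  The term at \<open>n = 0\<close> is \<open>0 / 0 = 0\<close>; it does not affect the lower limit.
\<close>

definition lower_log_density :: "nat set \<Rightarrow> ereal" where
  "lower_log_density E =
     liminf (\<lambda>n. ereal ((\<Sum>k\<in>{1..n} \<inter> E. 1 / real k) / (\<Sum>k=1..n. 1 / real k)))"

end

theory Submission
  imports Defs
begin

text \<open>
  Put \<open>N j = 2 ^ 4 ^ j\<close>. The functions have the form \<open>q + (\<Sum>j\<ge>j0. P j)\<close> where \<open>q\<close> is an arbitrary polynomial
  and the block \<open>P j\<close> has valuation at least \<open>(N j)\<^sup>2\<close> and degree at most \<open>(N j) ^ 4 = N (j + 1)\<close>, so that the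
  partial sums are constant for \<open>N (j + 1) \<le> n < (N (j + 1))\<^sup>2\<close>. These gaps all have comparable logarithmic
  length relative to what precedes them; hence the gaps whose indices \<open>j\<close> form a set with bounded distances have
  positive lower logarithmic density. Each pair of a compact set and a polynomial target, taken from
  countable families which suffice, is served by such a set of indices.

  A block is obtained by multiplying the required correction by a polynomial which is extremely small on a
  disc of radius \<open>r < 1\<close> and extremely close to 1 on the compact set. Reducing to polynomial targets, as
  well as the existence of that multiplier, rests on Mergelyan's theorem. It is proved by Vitushkin's scheme:
  the function is smoothed into a Cauchy transform \<open>\<integral> \<nu> \<eta> / (z - \<eta>)\<close> with \<open>\<nu>\<close> supported near the complement of \<open>K\<close>,
  and the kernel \<open>1 / (z - \<eta>)\<close> is replaced, up to an integrable third order error, by functions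
  built from the inverse of a Joukowski map.
\<close>

section \<open>Uniform approximation by polynomials\<close>

text \<open>The obstacle is the degree of the blocks. Positive density needs degrees bounded by a
  fixed power of the valuation, the same power for every compact set, and approximation theorems
  give no control of the degree. The blocks therefore use approximation only once per compact set,
  for a multiplier with the crude error 1/8; accuracy then comes from iterating a cubic polynomial
  with superattracting fixed points 0 and 1. With N = 2^e and 2 e iterations, the error is below
  2^(-N^2), the valuation is at least 4^e = N^2, and the degree is at most 9^e times a constant
  depending on the compact set. The exponent 4 in N (j+1) = (N j)^4 is chosen because 16 > 9: the
  surplus absorbs that constant for large e. The compact set and the target thus influence only the
  index from which on they can be served, and each of them is postponed until that index is
  reached.\<close>

definition poly_approximable :: "complex set \<Rightarrow> (complex \<Rightarrow> complex) \<Rightarrow> bool" where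
  "poly_approximable K f \<longleftrightarrow> (\<forall>e>0. \<exists>p. \<forall>z\<in>K. norm (f z - poly p z) < e)"

lemma poly_approximable_poly: "poly_approximable K (poly p)"
  unfolding poly_approximable_def by (intro allI impI exI[of _ p]) auto

lemma poly_approximable_const: "poly_approximable K (\<lambda>z. c)"
  unfolding poly_approximable_def by (intro allI impI exI[of _ "[:c:]"]) auto

lemma poly_approximable_ident: "poly_approximable K (\<lambda>z. z)"
  unfolding poly_approximable_def by (intro allI impI exI[of _ "[:0, 1:]"]) auto

lemma poly_approximable_cong:
  assumes "\<And>z. z \<in> K \<Longrightarrow> f z = g z"
  shows "poly_approximable K f \<longleftrightarrow> poly_approximable K g"
  unfolding poly_approximable_def using assms by simp

lemma poly_approximable_limit:
  assumes "\<And>e. e > 0 \<Longrightarrow> \<exists>g. poly_approximable K g \<and> (\<forall>z\<in>K. norm (f z - g z) < e)"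
  shows "poly_approximable K f"
  unfolding poly_approximable_def
proof (intro allI impI)
  fix e :: real assume e: "e > 0"
  obtain g where g: "poly_approximable K g" "\<And>z. z \<in> K \<Longrightarrow> norm (f z - g z) < e/2"
    using assms[of "e/2"] e by auto
  obtain p where p: "\<And>z. z \<in> K \<Longrightarrow> norm (g z - poly p z) < e/2"
    using g(1) e unfolding poly_approximable_def by (meson half_gt_zero)
  have "norm (f z - poly p z) < e" if "z \<in> K" for z
    using norm_triangle_ineq[of "f z - g z" "g z - poly p z"] g(2)[OF that] p[OF that] by simp
  then show "\<exists>p. \<forall>z\<in>K. norm (f z - poly p z) < e" by blast
qed

lemma poly_approximable_add:
  assumes "poly_approximable K f" "poly_approximable K g"
  shows "poly_approximable K (\<lambda>z. f z + g z)"
  unfolding poly_approximable_def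
proof (intro allI impI)
  fix e :: real assume e: "e > 0"
  obtain p where p: "\<And>z. z \<in> K \<Longrightarrow> norm (f z - poly p z) < e/2"
    using assms(1) e unfolding poly_approximable_def by (meson half_gt_zero)
  obtain q where q: "\<And>z. z \<in> K \<Longrightarrow> norm (g z - poly q z) < e/2"
    using assms(2) e unfolding poly_approximable_def by (meson half_gt_zero)
  have "norm (f z + g z - poly (p + q) z) < e" if "z \<in> K" for z
    using norm_triangle_ineq[of "f z - poly p z" "g z - poly q z"] p[OF that] q[OF that]
    by (simp add: algebra_simps)
  then show "\<exists>p. \<forall>z\<in>K. norm (f z + g z - poly p z) < e" by blast
qed

lemma poly_approximable_imp_continuous_on:
  assumes "poly_approximable K f"
  shows "continuous_on K f"
proof -
  have "\<forall>n. \<exists>p. \<forall>z\<in>K. norm (f z - poly p z) < inverse (real (Suc n))"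
    using assms unfolding poly_approximable_def by (meson inverse_positive_iff_positive of_nat_0_less_iff zero_less_Suc)
  then obtain p where p: "\<And>n z. z \<in> K \<Longrightarrow> norm (f z - poly (p n) z) < inverse (real (Suc n))"
    by metis
  have "uniform_limit K (\<lambda>n. poly (p n)) f sequentially"
  proof (rule uniform_limitI)
    fix e :: real assume "e > 0"
    then have "eventually (\<lambda>n. inverse (real (Suc n)) < e) sequentially"
      using order_tendstoD(2)[OF LIMSEQ_inverse_real_of_nat] by simp
    then show "\<forall>\<^sub>F n in sequentially. \<forall>x\<in>K. dist (poly (p n) x) (f x) < e"
      by eventually_elim (metis p dist_norm norm_minus_commute order_less_trans)
  qed
  moreover have "\<forall>\<^sub>F n in sequentially. continuous_on K (poly (p n))"
    by (intro always_eventually allI continuous_intros)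
  ultimately show ?thesis
    using uniform_limit_theorem by (metis sequentially_bot)
qed

lemma poly_approximable_bounded:
  assumes "poly_approximable K f" "compact K"
  obtains B where "B > 0" "\<And>z. z \<in> K \<Longrightarrow> norm (f z) \<le> B"
proof -
  have "bounded (f ` K)"
    using assms by (intro compact_imp_bounded compact_continuous_image poly_approximable_imp_continuous_on)
  then show ?thesis using that unfolding bounded_pos by (metis imageI)
qed

lemma poly_approximable_mult:
  assumes f: "poly_approximable K f" and g: "poly_approximable K g" and K: "compact K"
  shows "poly_approximable K (\<lambda>z. f z * g z)"
  unfolding poly_approximable_def
proof (intro allI impI)
  fix e :: real assume e: "e > 0"
  obtain B where B: "B > 0" "\<And>z. z \<in> K \<Longrightarrow> norm (g z) \<le> B"
    using poly_approximable_bounded[OF g K] by blast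
  have "e/(2*B) > 0" using e B by simp
  then obtain p where p: "\<And>z. z \<in> K \<Longrightarrow> norm (f z - poly p z) < e/(2*B)"
    using f unfolding poly_approximable_def by meson
  obtain C where C: "C > 0" "\<And>z. z \<in> K \<Longrightarrow> norm (poly p z) \<le> C"
    using poly_approximable_bounded[OF poly_approximable_poly K] by blast
  have "e/(2*C) > 0" using e C by simp
  then obtain q where q: "\<And>z. z \<in> K \<Longrightarrow> norm (g z - poly q z) < e/(2*C)"
    using g unfolding poly_approximable_def by meson
  have "norm (f z * g z - poly (p * q) z) < e" if z: "z \<in> K" for z
  proof -
    have "norm (f z - poly p z) * norm (g z) \<le> e/(2*B) * B"
      by (intro mult_mono) (use p[OF z] B z e in auto)
    moreover have "norm (poly p z) * norm (g z - poly q z) \<le> C * norm (g z - poly q z)"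
      by (intro mult_right_mono) (use C z in auto)
    moreover have "C * norm (g z - poly q z) < C * (e/(2*C))"
      using q[OF z] C by (intro mult_strict_left_mono) auto
    moreover have "f z * g z - poly (p * q) z = (f z - poly p z) * g z + poly p z * (g z - poly q z)"
      by (simp add: algebra_simps)
    ultimately show ?thesis
      using norm_triangle_ineq[of "(f z - poly p z) * g z" "poly p z * (g z - poly q z)"] B C
      by (simp add: norm_mult)
  qed
  then show "\<exists>p. \<forall>z\<in>K. norm (f z * g z - poly p z) < e" by blast
qed

lemma poly_approximable_sum:
  assumes "\<And>i. i \<in> I \<Longrightarrow> poly_approximable K (f i)"
  shows "poly_approximable K (\<lambda>z. \<Sum>i\<in>I. f i z)"
  using assms
  by (induction I rule: infinite_finite_induct)
     (auto intro: poly_approximable_add poly_approximable_const)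

lemma poly_approximable_poly_comp:
  assumes "poly_approximable K h" "compact K"
  shows "poly_approximable K (\<lambda>z. poly q (h z))"
  by (induction q)
     (auto intro!: poly_approximable_add poly_approximable_mult assms poly_approximable_const)

lemma holomorphic_on_ball_poly_approximable:
  assumes f: "f holomorphic_on ball 0 R" and r: "r < R"
  shows "poly_approximable (cball 0 r) f"
proof (cases "r < 0")
  case False
  let ?F = "fps_expansion f 0"
  let ?p = "\<lambda>n. \<Sum>i<n. monom (fps_nth ?F i) i"
  have R: "ereal r < fps_conv_radius ?F"
    using conv_radius_fps_expansion[of f 0 "ereal R"] f r by (metis eball_ereal less_ereal.simps(1) order_less_le_trans)
  have p: "poly (?p n) z = (\<Sum>i<n. fps_nth ?F i * (z - 0) ^ i)" for n z
    by (simp add: poly_sum poly_monom)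
  have lim: "uniform_limit (cball 0 r) (\<lambda>n z. \<Sum>i<n. fps_nth ?F i * (z - 0) ^ i)
               (\<lambda>z. suminf (\<lambda>i. fps_nth ?F i * (z - 0) ^ i)) sequentially"
    using R by (intro powser_uniform_limit) (simp add: fps_conv_radius_def)
  have val: "suminf (\<lambda>i. fps_nth ?F i * (z - 0) ^ i) = f z" if "z \<in> cball 0 r" for z
    using eval_fps_expansion[of f 0 "ereal R" z] f r that by (simp add: eval_fps_def)
  show ?thesis unfolding poly_approximable_def
  proof (intro allI impI)
    fix e :: real assume "e > 0"
    from eventually_happens'[OF sequentially_bot uniform_limitD[OF lim this]]
    obtain n where "\<forall>z\<in>cball 0 r. dist (\<Sum>i<n. fps_nth ?F i * (z - 0) ^ i)
         (suminf (\<lambda>i. fps_nth ?F i * (z - 0) ^ i)) < e" by blast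
    then show "\<exists>p. \<forall>z\<in>cball 0 r. norm (f z - poly p z) < e"
      by (intro exI[of _ "?p n"]) (metis p val dist_norm dist_commute)
  qed
qed (simp add: poly_approximable_def)

text \<open>By compactness the values of \<open>h\<close> stay in a closed disc of radius less than
  1, on which \<open>\<phi>\<close> is a uniform limit of polynomials.\<close>

lemma poly_approximable_holomorphic_comp:
  assumes h: "poly_approximable K h" and K: "compact K" and lt: "\<And>z. z \<in> K \<Longrightarrow> norm (h z) < 1"
    and \<phi>: "\<phi> holomorphic_on ball 0 1"
  shows "poly_approximable K (\<lambda>z. \<phi> (h z))"
proof (cases "K = {}")
  case False
  have "continuous_on K (\<lambda>z. norm (h z))"
    by (intro continuous_intros poly_approximable_imp_continuous_on h)
  then obtain x where x: "x \<in> K" "\<And>z. z \<in> K \<Longrightarrow> norm (h z) \<le> norm (h x)"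
    using continuous_attains_sup[OF K False] by blast
  have ap: "poly_approximable (cball 0 (norm (h x))) \<phi>"
    using holomorphic_on_ball_poly_approximable[OF \<phi>] lt x by blast
  show ?thesis
  proof (rule poly_approximable_limit)
    fix e :: real assume "e > 0"
    then obtain p where "\<And>w. w \<in> cball 0 (norm (h x)) \<Longrightarrow> norm (\<phi> w - poly p w) < e"
      using ap unfolding poly_approximable_def by meson
    then have "\<forall>z\<in>K. norm (\<phi> (h z) - poly p (h z)) < e"
      using x by auto
    then show "\<exists>g. poly_approximable K g \<and> (\<forall>z\<in>K. norm (\<phi> (h z) - g z) < e)"
      using poly_approximable_poly_comp[OF h K] by blast
  qed
qed (simp add: poly_approximable_def)

text \<open>Runge's pole pushing: the poles \<open>a\<close> that work form a set that is open and closed in \<open>- K\<close>.\<close>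

lemma poly_approximable_inverse:
  assumes K: "compact K" "connected (- K)" and a: "a \<notin> K"
  shows "poly_approximable K (\<lambda>z. 1 / (z - a))"
proof -
  \<comment> \<open>Geometric series: 1/(z - b) is 1/(z - a) times the sum of the powers of (b -
    a)/(z - a), which has modulus below 1 on \<open>K\<close>.\<close>
  have push: "poly_approximable K (\<lambda>z. 1 / (z - b))"
    if A: "poly_approximable K (\<lambda>z. 1 / (z - a))" and ab: "\<And>z. z \<in> K \<Longrightarrow> norm (b - a) < norm (z - a)" for a b
  proof -
    have "poly_approximable K (\<lambda>z. (b - a) * (1 / (z - a)))"
      by (intro poly_approximable_mult poly_approximable_const A K)
    then have "poly_approximable K (\<lambda>z. 1 / (1 - (b - a) * (1 / (z - a))))"
    proof (rule poly_approximable_holomorphic_comp[where \<phi> = "\<lambda>w. 1 / (1 - w)", OF _ K(1)])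
      show "norm ((b - a) * (1 / (z - a))) < 1" if "z \<in> K" for z
        using ab[OF that] norm_ge_zero[of "b - a"] by (simp add: norm_mult norm_divide divide_less_eq_1)
      show "(\<lambda>w. 1 / (1 - w)) holomorphic_on ball (0::complex) 1"
        by (intro holomorphic_intros) auto
    qed
    then have "poly_approximable K (\<lambda>z. (1 / (z - a)) * (1 / (1 - (b - a) * (1 / (z - a)))))"
      by (intro poly_approximable_mult A K)
    moreover have "(1 / (z - a)) * (1 / (1 - (b - a) * (1 / (z - a)))) = 1 / (z - b)" if "z \<in> K" for z
    proof -
      have "z - a \<noteq> 0" "z - b \<noteq> 0" using ab[OF that] by (auto simp: norm_minus_commute)
      then show ?thesis by (simp add: field_simps)
    qed
    ultimately show ?thesis using poly_approximable_cong by (metis (no_types, lifting))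
  qed
  define R where "R = (\<lambda>a b::complex. poly_approximable K (\<lambda>z. 1 / (z - a)) \<longleftrightarrow> poly_approximable K (\<lambda>z. 1 / (z - b)))"
  obtain B where B: "B > 0" "\<And>z. z \<in> K \<Longrightarrow> norm z \<le> B"
    using compact_imp_bounded[OF K(1)] unfolding bounded_pos by blast
  \<comment> \<open>A first admissible pole: z/c has modulus at most 1/2 on \<open>K\<close>, so
    1/(z - c) is a geometric series in z itself.\<close>
  define c where "c = complex_of_real (2 * B)"
  have normc: "norm c = 2 * B" using B unfolding c_def by (metis abs_of_pos mult_pos_pos norm_of_real zero_less_numeral)
  have cK: "c \<notin> K" using B normc by fastforce
  have c: "poly_approximable K (\<lambda>z. 1 / (z - c))"
  proof -
    have "poly_approximable K (\<lambda>z. 1 / c * z)"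
      by (intro poly_approximable_mult poly_approximable_const poly_approximable_ident K)
    then have "poly_approximable K (\<lambda>z. 1 / (1 - 1 / c * z))"
    proof (rule poly_approximable_holomorphic_comp[where \<phi> = "\<lambda>w. 1 / (1 - w)", OF _ K(1)])
      show "norm (1 / c * z) < 1" if "z \<in> K" for z
        using B(2)[OF that] B(1) by (simp add: norm_mult norm_divide normc)
      show "(\<lambda>w. 1 / (1 - w)) holomorphic_on ball (0::complex) 1"
        by (intro holomorphic_intros) auto
    qed
    then have "poly_approximable K (\<lambda>z. (- 1 / c) * (1 / (1 - 1 / c * z)))"
      by (intro poly_approximable_mult poly_approximable_const K)
    moreover have "(- 1 / c) * (1 / (1 - 1 / c * z)) = 1 / (z - c)" if "z \<in> K" for z
    proof -
      have "c \<noteq> 0" "z - c \<noteq> 0" using B cK normc that by auto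
      then show ?thesis by (simp add: field_simps)
    qed
    ultimately show ?thesis using poly_approximable_cong by (metis (no_types, lifting))
  qed
  have "R c a"
  proof (rule connected_equivalence_relation[OF K(2)])
    fix a assume a: "a \<in> - K"
    \<comment> \<open>Since \<open>K\<close> has distance at least 2 e from a, it has distance more
      than e from every x in \<open>ball a e\<close>; so the pole can be pushed from a to x and also
      back.\<close>
    obtain e where e: "e > 0" "ball a (2 * e) \<subseteq> - K"
    proof -
      obtain d where "d > 0" "ball a d \<subseteq> - K"
        using a K(1) by (meson compact_imp_closed open_Compl open_contains_ball)
      then show ?thesis by (intro that[of "d/2"]) auto
    qed
    have "R a x" if x: "x \<in> ball a e" for x
    proof -
      have far: "2 * e \<le> norm (z - a)" if "z \<in> K" for z
        using e(2) that by (auto simp: dist_norm norm_minus_commute subset_eq not_less[symmetric])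
      have xa: "norm (x - a) < e" "norm (a - x) < e"
        using x by (auto simp: dist_norm norm_minus_commute)
      have "norm (x - a) < norm (z - a)" "norm (a - x) < norm (z - x)" if "z \<in> K" for z
      proof -
        have "norm (z - a) \<le> norm (z - x) + norm (x - a)"
          using norm_triangle_ineq[of "z - x" "x - a"] by simp
        then show "norm (x - a) < norm (z - a)" "norm (a - x) < norm (z - x)"
          using far[OF that] xa e(1) by linarith+
      qed
      then show ?thesis unfolding R_def using push[of a x] push[of x a] by blast
    qed
    moreover have "ball a e \<subseteq> - K" using e by (auto simp: subset_eq)
    moreover have "a \<in> ball a e" using e by simp
    ultimately show "\<exists>T. openin (top_of_set (- K)) T \<and> a \<in> T \<and> (\<forall>x\<in>T. R a x)"
      by (meson open_ball openin_open_eq open_Compl K(1) compact_imp_closed)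
  qed (use a cK in \<open>auto simp: R_def\<close>)
  with c show ?thesis unfolding R_def by blast
qed

section \<open>Approximating the Cauchy kernel off a compact set\<close>

text \<open>For x close to a, the quotient (z - a)/(z - x) = 1 - (a - x)/(z - x) lies in the right
  half-plane and the principal root works. Products and reciprocals of such roots show that having a
  root is an equivalence relation on \<open>E\<close>, so connectedness of \<open>E\<close> carries
  it to distant points. The exterior of a disc is carried along because the sign of the root there
  has to be normalised later.\<close>

lemma square_root_branch:
  assumes K: "compact K" "connected (- K)"
    and E: "connected E" "E \<inter> K = {}" "E \<subseteq> cball c R" and R: "R < R'"
    and ab: "a \<in> E" "b \<in> E"
  obtains g where "poly_approximable K g" "continuous_on (- cball c R') g"
    "\<And>z. z \<in> K \<union> - cball c R' \<Longrightarrow> g z ^ 2 = (z - a) / (z - b)"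
proof -
  define X where "X = - cball c R'"
  define S where "S = (\<lambda>a b. \<exists>g. poly_approximable K g \<and> continuous_on X g \<and>
                         (\<forall>z\<in>K \<union> X. g z ^ 2 = (z - a) / (z - b)))"
  have EX: "E \<inter> (K \<union> X) = {}" using E R unfolding X_def by fastforce
  have "S a b"
  proof (rule connected_equivalence_relation[OF E(1) ab])
    fix a b assume S: "S a b" and ab: "a \<in> E" "b \<in> E"
    then obtain g where g: "poly_approximable K g" "continuous_on X g"
      "\<And>z. z \<in> K \<union> X \<Longrightarrow> g z ^ 2 = (z - a) / (z - b)" unfolding S_def by blast
    have nz: "z - a \<noteq> 0" "z - b \<noteq> 0" "g z \<noteq> 0" if "z \<in> K \<union> X" for z
    proof -
      show "z - a \<noteq> 0" "z - b \<noteq> 0" using EX ab that by auto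
      then show "g z \<noteq> 0" using g(3)[OF that] by auto
    qed
    \<comment> \<open>This function is 1/g, written as a product because only products and the
      functions 1/(z - a) are known to be approximable.\<close>
    have "poly_approximable K (\<lambda>z. g z * ((z - b) * (1 / (z - a))))"
      using poly_approximable_add[OF poly_approximable_ident poly_approximable_const[of K "-b"]]
      by (intro poly_approximable_mult g poly_approximable_inverse K) (use ab E in auto)
    moreover have "continuous_on X (\<lambda>z. g z * ((z - b) * (1 / (z - a))))"
      by (intro continuous_intros g) (use nz in auto)
    moreover have "(g z * ((z - b) * (1 / (z - a)))) ^ 2 = (z - b) / (z - a)" if "z \<in> K \<union> X" for z
      using nz[OF that] by (simp add: power_mult_distrib g(3)[OF that] power_divide) (simp add: power2_eq_square)
    ultimately show "S b a" unfolding S_def by blast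
  next
    fix a b x assume S: "S a b" "S b x" and ab: "a \<in> E" "b \<in> E" "x \<in> E"
    obtain g where g: "poly_approximable K g" "continuous_on X g"
      "\<And>z. z \<in> K \<union> X \<Longrightarrow> g z ^ 2 = (z - a) / (z - b)" using S unfolding S_def by blast
    obtain h where h: "poly_approximable K h" "continuous_on X h"
      "\<And>z. z \<in> K \<union> X \<Longrightarrow> h z ^ 2 = (z - b) / (z - x)" using S unfolding S_def by blast
    have "(g z * h z) ^ 2 = (z - a) / (z - x)" if "z \<in> K \<union> X" for z
      using EX ab that by (auto simp: power_mult_distrib g(3)[OF that] h(3)[OF that])
    then show "S a x" unfolding S_def
      by (intro exI[of _ "\<lambda>z. g z * h z"] conjI poly_approximable_mult continuous_on_mult g h K) blast
  next
    fix a assume a: "a \<in> E"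
    have "open (- K)" using K by (simp add: compact_imp_closed open_Compl)
    moreover have "a \<in> - K" using a E by blast
    ultimately obtain d where d: "d > 0" "ball a d \<subseteq> - K" using open_contains_ball by metis
    define e where "e = min d (R' - R) / 2"
    have e: "e > 0" using d R unfolding e_def by auto
    have far: "2 * e \<le> norm (z - a)" if "z \<in> K \<union> X" for z
      using that
    proof
      assume "z \<in> K" then show ?thesis using d(2) unfolding e_def by (auto simp: dist_norm norm_minus_commute subset_eq not_less[symmetric])
    next
      assume "z \<in> X"
      then have "R' < dist c z" "dist c a \<le> R" using a E unfolding X_def by auto
      then show ?thesis using dist_triangle[of c z a] unfolding e_def by (auto simp: dist_norm norm_minus_commute)
    qed
    have "S a x" if x: "x \<in> ball a e \<inter> E" for x
    proof -
      have close: "norm (a - x) < norm (z - x)" if "z \<in> K \<union> X" for z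
        using far[OF that] x norm_triangle_ineq[of "z - x" "x - a"] by (auto simp: dist_norm norm_minus_commute)
      define h where "h = (\<lambda>z. (a - x) * (1 / (z - x)))"
      have h1: "norm (h z) < 1" if "z \<in> K \<union> X" for z
      proof -
        have "0 < norm (z - x)" using close[OF that] norm_ge_zero[of "a - x"] by linarith
        then show ?thesis unfolding h_def using close[OF that] by (simp add: norm_mult norm_divide)
      qed
      have re: "Re (1 - w) > 0" if "norm w < 1" for w :: complex
        using that complex_Re_le_cmod[of w] by simp
      have hK: "poly_approximable K h" unfolding h_def
        by (intro poly_approximable_mult poly_approximable_const poly_approximable_inverse K) (use x E in auto)
      have "poly_approximable K (\<lambda>z. csqrt (1 - h z))"
      proof (rule poly_approximable_holomorphic_comp[OF hK K(1)])
        show "(\<lambda>w. csqrt (1 - w)) holomorphic_on ball 0 1"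
          by (intro holomorphic_intros) (use re in \<open>force simp: complex_nonpos_Reals_iff\<close>)+
      qed (use h1 in auto)
      moreover have "continuous_on X (\<lambda>z. csqrt (1 - h z))"
      proof (rule continuous_on_compose2[OF continuous_on_csqrt])
        show "continuous_on X (\<lambda>z. 1 - h z)"
          unfolding h_def by (intro continuous_intros) (use x EX in auto)
        show "(\<lambda>z. 1 - h z) ` X \<subseteq> - \<real>\<^sub>\<le>\<^sub>0"
          using re h1 by (fastforce simp: complex_nonpos_Reals_iff)
      qed
      moreover have "csqrt (1 - h z) ^ 2 = (z - a) / (z - x)" if "z \<in> K \<union> X" for z
      proof -
        have "z - x \<noteq> 0" using that x EX by auto
        then show ?thesis by (simp add: h_def divide_simps)
      qed
      ultimately show ?thesis unfolding S_def by blast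
    qed
    then show "\<exists>T. openin (top_of_set E) T \<and> a \<in> T \<and> (\<forall>x\<in>T. S a x)"
      using a e by (intro exI[of _ "ball a e \<inter> E"]) (auto simp: Int_commute)
  qed
  then show ?thesis using that unfolding S_def X_def by blast
qed

text \<open>
  With \<open>m\<close> and \<open>d\<close> the midpoint and half-difference of the ends of a continuum \<open>E\<close> avoiding \<open>K\<close>,
  the function \<open>J = (g - 1) / (g + 1)\<close> with \<open>g\<^sup>2 = (z - m + d) / (z - m - d)\<close> inverts the Joukowski map:
  \<open>J + 1 / J = 2 (z - m) / d\<close>. Hence \<open>J\<close> is bounded, and \<open>G = 2 J / d\<close> satisfies
  \<open>(z - m) G = 1 + J\<^sup>2\<close>, so that \<open>G + (\<zeta> - m) G\<^sup>2\<close> agrees with \<open>1 / (z - \<zeta>)\<close> to third order at infinity.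
\<close>

lemma joukowski_bounds:
  fixes J d z \<zeta> :: complex
  assumes J: "J \<noteq> 0" "J + 1 / J = 2 * z / d" and d: "norm d = R / 2" "R > 0" and \<zeta>: "norm \<zeta> < 3/2 * R"
    and small: "norm z > 5/2 * R \<Longrightarrow> norm J \<le> 1" and large: "norm J > 1 \<Longrightarrow> norm z \<le> 5/2 * R"
  defines "G \<equiv> 2 * J / d"
  shows "norm (G + \<zeta> * G\<^sup>2 - 1 / (z - \<zeta>)) \<le>
           (if norm (z - \<zeta>) < 4 * R then 3000 / R + 1 / norm (z - \<zeta>) else 30 * R\<^sup>2 / norm (z - \<zeta>) ^ 3)"
proof -
  have d0: "d \<noteq> 0" using d by auto
  have zG: "z * G = 1 + J\<^sup>2"
    using J d0 unfolding G_def by (simp add: field_simps power2_eq_square)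
  show ?thesis
  proof (cases "norm (z - \<zeta>) < 4 * R")
    case True
    \<comment> \<open>From J = 2 z/d - 1/J with |z| <= 5/2 R and |d| = R/2, the bound is 10 + 1.
      Hence |G| <= 44/R, and 44 + 3/2 * 44^2 = 2948 is rounded up to 3000.\<close>
    have "norm J \<le> 11"
    proof (cases "norm J > 1")
      case True
      have "J = 2 * z / d - 1 / J" using J(2) by (simp add: algebra_simps)
      then have "norm J \<le> norm (2 * z / d) + norm (1 / J)" using norm_triangle_ineq4 by metis
      also have "norm (2 * z / d) \<le> 10"
        using large[OF True] d by (simp add: norm_mult norm_divide divide_le_eq)
      also have "norm (1 / J) \<le> 1" using True by (simp add: norm_divide divide_le_eq)
      finally show ?thesis by simp
    qed auto
    then have G: "norm G \<le> 44 / R"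
      unfolding G_def norm_mult norm_divide d(1) using d(2) by (simp add: field_simps)
    have "norm (\<zeta> * G\<^sup>2) \<le> (3/2 * R) * (44 / R)\<^sup>2"
      unfolding norm_mult norm_power using G \<zeta> d by (intro mult_mono power_mono) auto
    also have "\<dots> = 2904 / R" using d by (simp add: power2_eq_square)
    finally have "norm (G + \<zeta> * G\<^sup>2) \<le> 44 / R + 2904 / R"
      using norm_triangle_ineq[of G "\<zeta> * G\<^sup>2"] G by linarith
    also have "\<dots> \<le> 3000 / R" using d by (simp add: divide_simps)
    finally have "norm (G + \<zeta> * G\<^sup>2 - 1 / (z - \<zeta>)) \<le> 3000 / R + norm (1 / (z - \<zeta>))"
      using norm_triangle_ineq4[of "G + \<zeta> * G\<^sup>2" "1 / (z - \<zeta>)"] by linarith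
    then show ?thesis using True by (simp add: norm_divide)
  next
    case False
    define t where "t = norm z"
    define u where "u = norm (z - \<zeta>)"
    have u: "u \<ge> 4 * R" "u < t + 3/2 * R" "t - 3/2 * R < u"
      using False \<zeta> norm_triangle_ineq4[of z \<zeta>] norm_triangle_ineq2[of z \<zeta>] unfolding u_def t_def by auto
    then have t: "t > 5/2 * R" "t > 0" "u \<le> 8/5 * t" "u \<ge> 2/5 * t" "u > 0" using d by auto
    have J1: "norm J \<le> 1" using small t d unfolding t_def by linarith
    have "1 / J = 2 * z / d - J" using J(2) by (simp add: algebra_simps)
    then have "norm (1 / J) \<ge> norm (2 * z / d) - norm J" by (metis norm_triangle_ineq2)
    then have "1 / norm J \<ge> 4 * t / R - 1"
      using J1 d by (simp add: norm_divide norm_mult t_def)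
    moreover have "4 * t / R - 1 \<ge> 2 * t / R" using t d by (simp add: field_simps)
    ultimately have "2 * t / R \<le> 1 / norm J" by linarith
    then have J2: "norm J \<le> R / (2 * t)"
      using J t d by (simp add: field_simps)
    have "R / (2 * t) \<le> 1/5" using t d by (simp add: field_simps)
    then have J3: "norm J \<le> 1/5" using J2 by linarith
    have nz: "z \<noteq> 0" "z - \<zeta> \<noteq> 0" using t unfolding t_def u_def by auto
    have Geq: "G = (1 + J\<^sup>2) / z" using zG nz by (simp add: field_simps)
    \<comment> \<open>In 1/(z - \<open>\<zeta>\<close>) = 1/z + \<open>\<zeta>\<close>/z^2 +
      \<open>\<zeta>\<close>^2/(z^2 (z - \<open>\<zeta>\<close>)) the first two terms cancel against
      \<open>G + \<zeta> * G\<^sup>2\<close>. Every remaining term is of order R^2/|z|^3, because J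
      is of order R/|z|.\<close>
    have key: "G + \<zeta> * G\<^sup>2 - 1 / (z - \<zeta>) = J\<^sup>2 / z + \<zeta> * (2 + J\<^sup>2) * J\<^sup>2 / z\<^sup>2 - \<zeta>\<^sup>2 / (z\<^sup>2 * (z - \<zeta>))"
      unfolding Geq using nz by (simp add: divide_simps) (simp add: algebra_simps power2_eq_square)
    have J2sq: "norm J ^ 2 \<le> R\<^sup>2 / (4 * t\<^sup>2)"
      using power_mono[OF J2, of 2] by (simp add: power_divide power_mult_distrib)
    have b1: "norm (J\<^sup>2 / z) \<le> 1/4 * (R\<^sup>2 / t ^ 3)"
    proof -
      have "norm (J\<^sup>2 / z) = norm J ^ 2 / t" by (simp add: norm_divide norm_power t_def)
      also have "\<dots> \<le> R\<^sup>2 / (4 * t\<^sup>2) / t" using J2sq t by (intro divide_right_mono) auto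
      finally show ?thesis by (simp add: power2_eq_square power3_eq_cube)
    qed
    have b2: "norm (\<zeta> * (2 + J\<^sup>2) * J\<^sup>2 / z\<^sup>2) \<le> 1/2 * (R\<^sup>2 / t ^ 3)"
    proof -
      have "norm (2 + J\<^sup>2) \<le> 2 + norm J ^ 2" by (metis norm_triangle_ineq norm_numeral norm_power)
      also have "norm J ^ 2 \<le> (1/5)\<^sup>2" using J3 by (intro power_mono) auto
      finally have a: "norm (2 + J\<^sup>2) \<le> 51/25" by (simp add: power2_eq_square)
      have "norm (\<zeta> * (2 + J\<^sup>2) * J\<^sup>2 / z\<^sup>2) = norm \<zeta> * norm (2 + J\<^sup>2) * norm J ^ 2 / t\<^sup>2"
        by (simp add: norm_divide norm_mult norm_power t_def)
      also have "\<dots> \<le> (3/2 * R) * (51/25) * (R\<^sup>2 / (4 * t\<^sup>2)) / t\<^sup>2"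
        using \<zeta> a J2sq d t by (intro divide_right_mono mult_mono) auto
      also have "\<dots> = (R / t) * (153/200) * (R\<^sup>2 / t ^ 3)"
        by (simp add: power2_eq_square power3_eq_cube)
      also have "\<dots> \<le> (2/5) * (153/200) * (R\<^sup>2 / t ^ 3)"
        using t d by (intro mult_right_mono) (auto simp: divide_simps)
      also have "\<dots> \<le> 1/2 * (R\<^sup>2 / t ^ 3)" using t by (intro mult_right_mono) auto
      finally show ?thesis .
    qed
    have b3: "norm (\<zeta>\<^sup>2 / (z\<^sup>2 * (z - \<zeta>))) \<le> 45/8 * (R\<^sup>2 / t ^ 3)"
    proof -
      have "norm (\<zeta>\<^sup>2 / (z\<^sup>2 * (z - \<zeta>))) = norm \<zeta> ^ 2 / (t\<^sup>2 * u)"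
        by (simp add: norm_divide norm_mult norm_power t_def u_def)
      also have "\<dots> \<le> (3/2 * R)\<^sup>2 / (t\<^sup>2 * (2/5 * t))"
        using \<zeta> t by (intro frac_le power_mono mult_left_mono) auto
      also have "\<dots> = 45/8 * (R\<^sup>2 / t ^ 3)"
        by (simp add: power2_eq_square power3_eq_cube)
      finally show ?thesis .
    qed
    have "norm (G + \<zeta> * G\<^sup>2 - 1 / (z - \<zeta>)) \<le> (1/4 + 1/2 + 45/8) * (R\<^sup>2 / t ^ 3)"
      unfolding key using b1 b2 b3
        norm_triangle_ineq4[of "J\<^sup>2 / z + \<zeta> * (2 + J\<^sup>2) * J\<^sup>2 / z\<^sup>2" "\<zeta>\<^sup>2 / (z\<^sup>2 * (z - \<zeta>))"]
        norm_triangle_ineq[of "J\<^sup>2 / z" "\<zeta> * (2 + J\<^sup>2) * J\<^sup>2 / z\<^sup>2"] by argo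
    also have "\<dots> \<le> (1/4 + 1/2 + 45/8) * (R\<^sup>2 / (5/8 * u) ^ 3)"
      using t by (intro mult_left_mono divide_left_mono power_mono) auto
    also have "\<dots> = (51/8 * 512/125) * (R\<^sup>2 / u ^ 3)" by (simp add: power3_eq_cube)
    also have "\<dots> \<le> 30 * (R\<^sup>2 / u ^ 3)" using t by (intro mult_right_mono) auto
    finally show ?thesis using False unfolding u_def by simp
  qed
qed

text \<open>Connectedness of \<open>- K\<close> provides a continuum of definite size: a path in
  \<open>- K\<close> leaving \<open>ball c R\<close>, cut where it first meets the circle, has ends
  at distance exactly R. Thus |d| = R/2, and the constants of the estimate depend on neither
  \<open>K\<close> nor the shape of the path.\<close>

lemma cauchy_kernel_approximation:
  assumes K: "compact K" "connected (- K)" and c: "c \<notin> K" and R: "R > 0"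
  obtains G m where "poly_approximable K G"
    "\<And>z \<zeta>. z \<in> K \<Longrightarrow> \<zeta> \<in> ball c R \<Longrightarrow> norm (G z + (\<zeta> - m) * (G z)\<^sup>2 - 1 / (z - \<zeta>)) \<le>
       (if norm (z - \<zeta>) < 4 * R then 3000 / R + 1 / norm (z - \<zeta>) else 30 * R\<^sup>2 / norm (z - \<zeta>) ^ 3)"
proof -
  obtain w where w: "w \<notin> K" "w \<notin> ball c R"
  proof -
    have "bounded (K \<union> ball c R)" using K compact_imp_bounded by simp
    then have "K \<union> ball c R \<noteq> UNIV" by (metis not_bounded_UNIV)
    then show ?thesis using that by blast
  qed
  have "path_connected (- K)"
    using K by (simp add: compact_imp_closed connected_open_path_connected open_Compl)
  then obtain p where p: "path p" "path_image p \<subseteq> - K" "pathstart p = c" "pathfinish p = w"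
    using c w unfolding path_connected_def by blast
  obtain h where h: "path h" "pathstart h = c" "path_image h \<subseteq> path_image p"
    "path_image h - {pathfinish h} \<subseteq> interior (ball c R)" "pathfinish h \<in> frontier (ball c R)"
    using exists_path_subpath_to_frontier[OF p(1), of "ball c R"] p w R by auto
  define E where "E = path_image h"
  define b where "b = pathfinish h"
  have cb: "norm (b - c) = R" using h(5) R unfolding b_def by (simp add: frontier_ball dist_norm norm_minus_commute)
  have E: "connected E" "E \<inter> K = {}" "E \<subseteq> cball c R" "c \<in> E" "b \<in> E"
  proof -
    show "c \<in> E" "b \<in> E" unfolding E_def b_def using h(2) by (metis pathstart_in_path_image, metis pathfinish_in_path_image)
    show "E \<subseteq> cball c R"
    proof
      fix x assume "x \<in> E"
      then show "x \<in> cball c R"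
        using h(4) cb unfolding E_def b_def by (cases "x = pathfinish h") (auto simp: dist_norm norm_minus_commute)
    qed
    show "E \<inter> K = {}" using h(3) p(2) unfolding E_def by blast
    show "connected E" unfolding E_def using h(1) by (simp add: connected_path_image)
  qed
  \<comment> \<open>Off the doubled disc (z - c)/(z - b) has positive real part, so its principal
    root \<open>s\<close> is continuous there and can serve to fix the sign of
    \<open>g0\<close>.\<close>
  define X where "X = - cball c (2 * R)"
  obtain g0 where g0: "poly_approximable K g0" "continuous_on X g0"
    "\<And>z. z \<in> K \<union> X \<Longrightarrow> g0 z ^ 2 = (z - c) / (z - b)"
    using square_root_branch[OF K E(1-3) _ E(4,5), of "2 * R"] R unfolding X_def by auto
  define m where "m = (c + b) / 2"
  define d where "d = (b - c) / 2"
  have md: "c = m - d" "b = m + d" unfolding m_def d_def by (simp_all add: field_simps)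
  have nd: "norm d = R / 2" "d \<noteq> 0" using cb R unfolding d_def by (auto simp: norm_divide)
  have mc: "norm (m - c) = R / 2" using nd md by simp
  define s where "s = (\<lambda>z. csqrt ((z - c) / (z - b)))"
  have Xfar: "norm (z - m) > 3/2 * R" if "z \<in> X" for z
    using that mc norm_triangle_ineq[of "z - m" "m - c"] unfolding X_def by (auto simp: dist_norm norm_minus_commute)
  have Re_pos: "Re ((z - c) / (z - b)) > 0" if "z \<in> X" for z
  proof -
    have "norm d < norm (z - m)" using Xfar[OF that] nd R by linarith
    then have "(norm d)\<^sup>2 < (norm (z - m))\<^sup>2" by (intro power_strict_mono) auto
    moreover have "Re ((x + d) * cnj (x - d)) = (norm x)\<^sup>2 - (norm d)\<^sup>2" for x
      unfolding cmod_power2 by (simp add: algebra_simps power2_eq_square)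
    ultimately have "Re ((z - m + d) * cnj (z - m - d)) > 0" by (metis diff_gt_0_iff_gt)
    then have "Re ((z - c) * cnj (z - b)) > 0" unfolding md by (simp add: algebra_simps)
    then show ?thesis by (simp add: Re_complex_div_gt_0)
  qed
  have nzX: "z - b \<noteq> 0" "z - c \<noteq> 0" if "z \<in> K \<union> X" for z
    using that E unfolding X_def using R by fastforce+
  have scont: "continuous_on X s"
    unfolding s_def
    by (rule continuous_on_compose2[OF continuous_on_csqrt])
       (use Re_pos nzX in \<open>fastforce simp: complex_nonpos_Reals_iff intro!: continuous_intros\<close>)+
  have s2: "s z ^ 2 = (z - c) / (z - b)" "s z \<noteq> 0" "Re (s z) \<ge> 0" if "z \<in> X" for z
  proof -
    show "s z ^ 2 = (z - c) / (z - b)" unfolding s_def by simp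
    show "Re (s z) \<ge> 0" using csqrt_principal[of "(z - c) / (z - b)"] unfolding s_def by linarith
    show "s z \<noteq> 0" unfolding s_def using nzX that by auto
  qed
  \<comment> \<open>Two continuous roots of the same function on the connected set \<open>X\<close>
    differ by a constant sign. After correcting it, g has nonnegative real part on \<open>X\<close>,
    which means |J| <= 1 there.\<close>
  have "(\<lambda>z. g0 z / s z) constant_on X"
  proof (rule continuous_finite_range_constant)
    show "connected X" unfolding X_def
      by (intro path_connected_imp_connected path_connected_complement_bounded_convex) auto
    show "continuous_on X (\<lambda>z. g0 z / s z)" by (intro continuous_intros g0 scont) (use s2 in auto)
    have "g0 z / s z \<in> {1, -1}" if "z \<in> X" for z
    proof -
      have "g0 z ^ 2 = s z ^ 2" using g0(3)[of z] s2[OF that] that by simp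
      then show ?thesis using s2(2)[OF that] by (auto simp: power2_eq_iff)
    qed
    then have "(\<lambda>z. g0 z / s z) ` X \<subseteq> {1, -1}" by blast
    then show "finite ((\<lambda>z. g0 z / s z) ` X)" by (rule finite_subset) auto
  qed
  then obtain \<epsilon> where \<epsilon>: "\<And>z. z \<in> X \<Longrightarrow> g0 z / s z = \<epsilon>" unfolding constant_on_def by blast
  define \<sigma> where "\<sigma> = (if \<epsilon> = -1 then -1 else 1 :: complex)"
  define g where "g = (\<lambda>z. \<sigma> * g0 z)"
  have gP: "poly_approximable K g" unfolding g_def by (intro poly_approximable_mult poly_approximable_const g0 K)
  have g2: "g z ^ 2 = (z - c) / (z - b)" if "z \<in> K \<union> X" for z
    using g0(3)[OF that] unfolding g_def \<sigma>_def by (simp add: power_mult_distrib)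
  have gs: "g z = s z" if "z \<in> X" for z
  proof -
    have "g0 z ^ 2 = s z ^ 2" using g0(3)[of z] s2[OF that] that by simp
    then have "g0 z / s z = 1 \<or> g0 z / s z = -1" using s2(2)[OF that] by (auto simp: power2_eq_iff)
    then show ?thesis using \<epsilon>[OF that] s2(2)[OF that] unfolding g_def \<sigma>_def
      by (auto simp: field_simps)
  qed
  \<comment> \<open>This is (g - 1)/(g + 1) with the denominator removed by means of g^2 - 1 = 2
    d/(z - b), so that approximability of J follows from products alone.\<close>
  define J where "J = (\<lambda>z. (g z - 1)\<^sup>2 * (z - b) * (1 / (2 * d)))"
  have gm1: "(g z)\<^sup>2 - 1 = 2 * d / (z - b)" if "z \<in> K \<union> X" for z
    using g2[OF that] nzX[OF that] md by (simp add: field_simps)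
  have Jeq: "J z = (g z - 1) / (g z + 1)" "g z + 1 \<noteq> 0" "J z \<noteq> 0" "J z + 1 / J z = 2 * (z - m) / d"
    if z: "z \<in> K \<union> X" for z
  proof -
    have prod: "(g z - 1) * (g z + 1) = 2 * d / (z - b)" using gm1[OF z] by (simp add: algebra_simps power2_eq_square)
    moreover have "2 * d / (z - b) \<noteq> 0" using nzX[OF z] nd by simp
    ultimately have nz: "g z - 1 \<noteq> 0" "g z + 1 \<noteq> 0" by (metis mult_zero_left, metis mult_zero_right)
    have e: "(z - b) / (2 * d) = 1 / ((g z - 1) * (g z + 1))" unfolding prod by simp
    show "g z + 1 \<noteq> 0" by fact
    have "J z = (g z - 1)\<^sup>2 * ((z - b) / (2 * d))" unfolding J_def by simp
    also have "\<dots> = (g z - 1) / (g z + 1)" unfolding e using nz by (simp add: power2_eq_square)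
    finally show J: "J z = (g z - 1) / (g z + 1)" .
    then show "J z \<noteq> 0" using nz by simp
    have "J z + 1 / J z = 2 * ((g z)\<^sup>2 + 1) * (1 / ((g z - 1) * (g z + 1)))"
      unfolding J using nz by (simp add: divide_simps) (simp add: algebra_simps power2_eq_square)
    also have "\<dots> = 2 * ((z - c) / (z - b) + 1) * ((z - b) / (2 * d))" unfolding e g2[OF z] ..
    also have "\<dots> = (2 * z - c - b) / d" using nzX[OF z] nd by (simp add: field_simps)
    also have "2 * z - c - b = 2 * (z - m)" unfolding m_def by (simp add: field_simps)
    finally show "J z + 1 / J z = 2 * (z - m) / d" .
  qed
  have JX: "norm (J z) \<le> 1" if "z \<in> X" for z
  proof -
    have "norm (g z - 1) ^ 2 \<le> norm (g z + 1) ^ 2"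
      unfolding cmod_power2 using s2(3)[OF that] gs[OF that] by (simp add: power2_eq_square algebra_simps)
    then have "norm (g z - 1) \<le> norm (g z + 1)" by (rule power2_le_imp_le) simp
    moreover have "norm (g z + 1) > 0" using Jeq(2)[of z] that by simp
    ultimately show ?thesis using Jeq(1)[of z] that by (simp add: norm_divide)
  qed
  define G where "G = (\<lambda>z. J z * (2 / d))"
  show thesis
  proof
    have "poly_approximable K (\<lambda>z. (g z + (-1)) * (g z + (-1)) * (z + (-b)) * (1 / (2 * d)) * (2 / d))"
      by (intro poly_approximable_mult poly_approximable_add gP poly_approximable_const poly_approximable_ident K)
    then show "poly_approximable K G"
      unfolding G_def J_def by (simp add: power2_eq_square)
    show "norm (G z + (\<zeta> - m) * (G z)\<^sup>2 - 1 / (z - \<zeta>)) \<le>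
       (if norm (z - \<zeta>) < 4 * R then 3000 / R + 1 / norm (z - \<zeta>) else 30 * R\<^sup>2 / norm (z - \<zeta>) ^ 3)"
      if z: "z \<in> K" and \<zeta>: "\<zeta> \<in> ball c R" for z \<zeta>
    proof -
      have inX: "z \<in> X \<or> norm (z - c) \<le> 2 * R" unfolding X_def by (auto simp: dist_norm norm_minus_commute)
      have a: "norm (\<zeta> - m) < 3/2 * R"
        using \<zeta> mc norm_triangle_ineq[of "\<zeta> - c" "c - m"] by (simp add: dist_norm norm_minus_commute)
      have near: "norm (z - m) \<le> 5/2 * R" if "\<not> z \<in> X"
        using that inX mc norm_triangle_ineq[of "z - c" "c - m"] by (simp add: norm_minus_commute)
      have small: "norm (J z) \<le> 1" if "norm (z - m) > 5/2 * R"
        using near that JX by fastforce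
      have large: "norm (z - m) \<le> 5/2 * R" if "norm (J z) > 1"
        using near that JX by fastforce
      have eqs: "z - m - (\<zeta> - m) = z - \<zeta>" "2 * J z / d = G z" by (simp_all add: G_def)
      have zKX: "z \<in> K \<union> X" using z by simp
      show ?thesis
        using joukowski_bounds[OF Jeq(3)[OF zKX] Jeq(4)[OF zKX] nd(1) R a small large] unfolding eqs .
    qed
  qed
qed

section \<open>Plane Lebesgue measure and circle means\<close>

lemma sets_borel_ball [measurable]: "ball c r \<in> sets borel" "cball c r \<in> sets borel"
  by simp_all

lemma distr_lborel_reflect: "distr lborel borel (\<lambda>x. t - x) = (lborel :: 'a::euclidean_space measure)"
  using lborel_affine[of "-1" t] by (simp add: density_1)

lemma nn_integral_lborel_reflect:
  fixes f :: "'a::euclidean_space \<Rightarrow> ennreal"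
  assumes [measurable]: "f \<in> borel_measurable borel"
  shows "(\<integral>\<^sup>+x. f (t - x) \<partial>lborel) = (\<integral>\<^sup>+x. f x \<partial>lborel)"
  by (subst (2) distr_lborel_reflect[of t, symmetric]) (simp add: nn_integral_distr)

lemma integral_lborel_reflect:
  fixes f :: "'a::euclidean_space \<Rightarrow> complex"
  assumes [measurable]: "f \<in> borel_measurable borel"
  shows "(\<integral>x. f (t - x) \<partial>lborel) = (\<integral>x. f x \<partial>lborel)"
  by (subst (2) distr_lborel_reflect[of t, symmetric]) (simp add: integral_distr)

lemma nn_integral_lborel_shift:
  fixes f :: "'a::euclidean_space \<Rightarrow> ennreal"
  assumes [measurable]: "f \<in> borel_measurable borel"
  shows "(\<integral>\<^sup>+x. f (t + x) \<partial>lborel) = (\<integral>\<^sup>+x. f x \<partial>lborel)"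
  using nn_integral_lborel_reflect[of "\<lambda>x. f (t - x)" 0] nn_integral_lborel_reflect[of f t] by simp

text \<open>Uniqueness of the translation-invariant measure: compare the double integrals of \<open>f (c x) g (y + c x)\<close>
  in both orders, with \<open>g\<close> the indicator of the unit disc.\<close>

lemma nn_integral_lborel_rotate:
  fixes f :: "complex \<Rightarrow> ennreal"
  assumes [measurable]: "f \<in> borel_measurable borel" and c: "norm c = 1"
  shows "(\<integral>\<^sup>+x. f (c * x) \<partial>lborel) = (\<integral>\<^sup>+x. f x \<partial>lborel)"
proof -
  define g :: "complex \<Rightarrow> ennreal" where "g = indicator (ball 0 1)"
  have [measurable]: "g \<in> borel_measurable borel" unfolding g_def by measurable
  have c0: "c \<noteq> 0" using c by auto
  have g: "g (c * x) = g x" for x unfolding g_def using c by (simp add: indicator_def norm_mult)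
  define I where "I = (\<integral>\<^sup>+x. g x \<partial>lborel)"
  have I: "I = ennreal pi"
    unfolding I_def g_def by (simp add: emeasure_ball unit_ball_vol_2)
  have "(\<integral>\<^sup>+x. f (c * x) \<partial>lborel) * I = (\<integral>\<^sup>+x. f (c * x) * I \<partial>lborel)"
    by (simp add: nn_integral_multc)
  also have "\<dots> = (\<integral>\<^sup>+x. \<integral>\<^sup>+y. f (c * x) * g (c * x + y) \<partial>lborel \<partial>lborel)"
    unfolding I_def by (simp add: nn_integral_cmult nn_integral_lborel_shift)
  also have "\<dots> = (\<integral>\<^sup>+y. \<integral>\<^sup>+x. f (c * x) * g (c * x + y) \<partial>lborel \<partial>lborel)"
    by (rule lborel_pair.Fubini'[symmetric]) measurable
  also have "\<dots> = (\<integral>\<^sup>+y. \<integral>\<^sup>+x. f (c * x - y) * g (c * x) \<partial>lborel \<partial>lborel)"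
  \<comment> \<open>For fixed y, translating x by -y/c turns c x + y into c x. After the next
    exchange of integrals, the integral of f (c x - y) over y no longer depends on c.\<close>
  proof (rule nn_integral_cong)
    fix y
    show "(\<integral>\<^sup>+x. f (c * x) * g (c * x + y) \<partial>lborel) = (\<integral>\<^sup>+x. f (c * x - y) * g (c * x) \<partial>lborel)"
      using nn_integral_lborel_shift[of "\<lambda>x. f (c * x) * g (c * x + y)" "- y / c"] c0
      by (simp add: algebra_simps)
  qed
  also have "\<dots> = (\<integral>\<^sup>+x. \<integral>\<^sup>+y. f (c * x - y) * g (c * x) \<partial>lborel \<partial>lborel)"
    by (rule lborel_pair.Fubini') measurable
  also have "\<dots> = (\<integral>\<^sup>+x. (\<integral>\<^sup>+y. f y \<partial>lborel) * g x \<partial>lborel)"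
    by (simp add: nn_integral_multc nn_integral_lborel_reflect g)
  also have "\<dots> = (\<integral>\<^sup>+y. f y \<partial>lborel) * I"
    unfolding I_def by (simp add: nn_integral_cmult)
  finally have "(\<integral>\<^sup>+x. f (c * x) \<partial>lborel) * ennreal pi / ennreal pi = (\<integral>\<^sup>+y. f y \<partial>lborel) * ennreal pi / ennreal pi"
    unfolding I by simp
  then show ?thesis by (simp add: mult_divide_eq_ennreal)
qed

lemma distr_lborel_rotate:
  fixes c :: complex
  assumes c: "norm c = 1"
  shows "distr lborel borel (\<lambda>x. c * x) = lborel"
proof (rule measure_eqI)
  fix A assume "A \<in> sets (distr lborel borel ((*) c))"
  then have [measurable]: "A \<in> sets borel" by simp
  have "emeasure (distr lborel borel ((*) c)) A = (\<integral>\<^sup>+x. indicator A x \<partial>distr lborel borel ((*) c))"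
    by (subst nn_integral_indicator) auto
  also have "\<dots> = (\<integral>\<^sup>+x. indicator A (c * x) \<partial>lborel)" by (subst nn_integral_distr) auto
  also have "\<dots> = (\<integral>\<^sup>+x. indicator A x \<partial>lborel)" by (rule nn_integral_lborel_rotate[OF _ c]) simp
  finally show "emeasure (distr lborel borel ((*) c)) A = emeasure lborel A" by simp
qed simp

lemma integral_lborel_rotate:
  fixes f :: "complex \<Rightarrow> 'b::{banach, second_countable_topology}"
  assumes [measurable]: "f \<in> borel_measurable borel" and c: "norm c = 1"
  shows "(\<integral>x. f (c * x) \<partial>lborel) = (\<integral>x. f x \<partial>lborel)"
  by (subst (2) distr_lborel_rotate[OF c, symmetric]) (simp add: integral_distr)

lemma integrable_lborel_rotate:
  fixes f :: "complex \<Rightarrow> 'b::{banach, second_countable_topology}"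
  assumes "integrable lborel f" and c: "norm c = 1"
  shows "integrable lborel (\<lambda>x. f (c * x))"
proof -
  have [measurable]: "f \<in> borel_measurable borel" using assms(1) by simp
  have "integrable (distr lborel borel (\<lambda>x. c * x)) f"
    using assms by (simp add: distr_lborel_rotate)
  then show ?thesis by (subst (asm) integrable_distr_eq) auto
qed

section \<open>Integrals of powers of the distance in the plane\<close>

lemma le_suminf_ennreal: "f k \<le> (\<Sum>k. f k)" for f :: "nat \<Rightarrow> ennreal"
  using sum_le_suminf[of f "{k}"] by simp

text \<open>Dyadic decomposition: where |u - c| is between s/2^(k+1) and s/2^k the integrand is at
  most 2^(k+1)/s. Multiplying by the areas of whole discs gives the series of 2 pi s/2^k. The exact
  value 2 pi s is thereby overestimated by a factor 2.\<close>

lemma nn_integral_ball_inverse_norm: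
  fixes c :: complex
  assumes s: "s > 0"
  shows "(\<integral>\<^sup>+u. indicator (ball c s) u * ennreal (1 / norm (u - c)) \<partial>lborel) \<le> ennreal (4 * pi * s)"
proof -
  have pt: "indicator (ball c s) u * ennreal (1 / norm (u - c)) \<le>
        (\<Sum>k. ennreal (2 ^ (k+1) / s) * indicator (ball c (s / 2 ^ k)) u)" for u
  proof (cases "u \<in> ball c s \<and> u \<noteq> c")
    case True
    define r where "r = norm (u - c)"
    have r: "0 < r" "r < s" using True unfolding r_def by (auto simp: dist_norm norm_minus_commute)
    have "\<exists>n. s < r * 2 ^ n"
      using real_arch_pow[of 2 "s / r"] r by (auto simp: field_simps)
    then obtain n where n: "s < r * 2 ^ n" and least: "\<And>m. m < n \<Longrightarrow> \<not> s < r * 2 ^ m"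
      using exists_least_iff[of "\<lambda>n. s < r * 2 ^ n"] by auto
    have "n \<noteq> 0" using n r by (intro notI) auto
    then obtain k where k: "n = Suc k" using not0_implies_Suc by blast
    show ?thesis
    proof (cases "r * 2 ^ k = s")
      case False
      then have "r < s / 2 ^ k" using least[of k] k by (auto simp: field_simps)
      then have "indicator (ball c s) u * ennreal (1 / norm (u - c)) \<le> ennreal (2 ^ (k+1) / s) * indicator (ball c (s / 2 ^ k)) u"
        using n r k s by (auto simp: r_def indicator_def dist_norm norm_minus_commute field_simps intro!: ennreal_leI)
      also have "\<dots> \<le> (\<Sum>k. ennreal (2 ^ (k+1) / s) * indicator (ball c (s / 2 ^ k)) u)"
        by (rule le_suminf_ennreal[of "\<lambda>k. ennreal (2 ^ (k+1) / s) * indicator (ball c (s / 2 ^ k)) u" k])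
      finally show ?thesis .
    next
      \<comment> \<open>Here u lies on the circle of radius s/2^k and so outside the open disc; the
        disc with index k - 1 contains it and has the right factor 2^k/s.\<close>
      case True
      then have "k \<noteq> 0" using r by (intro notI) auto
      then obtain j where j: "k = Suc j" using not0_implies_Suc by blast
      have "r < s / 2 ^ j" using True j r s by (auto simp: field_simps)
      then have "indicator (ball c s) u * ennreal (1 / norm (u - c)) \<le> ennreal (2 ^ (j+1) / s) * indicator (ball c (s / 2 ^ j)) u"
        using True r j s by (auto simp: r_def indicator_def dist_norm norm_minus_commute field_simps intro!: ennreal_leI)
      also have "\<dots> \<le> (\<Sum>k. ennreal (2 ^ (k+1) / s) * indicator (ball c (s / 2 ^ k)) u)"
        by (rule le_suminf_ennreal[of "\<lambda>k. ennreal (2 ^ (k+1) / s) * indicator (ball c (s / 2 ^ k)) u" j])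
      finally show ?thesis .
    qed
  qed (auto simp: indicator_def)
  have "(\<integral>\<^sup>+u. indicator (ball c s) u * ennreal (1 / norm (u - c)) \<partial>lborel) \<le>
        (\<integral>\<^sup>+u. (\<Sum>k. ennreal (2 ^ (k+1) / s) * indicator (ball c (s / 2 ^ k)) u) \<partial>lborel)"
    by (intro nn_integral_mono pt)
  also have "\<dots> = (\<Sum>k. \<integral>\<^sup>+u. ennreal (2 ^ (k+1) / s) * indicator (ball c (s / 2 ^ k)) u \<partial>lborel)"
    by (intro nn_integral_suminf) measurable
  also have "\<dots> = (\<Sum>k. ennreal (2 * pi * s * (1/2) ^ k))"
  proof (intro suminf_cong)
    fix k
    have "(\<integral>\<^sup>+u. ennreal (2 ^ (k+1) / s) * indicator (ball c (s / 2 ^ k)) u \<partial>lborel)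
         = ennreal (2 ^ (k+1) / s) * ennreal (pi * (s / 2 ^ k)\<^sup>2)"
      using s by (simp add: nn_integral_cmult emeasure_ball unit_ball_vol_2)
    also have "\<dots> = ennreal (2 ^ (k+1) / s * (pi * (s / 2 ^ k)\<^sup>2))"
      by (rule ennreal_mult[symmetric]) (use s in auto)
    also have "2 ^ (k+1) / s * (pi * (s / 2 ^ k)\<^sup>2) = 2 * pi * s * (1/2) ^ k"
      using s by (simp add: power2_eq_square power_one_over field_simps)
    finally show "(\<integral>\<^sup>+u. ennreal (2 ^ (k+1) / s) * indicator (ball c (s / 2 ^ k)) u \<partial>lborel) = ennreal (2 * pi * s * (1/2) ^ k)" .
  qed
  also have "\<dots> = ennreal (2 * pi * s * 2)"
    using s geometric_sums[of "1/2::real"]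
    by (intro suminf_ennreal_eq sums_mult) auto
  finally show ?thesis by (simp add: mult.commute mult.left_commute)
qed

text \<open>The same decomposition outwards: the annulus from s 2^k to s 2^(k+1) contributes at most
  4 pi/(s 2^k), which is summable because the cube beats the area.\<close>

lemma nn_integral_outside_ball_inverse_cube:
  fixes c :: complex
  assumes s: "s > 0"
  shows "(\<integral>\<^sup>+u. indicator (- ball c s) u * ennreal (1 / norm (u - c) ^ 3) \<partial>lborel) \<le> ennreal (8 * pi / s)"
proof -
  have pt: "indicator (- ball c s) u * ennreal (1 / norm (u - c) ^ 3) \<le>
        (\<Sum>k. ennreal (1 / (s * 2 ^ k) ^ 3) * indicator (ball c (s * 2 ^ (k+1))) u)" for u
  proof (cases "u \<in> ball c s")
    case False
    define r where "r = norm (u - c)"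
    have r: "s \<le> r" "0 < r" using False s unfolding r_def by (auto simp: dist_norm norm_minus_commute)
    have "\<exists>n. r < s * 2 ^ n"
      using real_arch_pow[of 2 "r / s"] s by (auto simp: field_simps)
    then obtain n where n: "r < s * 2 ^ n" and least: "\<And>m. m < n \<Longrightarrow> \<not> r < s * 2 ^ m"
      using exists_least_iff[of "\<lambda>n. r < s * 2 ^ n"] by auto
    have "n \<noteq> 0" using n r by (intro notI) auto
    then obtain k where k: "n = Suc k" using not0_implies_Suc by blast
    have "s * 2 ^ k \<le> r" using least[of k] k by simp
    then have "1 / r ^ 3 \<le> 1 / (s * 2 ^ k) ^ 3"
      using s by (intro divide_left_mono power_mono) (auto intro!: mult_pos_pos r)
    then have "indicator (- ball c s) u * ennreal (1 / norm (u - c) ^ 3) \<le> ennreal (1 / (s * 2 ^ k) ^ 3) * indicator (ball c (s * 2 ^ (k+1))) u"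
      using n k False by (auto simp: r_def indicator_def dist_norm norm_minus_commute intro!: ennreal_leI)
    also have "\<dots> \<le> (\<Sum>k. ennreal (1 / (s * 2 ^ k) ^ 3) * indicator (ball c (s * 2 ^ (k+1))) u)"
      by (rule le_suminf_ennreal[of "\<lambda>k. ennreal (1 / (s * 2 ^ k) ^ 3) * indicator (ball c (s * 2 ^ (k+1))) u" k])
    finally show ?thesis .
  qed (auto simp: indicator_def)
  have "(\<integral>\<^sup>+u. indicator (- ball c s) u * ennreal (1 / norm (u - c) ^ 3) \<partial>lborel) \<le>
        (\<integral>\<^sup>+u. (\<Sum>k. ennreal (1 / (s * 2 ^ k) ^ 3) * indicator (ball c (s * 2 ^ (k+1))) u) \<partial>lborel)"
    by (intro nn_integral_mono pt)
  also have "\<dots> = (\<Sum>k. \<integral>\<^sup>+u. ennreal (1 / (s * 2 ^ k) ^ 3) * indicator (ball c (s * 2 ^ (k+1))) u \<partial>lborel)"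
    by (intro nn_integral_suminf) measurable
  also have "\<dots> = (\<Sum>k. ennreal (4 * pi / s * (1/2) ^ k))"
  proof (intro suminf_cong)
    fix k
    have "(\<integral>\<^sup>+u. ennreal (1 / (s * 2 ^ k) ^ 3) * indicator (ball c (s * 2 ^ (k+1))) u \<partial>lborel)
         = ennreal (1 / (s * 2 ^ k) ^ 3) * ennreal (pi * (s * 2 ^ (k+1))\<^sup>2)"
      using s by (simp add: nn_integral_cmult emeasure_ball unit_ball_vol_2)
    also have "\<dots> = ennreal (1 / (s * 2 ^ k) ^ 3 * (pi * (s * 2 ^ (k+1))\<^sup>2))"
      by (rule ennreal_mult[symmetric]) (use s in auto)
    also have "1 / (s * 2 ^ k) ^ 3 * (pi * (s * 2 ^ (k+1))\<^sup>2) = 4 * pi / s * (1/2) ^ k"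
      using s by (simp add: power2_eq_square power3_eq_cube power_one_over field_simps)
    finally show "(\<integral>\<^sup>+u. ennreal (1 / (s * 2 ^ k) ^ 3) * indicator (ball c (s * 2 ^ (k+1))) u \<partial>lborel) = ennreal (4 * pi / s * (1/2) ^ k)" .
  qed
  also have "\<dots> = ennreal (4 * pi / s * 2)"
    using s geometric_sums[of "1/2::real"]
    by (intro suminf_ennreal_eq sums_mult) auto
  finally show ?thesis by (simp add: mult.commute mult.left_commute)
qed

section \<open>Circle means in place of polar coordinates\<close>

lemma null_sets_lborel_sphere: "sphere (c :: 'a::euclidean_space) r \<in> null_sets lborel"
  using negligible_sphere[of c r]
  by (auto simp: null_sets_completion_iff negligible_iff_null_sets)

text \<open>By rotation invariance and Fubini, averaging g over the rotations t in [0, 2 pi] does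
  not change its integral, and the average at almost every \<open>\<zeta>\<close> is
  \<open>k \<zeta>\<close>.\<close>

lemma integral_circle_mean:
  fixes g k :: "complex \<Rightarrow> complex"
  assumes g: "integrable lborel g" and k: "k \<in> borel_measurable borel"
    and mean: "AE \<zeta> in lborel. ((\<lambda>t. g (cis t * \<zeta>)) has_integral (2 * pi * k \<zeta>)) {0..2*pi}"
  shows "(\<integral>\<zeta>. g \<zeta> \<partial>lborel) = (\<integral>\<zeta>. k \<zeta> \<partial>lborel)"
proof -
  have [measurable]: "g \<in> borel_measurable borel" "k \<in> borel_measurable borel" using g k by auto
  have [measurable]: "cis \<in> borel_measurable borel"
    by (intro borel_measurable_continuous_onI continuous_intros)
  define H where "H = (\<lambda>t \<zeta>. indicator {0..2*pi} t *\<^sub>R g (cis t * \<zeta>))"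
  have H: "integrable (lborel \<Otimes>\<^sub>M lborel) (case_prod H)"
  proof (rule lborel_pair.Fubini_integrable)
    show "case_prod H \<in> borel_measurable (lborel \<Otimes>\<^sub>M lborel)"
      unfolding H_def by measurable
    have "(\<integral>\<zeta>. norm (H t \<zeta>) \<partial>lborel) = indicator {0..2*pi} t * (\<integral>\<zeta>. norm (g \<zeta>) \<partial>lborel)" for t
      using integral_lborel_rotate[of "\<lambda>\<zeta>. norm (g \<zeta>)" "cis t"] unfolding H_def by simp
    then show "integrable lborel (\<lambda>t. \<integral>\<zeta>. norm (case_prod H (t, \<zeta>)) \<partial>lborel)" by simp
    show "AE t in lborel. integrable lborel (\<lambda>\<zeta>. case_prod H (t, \<zeta>))"
      using integrable_lborel_rotate[OF g] unfolding H_def by (intro AE_I2) simp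
  qed
  have "2 * pi * (\<integral>\<zeta>. g \<zeta> \<partial>lborel) = (\<integral>t. indicator {0..2*pi} t *\<^sub>R (\<integral>\<zeta>. g \<zeta> \<partial>lborel) \<partial>lborel)"
    by (simp add: scaleR_conv_of_real)
  also have "\<dots> = (\<integral>t. \<integral>\<zeta>. H t \<zeta> \<partial>lborel \<partial>lborel)"
    using integral_lborel_rotate[of g] unfolding H_def by simp
  also have "\<dots> = (\<integral>\<zeta>. \<integral>t. H t \<zeta> \<partial>lborel \<partial>lborel)"
    by (rule lborel_pair.Fubini_integral[OF H, symmetric])
  also have "\<dots> = (\<integral>\<zeta>. 2 * pi * k \<zeta> \<partial>lborel)"
  proof (rule integral_cong_AE)
    have "AE \<zeta> in lborel. integrable lborel (\<lambda>t. H t \<zeta>)"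
      using lborel_pair.AE_integrable_snd[OF H] .
    with mean show "AE \<zeta> in lborel. (\<integral>t. H t \<zeta> \<partial>lborel) = 2 * pi * k \<zeta>"
    proof eventually_elim
      case (elim \<zeta>)
      have eq: "(\<lambda>t. H t \<zeta>) = (\<lambda>t. if t \<in> {0..2*pi} then g (cis t * \<zeta>) else 0)"
        by (auto simp: H_def)
      have "((\<lambda>t. H t \<zeta>) has_integral (2 * pi * k \<zeta>)) UNIV"
        using elim(1) unfolding eq by (simp only: has_integral_restrict_UNIV)
      then show ?case using has_integral_integral_lborel[OF elim(2)] has_integral_unique by blast
    qed
  qed (unfold H_def, measurable)
  finally show ?thesis by simp
qed

text \<open>On \<open>\<bar>\<zeta>\<bar> = r\<close> the circle mean of \<open>\<zeta> h \<zeta>\<close> is \<open>1 / (2 \<pi> \<i>)\<close> times a contour integral of \<open>h\<close>.\<close>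

lemma has_integral_circle:
  fixes k \<zeta> :: complex
  assumes "((\<lambda>u. \<zeta> * h (\<zeta> * u)) has_contour_integral 2 * pi * \<i> * k) (circlepath 0 1)"
  shows "((\<lambda>t. (cis t * \<zeta>) * h (cis t * \<zeta>)) has_integral 2 * pi * k) {0..2*pi}"
proof -
  have "((\<lambda>t. \<zeta> * h (\<zeta> * cis t) * \<i> * cis t) has_integral 2 * pi * \<i> * k) {0..2*pi}"
    using assms unfolding circlepath_def
    by (subst (asm) has_contour_integral_part_circlepath_iff) auto
  then have "((\<lambda>t. (-\<i>) * (\<zeta> * h (\<zeta> * cis t) * \<i> * cis t)) has_integral (-\<i>) * (2 * pi * \<i> * k)) {0..2*pi}"
    by (rule has_integral_mult_right)
  then show ?thesis by (simp add: mult_ac)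
qed

text \<open>On the circle |\<open>\<zeta>\<close>| = r the mean of
  \<open>\<zeta> / (\<zeta> - w)\<close> is 1 for r > |w| and 0 for r < |w|, by Cauchy's formula and
  Cauchy's theorem. The integral is therefore the area of the annulus |w| < |\<open>\<zeta>\<close>|
  < \<open>\<delta>\<close>, which is empty if |w| >= \<open>\<delta>\<close>.\<close>

lemma integral_ball_cauchy_kernel:
  assumes \<delta>: "\<delta> > 0"
  shows "integrable lborel (\<lambda>\<zeta>. indicator (ball 0 \<delta>) \<zeta> *\<^sub>R (\<zeta> / (\<zeta> - w)))"
    and "(\<integral>\<zeta>. indicator (ball 0 \<delta>) \<zeta> *\<^sub>R (\<zeta> / (\<zeta> - w)) \<partial>lborel) = complex_of_real (pi * max 0 (\<delta>\<^sup>2 - (norm w)\<^sup>2))"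
proof -
  let ?g = "\<lambda>\<zeta>. indicator (ball 0 \<delta>) \<zeta> *\<^sub>R (\<zeta> / (\<zeta> - w))"
  let ?k = "\<lambda>\<zeta>::complex. complex_of_real (indicator (ball 0 \<delta> - cball 0 (norm w)) \<zeta>)"
  show int: "integrable lborel ?g"
  proof (rule integrableI_bounded)
    have "(\<integral>\<^sup>+\<zeta>. ennreal (norm (?g \<zeta>)) \<partial>lborel) \<le>
          (\<integral>\<^sup>+\<zeta>. ennreal \<delta> * (indicator (ball w (\<delta> + norm w)) \<zeta> * ennreal (1 / norm (\<zeta> - w))) \<partial>lborel)"
    proof (rule nn_integral_mono)
      fix \<zeta> :: complex
      show "ennreal (norm (?g \<zeta>)) \<le> ennreal \<delta> * (indicator (ball w (\<delta> + norm w)) \<zeta> * ennreal (1 / norm (\<zeta> - w)))"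
      proof (cases "\<zeta> \<in> ball 0 \<delta>")
        case True
        then have "\<zeta> \<in> ball w (\<delta> + norm w)"
          using norm_triangle_ineq4[of w \<zeta>] by (simp add: dist_norm)
        moreover have "norm \<zeta> / norm (\<zeta> - w) \<le> \<delta> * (1 / norm (\<zeta> - w))"
          using True by (simp add: divide_right_mono)
        ultimately show ?thesis
          using True \<delta> by (simp add: norm_divide ennreal_mult[symmetric] ennreal_leI)
      qed simp
    qed
    also have "\<dots> = ennreal \<delta> * (\<integral>\<^sup>+\<zeta>. (indicator (ball w (\<delta> + norm w)) \<zeta> * ennreal (1 / norm (\<zeta> - w))) \<partial>lborel)"
      by (rule nn_integral_cmult) measurable
    also have "\<dots> \<le> ennreal \<delta> * ennreal (4 * pi * (\<delta> + norm w))"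
      using \<delta> by (intro mult_left_mono nn_integral_ball_inverse_norm) (auto intro: add_pos_nonneg)
    also have "\<dots> < \<infinity>" by (simp add: ennreal_mult_less_top)
    finally show "(\<integral>\<^sup>+\<zeta>. ennreal (norm (?g \<zeta>)) \<partial>lborel) < \<infinity>" .
  qed measurable
  have "(\<integral>\<zeta>. ?g \<zeta> \<partial>lborel) = (\<integral>\<zeta>. ?k \<zeta> \<partial>lborel)"
  proof (rule integral_circle_mean[OF int])
    have "AE \<zeta>::complex in lborel. \<zeta> \<notin> sphere 0 (norm w) \<union> {0}"
      using null_sets_lborel_sphere[of 0 "norm w"] null_sets_lborel_sphere[of "0::complex" 0]
      by (intro AE_not_in null_sets.Un) simp_all
    then show "AE \<zeta> in lborel. ((\<lambda>t. ?g (cis t * \<zeta>)) has_integral (2 * pi * ?k \<zeta>)) {0..2*pi}"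
    proof eventually_elim
      case (elim \<zeta>)
      then have nz: "\<zeta> \<noteq> 0" "norm \<zeta> \<noteq> norm w" by auto
      show ?case
      proof (cases "\<zeta> \<in> ball 0 \<delta>")
        case True
        have eq: "\<zeta> * (1 / (\<zeta> * u - w)) = 1 / (u - w / \<zeta>)" for u
          using nz by (simp add: divide_simps) (simp add: algebra_simps)
        have "((\<lambda>u. \<zeta> * (1 / (\<zeta> * u - w))) has_contour_integral 2 * pi * \<i> * ?k \<zeta>) (circlepath 0 1)"
        proof (cases "norm w < norm \<zeta>")
          case 1: True
          have "((\<lambda>u. 1 / (u - w / \<zeta>)) has_contour_integral 2 * pi * \<i> * 1) (circlepath 0 1)"
            using Cauchy_integral_circlepath_simple[of "\<lambda>_. 1" 0 1 "w / \<zeta>"] 1 nz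
            by (simp add: norm_divide)
          then show ?thesis using True 1 unfolding eq by simp
        next
          case 2: False
          then have lt: "1 < norm (w / \<zeta>)" using nz by (simp add: norm_divide)
          have "((\<lambda>u. 1 / (u - w / \<zeta>)) has_contour_integral 0) (circlepath 0 1)"
            by (rule Cauchy_theorem_disc_simple[of _ 0 "norm (w / \<zeta>)"])
               (use lt in \<open>auto intro!: holomorphic_intros simp del: norm_divide\<close>)
          then show ?thesis using True 2 unfolding eq by simp
        qed
        from has_integral_circle[OF this] show ?thesis
          using True by (simp add: norm_mult)
      qed (simp add: norm_mult)
    qed
  qed measurable
  also have "\<dots> = complex_of_real (measure lborel (ball 0 \<delta> - cball 0 (norm w) :: complex set))"
    by simp
  also have "measure lborel (ball 0 \<delta> - cball 0 (norm w) :: complex set) = pi * max 0 (\<delta>\<^sup>2 - (norm w)\<^sup>2)"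
  proof (cases "norm w < \<delta>")
    case True
    then have "measure lborel (ball 0 \<delta> - cball 0 (norm w) :: complex set) = pi * \<delta>\<^sup>2 - pi * (norm w)\<^sup>2"
      using \<delta> by (subst measure_Diff)
        (auto simp: content_ball content_cball unit_ball_vol_2 emeasure_ball)
    moreover have "(norm w)\<^sup>2 < \<delta>\<^sup>2" using True by (intro power_strict_mono) auto
    ultimately show ?thesis by (simp add: algebra_simps)
  next
    case False
    then have e: "ball 0 \<delta> - cball 0 (norm w) = ({} :: complex set)" by auto
    have "\<delta>\<^sup>2 \<le> (norm w)\<^sup>2" using False \<delta> by (intro power_mono) auto
    then show ?thesis unfolding e by simp
  qed
  finally show "(\<integral>\<zeta>. ?g \<zeta> \<partial>lborel) = complex_of_real (pi * max 0 (\<delta>\<^sup>2 - (norm w)\<^sup>2))" .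
qed

lemma integrable_indicator_ball:
  fixes f :: "complex \<Rightarrow> 'b::euclidean_space"
  assumes "continuous_on UNIV f"
  shows "integrable lborel (\<lambda>\<zeta>. indicator (ball 0 \<delta>) \<zeta> *\<^sub>R f \<zeta>)"
proof -
  have "integrable lborel (\<lambda>\<zeta>. indicator (ball 0 \<delta>) \<zeta> *\<^sub>R (indicator (cball 0 \<delta>) \<zeta> *\<^sub>R f \<zeta>))"
    by (intro integrable_mult_indicator borel_integrable_compact continuous_on_subset[OF assms]) auto
  moreover have "(\<lambda>\<zeta>. indicator (ball 0 \<delta>) \<zeta> *\<^sub>R (indicator (cball 0 \<delta>) \<zeta> *\<^sub>R f \<zeta>)) = (\<lambda>\<zeta>. indicator (ball 0 \<delta>) \<zeta> *\<^sub>R f \<zeta>)"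
    by (auto simp: fun_eq_iff indicator_def)
  ultimately show ?thesis by (simp only:)
qed

text \<open>By Cauchy's theorem the integrand has mean 0 on every circle of radius less than
  \<open>\<delta>\<close> around 0, since \<open>\<eta> - \<zeta>\<close> stays in the disc where
  \<open>F\<close> is holomorphic.\<close>

lemma integral_ball_holomorphic:
  assumes F: "continuous_on UNIV F" "F holomorphic_on ball \<eta> \<delta>"
  shows "(\<integral>\<zeta>. indicator (ball 0 \<delta>) \<zeta> *\<^sub>R (\<zeta> * F (\<eta> - \<zeta>)) \<partial>lborel) = 0"
proof -
  let ?g = "\<lambda>\<zeta>. indicator (ball 0 \<delta>) \<zeta> *\<^sub>R (\<zeta> * F (\<eta> - \<zeta>))"
  have cont: "continuous_on UNIV (\<lambda>\<zeta>. \<zeta> * F (\<eta> - \<zeta>))"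
    by (intro continuous_intros continuous_on_compose2[OF F(1)]) auto
  have int: "integrable lborel ?g" by (rule integrable_indicator_ball[OF cont])
  have "(\<integral>\<zeta>. ?g \<zeta> \<partial>lborel) = (\<integral>\<zeta>. 0 \<partial>(lborel :: complex measure))"
  proof (rule integral_circle_mean[OF int, of "\<lambda>_. 0"])
    show "AE \<zeta> in lborel. ((\<lambda>t. ?g (cis t * \<zeta>)) has_integral complex_of_real (2 * pi) * 0) {0..2*pi}"
    proof (rule AE_I2)
      fix \<zeta> :: complex
      show "((\<lambda>t. ?g (cis t * \<zeta>)) has_integral complex_of_real (2 * pi) * 0) {0..2*pi}"
      proof (cases "\<zeta> \<in> ball 0 \<delta> \<and> \<zeta> \<noteq> 0")
        case True
        have "((\<lambda>u. \<zeta> * F (\<eta> - \<zeta> * u)) has_contour_integral 0) (circlepath 0 1)"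
        proof (rule Cauchy_theorem_disc_simple[of _ 0 "\<delta> / norm \<zeta>"])
          have "(\<lambda>u. F (\<eta> - \<zeta> * u)) holomorphic_on ball 0 (\<delta> / norm \<zeta>)"
          proof (rule holomorphic_on_compose_gen[OF _ F(2), unfolded o_def])
            show "(\<lambda>u. \<eta> - \<zeta> * u) holomorphic_on ball 0 (\<delta> / norm \<zeta>)" by (intro holomorphic_intros)
            show "(\<lambda>u. \<eta> - \<zeta> * u) ` ball 0 (\<delta> / norm \<zeta>) \<subseteq> ball \<eta> \<delta>"
              using True by (auto simp: dist_norm norm_mult field_simps)
          qed
          then show "(\<lambda>u. \<zeta> * F (\<eta> - \<zeta> * u)) holomorphic_on ball 0 (\<delta> / norm \<zeta>)"
            by (intro holomorphic_intros)
          show "path_image (circlepath 0 1) \<subseteq> ball 0 (\<delta> / norm \<zeta>)"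
            using True by (auto simp: field_simps)
        qed auto
        then have "((\<lambda>u. \<zeta> * F (\<eta> - \<zeta> * u)) has_contour_integral complex_of_real (2 * pi) * \<i> * 0) (circlepath 0 1)" by simp
        from has_integral_circle[of _ "\<lambda>u. F (\<eta> - u)", OF this] show ?thesis
          using True by (simp add: norm_mult)
      qed (auto simp: norm_mult)
    qed
  qed measurable
  then show ?thesis by simp
qed

section \<open>Smoothing by Cauchy transforms\<close>

lemma integrable_lborel_product:
  fixes f :: "'a::euclidean_space \<Rightarrow> real" and g :: "'b::euclidean_space \<Rightarrow> real"
  assumes "integrable lborel f" "integrable lborel g"
  shows "integrable (lborel \<Otimes>\<^sub>M lborel) (\<lambda>(x, y). f x * g y)"
proof (rule lborel_pair.Fubini_integrable)
  have [measurable]: "f \<in> borel_measurable borel" "g \<in> borel_measurable borel" using assms by auto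
  show "(\<lambda>(x, y). f x * g y) \<in> borel_measurable (lborel \<Otimes>\<^sub>M lborel)" by measurable
  show "integrable lborel (\<lambda>x. \<integral>y. norm (case (x, y) of (x, y) \<Rightarrow> f x * g y) \<partial>lborel)"
    using assms by (simp add: norm_mult abs_mult)
  show "AE x in lborel. integrable lborel (\<lambda>y. case (x, y) of (x, y) \<Rightarrow> f x * g y)"
    using assms by simp
qed

lemma integrable_ball_inverse_norm:
  assumes "s > 0"
  shows "integrable lborel (\<lambda>\<eta>::complex. indicator (ball c s) \<eta> * (1 / norm (\<eta> - z)))"
proof (rule integrableI_bounded)
  have "(\<integral>\<^sup>+\<eta>. ennreal (norm (indicator (ball c s) \<eta> * (1 / norm (\<eta> - z)))) \<partial>lborel) \<le>
        (\<integral>\<^sup>+\<eta>. indicator (ball z (s + norm (z - c))) \<eta> * ennreal (1 / norm (\<eta> - z)) \<partial>lborel)"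
  proof (rule nn_integral_mono)
    fix \<eta> :: complex
    have "\<eta> \<in> ball z (s + norm (z - c))" if "\<eta> \<in> ball c s"
      using that dist_triangle[of z \<eta> c] by (simp add: dist_norm norm_minus_commute)
    then show "ennreal (norm (indicator (ball c s) \<eta> * (1 / norm (\<eta> - z)))) \<le> 
       indicator (ball z (s + norm (z - c))) \<eta> * ennreal (1 / norm (\<eta> - z))"
      by (auto simp: indicator_def)
  qed
  also have "\<dots> \<le> ennreal (4 * pi * (s + norm (z - c)))"
    using assms by (intro nn_integral_ball_inverse_norm) (auto intro: add_pos_nonneg)
  also have "\<dots> < \<infinity>" by simp
  finally show "(\<integral>\<^sup>+\<eta>. ennreal (norm (indicator (ball c s) \<eta> * (1 / norm (\<eta> - z)))) \<partial>lborel) < \<infinity>" .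
qed measurable

text \<open>On the disc of half the radius the kernel is at least 3/4 \<open>\<delta>\<close>^2.
  This loses only a constant against the exact mass pi \<open>\<delta>\<close>^4/2.\<close>

lemma smoothing_kernel_mass:
  assumes "\<delta> > 0"
  shows "(\<integral>w. indicator (ball 0 \<delta>) w *\<^sub>R (\<delta>\<^sup>2 - (norm w)\<^sup>2) \<partial>(lborel :: complex measure)) \<ge> 3 * pi * \<delta> ^ 4 / 16"
proof -
  have "(\<integral>w. indicator (ball 0 (\<delta>/2)) w *\<^sub>R (3/4 * \<delta>\<^sup>2) \<partial>(lborel :: complex measure)) \<le>
        (\<integral>w. indicator (ball 0 \<delta>) w *\<^sub>R (\<delta>\<^sup>2 - (norm w)\<^sup>2) \<partial>(lborel :: complex measure))"
  proof (rule integral_mono)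
    fix w :: complex
    show "indicator (ball 0 (\<delta>/2)) w *\<^sub>R (3/4 * \<delta>\<^sup>2) \<le> indicator (ball 0 \<delta>) w *\<^sub>R (\<delta>\<^sup>2 - (norm w)\<^sup>2)"
    proof (cases "w \<in> ball 0 (\<delta>/2)")
      case True
      then have "(norm w)\<^sup>2 \<le> (\<delta>/2)\<^sup>2" by (intro power_mono) auto
      moreover have "norm w < \<delta>" using True assms by simp
      ultimately show ?thesis using True by (simp add: indicator_def power_divide)
    next
      case False
      have "(norm w)\<^sup>2 \<le> \<delta>\<^sup>2" if "norm w < \<delta>" using that by (intro power_mono) auto
      then show ?thesis using False by (simp add: indicator_def)
    qed
  qed (intro integrable_indicator_ball continuous_intros)+
  then show ?thesis using assms
    by (simp add: content_ball unit_ball_vol_2 power2_eq_square power4_eq_xxxx field_simps)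
qed

text \<open>
  Smoothing \<open>F\<close> with the kernel \<open>A w = max 0 (\<delta>\<^sup>2 - \<bar>w\<bar>\<^sup>2)\<close>: since \<open>\<pi> A\<close> is the Cauchy transform of
  \<open>\<zeta>\<close> restricted to \<open>ball 0 \<delta>\<close>, the smoothed function is the Cauchy transform of the density
  \<open>\<nu>\<close>, which vanishes wherever \<open>F\<close> is holomorphic on a disc of radius \<open>\<delta>\<close>.
\<close>

lemma cauchy_transform_smoothing:
  assumes F: "continuous_on UNIV F" and supp: "\<And>z. R \<le> norm z \<Longrightarrow> F z = 0"
    and \<delta>: "\<delta> > 0" and \<epsilon>: "\<And>x y. norm (x - y) < \<delta> \<Longrightarrow> norm (F x - F y) \<le> \<epsilon>"
  obtains \<nu> where "\<nu> \<in> borel_measurable borel" "\<And>\<eta>. norm (\<nu> \<eta>) \<le> 2 * \<epsilon> / \<delta>"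
    "\<And>\<eta>. F holomorphic_on ball \<eta> \<delta> \<Longrightarrow> \<nu> \<eta> = 0"
    "\<And>z. norm (F z - (\<integral>\<eta>. \<nu> \<eta> / (z - \<eta>) \<partial>lborel)) \<le> \<epsilon>"
proof -
  have [measurable]: "F \<in> borel_measurable borel" using F by (rule borel_measurable_continuous_onI)
  have \<epsilon>0: "\<epsilon> \<ge> 0" using \<epsilon>[of 0 0] \<delta> by simp
  have Fcomp: "continuous_on UNIV (\<lambda>\<zeta>. F (\<eta> - \<zeta>))" for \<eta>
    by (intro continuous_on_compose2[OF F] continuous_intros) auto
  define B where "B = (\<lambda>\<zeta>::complex. indicator (ball 0 \<delta>) \<zeta> *\<^sub>R \<zeta>)"
  have [measurable]: "B \<in> borel_measurable borel" unfolding B_def by measurable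
  define A where "A = (\<lambda>w::complex. indicator (ball 0 \<delta>) w *\<^sub>R (\<delta>\<^sup>2 - (norm w)\<^sup>2))"
  have [measurable]: "A \<in> borel_measurable borel" unfolding A_def by measurable
  define m where "m = (\<integral>w. A w \<partial>lborel)"
  define \<mu> where "\<mu> = (\<lambda>\<eta>. \<integral>u. F u * B (\<eta> - u) \<partial>lborel)"
  have m: "m \<ge> 3 * pi * \<delta> ^ 4 / 16" unfolding m_def A_def by (rule smoothing_kernel_mass[OF \<delta>])
  then have m0: "m > 0" using \<delta> by (smt (verit) divide_pos_pos mult_pos_pos pi_gt_zero zero_less_power)
  have \<mu>_alt: "\<mu> \<eta> = (\<integral>\<zeta>. indicator (ball 0 \<delta>) \<zeta> *\<^sub>R (\<zeta> * F (\<eta> - \<zeta>)) \<partial>lborel)" for \<eta>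
    using integral_lborel_reflect[of "\<lambda>u. F u * B (\<eta> - u)" \<eta>] unfolding \<mu>_def B_def
    by (simp add: mult.commute)
  have \<mu>_holo: "\<mu> \<eta> = 0" if "F holomorphic_on ball \<eta> \<delta>" for \<eta>
    unfolding \<mu>_alt by (rule integral_ball_holomorphic[OF F that])
  \<comment> \<open>The integral of \<open>\<zeta>\<close> times the constant
    \<open>F \<eta>\<close> over the disc vanishes. Subtracting it replaces the size of
    \<open>F\<close> by its oscillation \<open>\<epsilon>\<close>.\<close>
  have \<mu>_bound: "norm (\<mu> \<eta>) \<le> \<epsilon> * \<delta> * (pi * \<delta>\<^sup>2)" for \<eta>
  proof -
    have "\<mu> \<eta> = (\<integral>\<zeta>. indicator (ball 0 \<delta>) \<zeta> *\<^sub>R (\<zeta> * F (\<eta> - \<zeta>)) \<partial>lborel) -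
                (\<integral>\<zeta>. indicator (ball 0 \<delta>) \<zeta> *\<^sub>R (\<zeta> * F \<eta>) \<partial>lborel)"
      unfolding \<mu>_alt using integral_ball_holomorphic[of "\<lambda>_. F \<eta>" 0 \<delta>] by simp
    also have "\<dots> = (\<integral>\<zeta>. indicator (ball 0 \<delta>) \<zeta> *\<^sub>R (\<zeta> * F (\<eta> - \<zeta>)) - indicator (ball 0 \<delta>) \<zeta> *\<^sub>R (\<zeta> * F \<eta>) \<partial>lborel)"
      by (intro Bochner_Integration.integral_diff[symmetric] integrable_indicator_ball continuous_intros Fcomp)
    finally have eq: "\<mu> \<eta> = (\<integral>\<zeta>. indicator (ball 0 \<delta>) \<zeta> *\<^sub>R (\<zeta> * F (\<eta> - \<zeta>)) - indicator (ball 0 \<delta>) \<zeta> *\<^sub>R (\<zeta> * F \<eta>) \<partial>lborel)" .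
    have "norm (\<mu> \<eta>) \<le> (\<integral>\<zeta>. indicator (ball 0 \<delta>) \<zeta> *\<^sub>R (\<epsilon> * \<delta>) \<partial>(lborel :: complex measure))"
      unfolding eq
    proof (rule Bochner_Integration.integral_norm_bound_integral)
      fix \<zeta> :: complex
      show "norm (indicator (ball 0 \<delta>) \<zeta> *\<^sub>R (\<zeta> * F (\<eta> - \<zeta>)) - indicator (ball 0 \<delta>) \<zeta> *\<^sub>R (\<zeta> * F \<eta>))
        \<le> indicator (ball 0 \<delta>) \<zeta> *\<^sub>R (\<epsilon> * \<delta>)"
      proof (cases "\<zeta> \<in> ball 0 \<delta>")
        case True
        then have "norm \<zeta> * norm (F (\<eta> - \<zeta>) - F \<eta>) \<le> \<delta> * \<epsilon>"
          using \<delta> by (intro mult_mono \<epsilon>) auto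
        then show ?thesis using True by (simp add: norm_mult[symmetric] algebra_simps)
      qed simp
    qed (intro Bochner_Integration.integrable_diff integrable_indicator_ball continuous_intros Fcomp)+
    then show ?thesis using \<delta> by (simp add: content_ball unit_ball_vol_2 mult_ac)
  qed
  obtain M where M: "M > 0" "\<And>z. norm (F z) \<le> M"
  proof -
    have "bounded (F ` cball 0 R)"
      by (intro compact_imp_bounded compact_continuous_image continuous_on_subset[OF F]) auto
    then obtain M where "M > 0" "\<And>z. z \<in> cball 0 R \<Longrightarrow> norm (F z) \<le> M" unfolding bounded_pos by blast
    then show ?thesis using that[of M] supp by (metis less_imp_le linear mem_cball_0 norm_zero)
  qed
  define R' where "R' = max R 1"
  have R': "R' > 0" unfolding R'_def by simp
  \<comment> \<open>By Fubini, the Cauchy transform of the convolution of \<open>F\<close> with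
    \<open>B\<close> is the convolution of \<open>F\<close> with the transform of \<open>B\<close>,
    which is pi times \<open>A\<close>. Fubini applies because \<open>F u\<close> and
    \<open>B (\<eta> - u)\<close> confine u and \<open>\<eta>\<close> to discs.\<close>
  have identity: "(\<integral>\<eta>. \<mu> \<eta> / (\<eta> - z) \<partial>lborel) = complex_of_real pi * (\<integral>u. F u * complex_of_real (A (z - u)) \<partial>lborel)" for z
  proof -
    define H where "H = (\<lambda>u \<eta>. F u * B (\<eta> - u) / (\<eta> - z))"
    have "integrable (lborel \<Otimes>\<^sub>M lborel) (\<lambda>(u, \<eta>). (M * \<delta> * indicator (ball 0 R') u) *
        (indicator (ball 0 (R' + \<delta>)) \<eta> * (1 / norm (\<eta> - z))))"
      using \<delta> R' by (intro integrable_lborel_product integrable_ball_inverse_norm) (auto simp: emeasure_ball)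
    then have H: "integrable (lborel \<Otimes>\<^sub>M lborel) (case_prod H)"
    proof (rule Bochner_Integration.integrable_bound)
      show "case_prod H \<in> borel_measurable (lborel \<Otimes>\<^sub>M lborel)" unfolding H_def by measurable
      show "AE x in lborel \<Otimes>\<^sub>M lborel. norm (case_prod H x) \<le> norm (case x of (u, \<eta>) \<Rightarrow>
          (M * \<delta> * indicator (ball 0 R') u) * (indicator (ball 0 (R' + \<delta>)) \<eta> * (1 / norm (\<eta> - z))))"
      proof (rule AE_I2)
        fix p :: "complex \<times> complex"
        obtain u \<eta> where p: "p = (u, \<eta>)" by (cases p)
        show "norm (case_prod H p) \<le> norm (case p of (u, \<eta>) \<Rightarrow>
          (M * \<delta> * indicator (ball 0 R') u) * (indicator (ball 0 (R' + \<delta>)) \<eta> * (1 / norm (\<eta> - z))))"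
        proof (cases "norm u < R' \<and> norm (\<eta> - u) < \<delta>")
          case True
          then have "norm \<eta> < R' + \<delta>" using norm_triangle_ineq[of "\<eta> - u" u] by simp
          moreover have "norm (F u) * norm (\<eta> - u) / norm (\<eta> - z) \<le> M * \<delta> / norm (\<eta> - z)"
            using True M by (intro divide_right_mono mult_mono) auto
          ultimately show ?thesis using True M \<delta> by (simp add: p H_def B_def norm_mult norm_divide)
        next
          case False
          then have "F u = 0 \<or> B (\<eta> - u) = 0" using supp unfolding R'_def B_def by auto
          then show ?thesis by (auto simp: p H_def)
        qed
      qed
    qed
    have "(\<integral>\<eta>. \<mu> \<eta> / (\<eta> - z) \<partial>lborel) = (\<integral>\<eta>. \<integral>u. H u \<eta> \<partial>lborel \<partial>lborel)"
      unfolding \<mu>_def H_def by (simp add: divide_inverse)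
    also have "\<dots> = (\<integral>u. \<integral>\<eta>. H u \<eta> \<partial>lborel \<partial>lborel)"
      by (rule lborel_pair.Fubini_integral[OF H])
    also have "\<dots> = (\<integral>u. complex_of_real pi * (F u * complex_of_real (A (z - u))) \<partial>lborel)"
    proof (rule Bochner_Integration.integral_cong[OF refl])
      fix u
      have "(\<integral>\<eta>. H u \<eta> \<partial>lborel) = F u * (\<integral>\<eta>. B (\<eta> - u) / (\<eta> - z) \<partial>lborel)"
        unfolding H_def by (simp add: divide_inverse mult.assoc)
      also have "(\<integral>\<eta>. B (\<eta> - u) / (\<eta> - z) \<partial>lborel) = (\<integral>\<zeta>. B (- \<zeta> - u) / (- \<zeta> - z) \<partial>lborel)"
        using integral_lborel_reflect[of "\<lambda>\<eta>. B (\<eta> - u) / (\<eta> - z)" 0] by (simp add: algebra_simps)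
      also have "\<dots> = (\<integral>\<zeta>. B \<zeta> / (\<zeta> - (z - u)) \<partial>lborel)"
        using integral_lborel_reflect[of "\<lambda>\<zeta>. B (- \<zeta> - u) / (- \<zeta> - z)" "- u"] by (simp add: algebra_simps)
      also have "\<dots> = complex_of_real (pi * max 0 (\<delta>\<^sup>2 - (norm (z - u))\<^sup>2))"
        using integral_ball_cauchy_kernel(2)[OF \<delta>, of "z - u"] unfolding B_def by (simp add: scaleR_conv_of_real)
      also have "max 0 (\<delta>\<^sup>2 - (norm (z - u))\<^sup>2) = A (z - u)"
      proof (cases "norm (z - u) < \<delta>")
        case True
        then have "(norm (z - u))\<^sup>2 \<le> \<delta>\<^sup>2" by (intro power_mono) auto
        then show ?thesis using True unfolding A_def by simp
      next
        case False
        then have "\<delta>\<^sup>2 \<le> (norm (z - u))\<^sup>2" using \<delta> by (intro power_mono) auto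
        then show ?thesis using False unfolding A_def by simp
      qed
      finally show "(\<integral>\<eta>. H u \<eta> \<partial>lborel) = complex_of_real pi * (F u * complex_of_real (A (z - u)))" by simp
    qed
    finally show ?thesis by simp
  qed
  \<comment> \<open>The minus sign turns 1/(\<open>\<eta>\<close> - z) into 1/(z -
    \<open>\<eta>\<close>); after the factor pi cancels, dividing by m gives the smoothing kernel
    mass 1.\<close>
  define \<nu> where "\<nu> = (\<lambda>\<eta>. - \<mu> \<eta> / complex_of_real (pi * m))"
  show thesis
  proof
    show "\<nu> \<in> borel_measurable borel" unfolding \<nu>_def \<mu>_def by measurable
    \<comment> \<open>The bounds on \<open>\<mu>\<close> and m give the factor 16/(3 pi), which is
      below 2.\<close>
    show "norm (\<nu> \<eta>) \<le> 2 * \<epsilon> / \<delta>" for \<eta>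
    proof -
      have "norm (\<nu> \<eta>) = norm (\<mu> \<eta>) / (pi * m)"
        unfolding \<nu>_def using m0 by (simp add: norm_divide norm_mult)
      also have "\<dots> \<le> (\<epsilon> * \<delta> * (pi * \<delta>\<^sup>2)) / (pi * (3 * pi * \<delta> ^ 4 / 16))"
        using \<mu>_bound m \<delta> \<epsilon>0 by (intro frac_le mult_left_mono) auto
      also have "\<dots> = (\<epsilon> / \<delta>) * (16 / (3 * pi))"
        using \<delta> by (simp add: power2_eq_square power4_eq_xxxx)
      also have "\<dots> \<le> (\<epsilon> / \<delta>) * 2"
        using \<delta> \<epsilon>0 pi_gt3 by (intro mult_left_mono) (auto simp: field_simps)
      finally show ?thesis by (simp add: mult.commute)
    qed
    show "\<nu> \<eta> = 0" if "F holomorphic_on ball \<eta> \<delta>" for \<eta>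
      using \<mu>_holo[OF that] unfolding \<nu>_def by simp
    show "norm (F z - (\<integral>\<eta>. \<nu> \<eta> / (z - \<eta>) \<partial>lborel)) \<le> \<epsilon>" for z
    proof -
      have "(\<integral>\<eta>. \<nu> \<eta> / (z - \<eta>) \<partial>lborel) = (\<integral>\<eta>. (1 / complex_of_real (pi * m)) * (\<mu> \<eta> / (\<eta> - z)) \<partial>lborel)"
      proof (rule Bochner_Integration.integral_cong[OF refl])
        fix \<eta>
        have "z - \<eta> = - (\<eta> - z)" by simp
        then show "\<nu> \<eta> / (z - \<eta>) = 1 / complex_of_real (pi * m) * (\<mu> \<eta> / (\<eta> - z))"
          unfolding \<nu>_def by (metis (no_types, lifting) divide_divide_eq_left minus_divide_divide mult.commute mult.left_neutral times_divide_eq_left)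
      qed
      also have "\<dots> = (1 / complex_of_real m) * (\<integral>u. F u * complex_of_real (A (z - u)) \<partial>lborel)"
        unfolding integral_mult_right_zero identity by simp
      also have "(\<integral>u. F u * complex_of_real (A (z - u)) \<partial>lborel) = (\<integral>w. F (z - w) * complex_of_real (A w) \<partial>lborel)"
        using integral_lborel_reflect[of "\<lambda>u. F u * complex_of_real (A (z - u))" z] by simp
      finally have eq: "(\<integral>\<eta>. \<nu> \<eta> / (z - \<eta>) \<partial>lborel) = (1 / complex_of_real m) * (\<integral>w. F (z - w) * complex_of_real (A w) \<partial>lborel)" .
      have intA: "integrable lborel A" unfolding A_def by (intro integrable_indicator_ball continuous_intros)
      have "integrable lborel (\<lambda>w. indicator (ball 0 \<delta>) w *\<^sub>R (F (z - w) * complex_of_real (\<delta>\<^sup>2 - (norm w)\<^sup>2)))"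
        by (intro integrable_indicator_ball continuous_intros Fcomp)
      then have intFA: "integrable lborel (\<lambda>w. F (z - w) * complex_of_real (A w))"
        unfolding A_def by (simp add: scaleR_conv_of_real mult_ac)
      have "complex_of_real m * F z = (\<integral>w. F z * complex_of_real (A w) \<partial>lborel)"
        unfolding m_def using intA by simp
      then have "complex_of_real m * F z - (\<integral>w. F (z - w) * complex_of_real (A w) \<partial>lborel)
             = (\<integral>w. F z * complex_of_real (A w) - F (z - w) * complex_of_real (A w) \<partial>lborel)"
        using intFA intA by simp
      also have "norm \<dots> \<le> (\<integral>w. \<epsilon> * A w \<partial>lborel)"
      proof (rule Bochner_Integration.integral_norm_bound_integral)
        fix w
        show "norm (F z * complex_of_real (A w) - F (z - w) * complex_of_real (A w)) \<le> \<epsilon> * A w"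
        proof (cases "norm w < \<delta>")
          case True
          then have "(norm w)\<^sup>2 \<le> \<delta>\<^sup>2" by (intro power_mono) auto
          then have A0: "A w \<ge> 0" using True unfolding A_def by simp
          have "norm (F z - F (z - w)) * A w \<le> \<epsilon> * A w"
            using A0 True by (intro mult_right_mono \<epsilon>) auto
          moreover have "norm ((F z - F (z - w)) * complex_of_real (A w)) = norm (F z - F (z - w)) * A w"
            using A0 by (simp add: norm_mult)
          ultimately show ?thesis by (simp add: algebra_simps)
        qed (simp add: A_def)
      qed (use intA intFA in auto)
      also have "\<dots> = \<epsilon> * m" unfolding m_def by simp
      finally have b: "norm (complex_of_real m * F z - (\<integral>w. F (z - w) * complex_of_real (A w) \<partial>lborel)) \<le> \<epsilon> * m" .
      have "F z - (\<integral>\<eta>. \<nu> \<eta> / (z - \<eta>) \<partial>lborel) =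
            (complex_of_real m * F z - (\<integral>w. F (z - w) * complex_of_real (A w) \<partial>lborel)) / complex_of_real m"
        unfolding eq using m0 by (simp add: diff_divide_distrib)
      then show ?thesis using b m0 by (simp add: norm_divide divide_le_eq)
    qed
  qed
qed

section \<open>Mergelyan's theorem\<close>

text \<open>The kernel is homogeneous of degree -1 in z - \<open>\<eta>\<close> and
  \<open>\<rho>\<close> together, so its integral over the plane is a constant times
  \<open>\<rho>\<close>. Cubic decay is what makes the far part integrable; quadratic decay would
  fail logarithmically.\<close>

lemma mergelyan_error_kernel:
  fixes z :: complex
  assumes \<rho>: "\<rho> > 0"
  defines "k \<equiv> \<lambda>\<eta>. if norm (z - \<eta>) < 4 * \<rho> then 3000 / \<rho> + 1 / norm (z - \<eta>) else 30 * \<rho>\<^sup>2 / norm (z - \<eta>) ^ 3"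
  shows "integrable lborel k" "(\<integral>\<eta>. k \<eta> \<partial>lborel) \<le> 50000 * pi * \<rho>"
proof -
  define a where "a = (\<lambda>\<eta>. (3000 / \<rho>) * indicator (ball z (4 * \<rho>)) \<eta> :: real)"
  define b where "b = (\<lambda>\<eta>. indicator (ball z (4 * \<rho>)) \<eta> * (1 / norm (\<eta> - z)))"
  define c where "c = (\<lambda>\<eta>. indicator (- ball z (4 * \<rho>)) \<eta> * (1 / norm (\<eta> - z) ^ 3))"
  have k: "k = (\<lambda>\<eta>. a \<eta> + b \<eta> + 30 * \<rho>\<^sup>2 * c \<eta>)"
    unfolding k_def a_def b_def c_def by (auto simp: fun_eq_iff indicator_def dist_norm norm_minus_commute)
  have a: "integrable lborel a" "(\<integral>\<eta>. a \<eta> \<partial>lborel) = 48000 * pi * \<rho>"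
    using \<rho> unfolding a_def by (auto simp: content_ball emeasure_ball unit_ball_vol_2 power2_eq_square)
  have nb: "(\<integral>\<^sup>+\<eta>. ennreal (b \<eta>) \<partial>lborel) \<le> ennreal (16 * pi * \<rho>)"
  proof -
    have "ennreal (b \<eta>) = indicator (ball z (4 * \<rho>)) \<eta> * ennreal (1 / norm (\<eta> - z))" for \<eta>
      unfolding b_def by (simp add: indicator_def)
    then show ?thesis using nn_integral_ball_inverse_norm[of "4 * \<rho>" z] \<rho> by (simp add: mult_ac)
  qed
  have nc: "(\<integral>\<^sup>+\<eta>. ennreal (c \<eta>) \<partial>lborel) \<le> ennreal (2 * pi / \<rho>)"
  proof -
    have "ennreal (c \<eta>) = indicator (- ball z (4 * \<rho>)) \<eta> * ennreal (1 / norm (\<eta> - z) ^ 3)" for \<eta>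
      unfolding c_def by (simp add: indicator_def)
    then show ?thesis using nn_integral_outside_ball_inverse_cube[of "4 * \<rho>" z] \<rho> by simp
  qed
  have [measurable]: "b \<in> borel_measurable borel" "c \<in> borel_measurable borel"
    unfolding b_def c_def by measurable
  have pos: "b \<eta> \<ge> 0" "c \<eta> \<ge> 0" for \<eta> unfolding b_def c_def by auto
  have b: "integrable lborel b"
    using nb pos by (intro integrableI_nonneg) (auto simp: order.strict_trans1)
  have c: "integrable lborel c"
    using nc pos by (intro integrableI_nonneg) (auto simp: order.strict_trans1)
  have ib: "(\<integral>\<eta>. b \<eta> \<partial>lborel) \<le> 16 * pi * \<rho>"
    using nb pos b \<rho> by (simp add: nn_integral_eq_integral)
  have ic: "(\<integral>\<eta>. c \<eta> \<partial>lborel) \<le> 2 * pi / \<rho>"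
    using nc pos c \<rho> by (simp add: nn_integral_eq_integral)
  show "integrable lborel k" unfolding k using a b c by simp
  have "(\<integral>\<eta>. k \<eta> \<partial>lborel) = (\<integral>\<eta>. a \<eta> \<partial>lborel) + (\<integral>\<eta>. b \<eta> \<partial>lborel) + 30 * \<rho>\<^sup>2 * (\<integral>\<eta>. c \<eta> \<partial>lborel)"
    unfolding k using a b c by simp
  also have "\<dots> \<le> 48000 * pi * \<rho> + 16 * pi * \<rho> + 30 * \<rho>\<^sup>2 * (2 * pi / \<rho>)"
    unfolding a(2) using ib ic by (intro add_mono mult_left_mono) auto
  also have "\<dots> = 48076 * pi * \<rho>" using \<rho> by (simp add: power2_eq_square)
  also have "\<dots> \<le> 50000 * pi * \<rho>" using \<rho> by (intro mult_right_mono) auto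
  finally show "(\<integral>\<eta>. k \<eta> \<partial>lborel) \<le> 50000 * pi * \<rho>" .
qed

text \<open>Prescribing 0 outside a disc around \<open>K\<close> before Dugundji's extension gives
  compact support, and with it uniform continuity on the whole plane.\<close>

lemma compact_support_extension:
  fixes f :: "complex \<Rightarrow> complex"
  assumes K: "compact K" and f: "continuous_on K f"
  obtains F R where "continuous_on UNIV F" "R > 0" "\<And>z. z \<in> K \<Longrightarrow> F z = f z" "\<And>z. R \<le> norm z \<Longrightarrow> F z = 0"
    "uniformly_continuous_on UNIV F"
proof -
  obtain R where R: "R > 0" "K \<subseteq> ball 0 R"
    using K by (meson bounded_subset_ballD compact_imp_bounded)
  define h where "h = (\<lambda>z. if z \<in> K then f z else 0)"
  have "continuous_on (K \<union> - ball 0 R) h"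
    unfolding h_def by (rule continuous_on_If) (use K R f in \<open>auto intro: compact_imp_closed\<close>)
  moreover have "closedin (top_of_set UNIV) (K \<union> - ball 0 R)"
    using K by (simp add: closed_Un compact_imp_closed closed_Compl)
  ultimately obtain F where F: "continuous_on UNIV F" "\<And>z. z \<in> K \<union> - ball 0 R \<Longrightarrow> F z = h z"
    using Dugundji[of UNIV UNIV "K \<union> - ball 0 R" h] by auto
  have zero: "F z = 0" if "R \<le> norm z" for z
  proof -
    have "z \<notin> K" "z \<in> - ball 0 R" using that R by auto
    then show ?thesis using F(2)[of z] unfolding h_def by simp
  qed
  have "uniformly_continuous_on UNIV F"
    unfolding uniformly_continuous_on_def
  proof (intro allI impI)
    fix e :: real assume e: "e > 0"
    have "uniformly_continuous_on (cball 0 (R + 1)) F"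
      by (rule compact_uniformly_continuous[OF continuous_on_subset[OF F(1)]]) auto
    then obtain d where d: "d > 0" "\<And>x y. x \<in> cball 0 (R + 1) \<Longrightarrow> y \<in> cball 0 (R + 1) \<Longrightarrow> dist y x < d \<Longrightarrow> dist (F y) (F x) < e"
      using e unfolding uniformly_continuous_on_def by meson
    have "dist (F y) (F x) < e" if "dist y x < min d 1" for x y
    proof (cases "norm x \<le> R + 1 \<and> norm y \<le> R + 1")
      \<comment> \<open>If one of two points at distance less than 1 has modulus above R + 1, both
        have modulus at least R, so both values are 0.\<close>
      case False
      then have "R \<le> norm x" "R \<le> norm y"
        using that norm_triangle_ineq2[of x y] norm_triangle_ineq2[of y x] by (auto simp: dist_norm norm_minus_commute)
      then show ?thesis using zero e by simp
    qed (use that d in auto)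
    then show "\<exists>d>0. \<forall>x\<in>UNIV. \<forall>x'\<in>UNIV. dist x' x < d \<longrightarrow> dist (F x') (F x) < e"
      using d(1) by (intro exI[of _ "min d 1"]) auto
  qed
  then show ?thesis using that[OF F(1) R(1)] F(2) zero unfolding h_def by auto
qed

text \<open>The support of \<open>\<nu>\<close> is cut into disjoint pieces, each in a disc centred
  off \<open>K\<close>. On each piece the substitute kernel is affine in \<open>\<eta>\<close>, so
  integrating it against \<open>\<nu>\<close> leaves only the two moments \<open>\<alpha>\<close>
  and \<open>\<beta>\<close> as coefficients of G and G^2. The error bound does not involve the
  number of pieces, because at each \<open>\<eta>\<close> only one piece contributes.\<close>

lemma cauchy_transform_poly_approximation:
  assumes K: "compact K" "connected (- K)" and \<delta>: "\<delta> > 0" and c: "c \<ge> 0"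
    and \<nu>: "\<nu> \<in> borel_measurable borel" "\<And>\<eta>. norm (\<nu> \<eta>) \<le> c"
    and bdd: "bounded {\<eta>. \<nu> \<eta> \<noteq> 0}" and near: "\<And>\<eta>. \<nu> \<eta> \<noteq> 0 \<Longrightarrow> \<exists>p. p \<notin> K \<and> p \<in> ball \<eta> \<delta>"
  obtains P where "poly_approximable K P"
    "\<And>z. z \<in> K \<Longrightarrow> norm ((\<integral>\<eta>. \<nu> \<eta> / (z - \<eta>) \<partial>lborel) - P z) \<le> 100000 * pi * c * \<delta>"
proof -
  note [measurable] = \<nu>(1)
  define S where "S = {\<eta>. \<nu> \<eta> \<noteq> 0}"
  have "compact (closure S)" using bdd unfolding S_def by simp
  moreover have "closure S \<subseteq> (\<Union>p\<in>-K. ball p (2 * \<delta>))"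
  proof
    fix x assume "x \<in> closure S"
    then obtain \<eta> where \<eta>: "\<eta> \<in> S" "dist \<eta> x < \<delta>" using \<delta> closure_approachable by blast
    then obtain p where p: "p \<notin> K" "dist \<eta> p < \<delta>" using near unfolding S_def by auto
    then have "dist p x < 2 * \<delta>" using \<eta>(2) dist_triangle[of p x \<eta>] by (simp add: dist_commute)
    then show "x \<in> (\<Union>p\<in>-K. ball p (2 * \<delta>))" using p by auto
  qed
  ultimately obtain C where C: "C \<subseteq> - K" "finite C" "closure S \<subseteq> (\<Union>p\<in>C. ball p (2 * \<delta>))"
    using compactE_image[of "closure S" "- K" "\<lambda>p. ball p (2 * \<delta>)"] by (metis open_ball)
  obtain n and p :: "nat \<Rightarrow> complex" where p: "C = p ` {i. i < n}"
    using finite_imp_nat_seg_image_inj_on[OF C(2)] by metis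
  have pK: "p j \<notin> K" if "j < n" for j using C(1) p that by auto
  \<comment> \<open>Removing the earlier discs makes the pieces disjoint, so that the kernel errors
    are integrated once instead of being summed over overlapping discs.\<close>
  define X where "X = (\<lambda>j. ball (p j) (2 * \<delta>) - (\<Union>i<j. ball (p i) (2 * \<delta>)))"
  have [measurable]: "X j \<in> sets borel" for j unfolding X_def by measurable
  have unique: "\<exists>j<n. \<eta> \<in> X j \<and> (\<forall>i<n. i \<noteq> j \<longrightarrow> \<eta> \<notin> X i)" if "\<nu> \<eta> \<noteq> 0" for \<eta>
  proof -
    have "\<eta> \<in> S" using that unfolding S_def by simp
    then have "\<eta> \<in> closure S" by (rule subsetD[OF closure_subset])
    then have "\<eta> \<in> (\<Union>x\<in>C. ball x (2 * \<delta>))" by (rule subsetD[OF C(3)])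
    then have "\<exists>j. j < n \<and> \<eta> \<in> ball (p j) (2 * \<delta>)" unfolding p by blast
    then obtain j where j: "j < n \<and> \<eta> \<in> ball (p j) (2 * \<delta>)" "\<forall>i<j. \<not> (i < n \<and> \<eta> \<in> ball (p i) (2 * \<delta>))"
      unfolding exists_least_iff[of "\<lambda>j. j < n \<and> \<eta> \<in> ball (p j) (2 * \<delta>)"] by metis
    have "\<eta> \<in> X j" using j unfolding X_def by auto
    moreover have "\<eta> \<notin> X i" if "i < n" "i \<noteq> j" for i
    proof (cases "i < j")
      case True
      then show ?thesis using that j(2) unfolding X_def by blast
    next
      case False
      then have "j \<in> {..<i}" using that by simp
      then show ?thesis using j(1) unfolding X_def by blast
    qed
    ultimately show ?thesis using j(1) by blast
  qed
  define k where "k = (\<lambda>(z::complex) \<eta>. if norm (z - \<eta>) < 4 * (2 * \<delta>) then 3000 / (2 * \<delta>) + 1 / norm (z - \<eta>)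
                         else 30 * (2 * \<delta>)\<^sup>2 / norm (z - \<eta>) ^ 3 :: real)"
  have "\<exists>G m. poly_approximable K G \<and> (\<forall>z\<in>K. \<forall>\<zeta>\<in>ball (p j) (2 * \<delta>).
          norm (G z + (\<zeta> - m) * (G z)\<^sup>2 - 1 / (z - \<zeta>)) \<le> k z \<zeta>)" if "j < n" for j
  proof -
    have "2 * \<delta> > 0" using \<delta> by simp
    from cauchy_kernel_approximation[OF K pK[OF that] this] show ?thesis unfolding k_def by metis
  qed
  then obtain G m where G: "\<And>j. j < n \<Longrightarrow> poly_approximable K (G j)"
    and Gm: "\<And>j z \<zeta>. j < n \<Longrightarrow> z \<in> K \<Longrightarrow> \<zeta> \<in> ball (p j) (2 * \<delta>) \<Longrightarrow>
          norm (G j z + (\<zeta> - m j) * (G j z)\<^sup>2 - 1 / (z - \<zeta>)) \<le> k z \<zeta>"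
    by metis
  define \<alpha> where "\<alpha> = (\<lambda>j. \<integral>\<eta>. indicator (X j) \<eta> *\<^sub>R \<nu> \<eta> \<partial>lborel)"
  define \<beta> where "\<beta> = (\<lambda>j. \<integral>\<eta>. indicator (X j) \<eta> *\<^sub>R (\<nu> \<eta> * (\<eta> - m j)) \<partial>lborel)"
  define P where "P = (\<lambda>z. \<Sum>j<n. \<alpha> j * G j z + \<beta> j * (G j z * G j z))"
  obtain R where R: "R > 0" "S \<subseteq> ball 0 R"
    using bdd bounded_subset_ballD unfolding S_def by blast
  have bounded_int: "integrable lborel (\<lambda>\<eta>. \<nu> \<eta> * g \<eta>)"
    if "integrable lborel (\<lambda>\<eta>. indicator (ball 0 R) \<eta> *\<^sub>R g \<eta>)" "g \<in> borel_measurable borel" for g :: "complex \<Rightarrow> complex"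
  proof (rule Bochner_Integration.integrable_bound[OF integrable_mult_right[OF that(1), of "complex_of_real c"]])
    show "(\<lambda>\<eta>. \<nu> \<eta> * g \<eta>) \<in> borel_measurable lborel" using that(2) by simp
    show "AE \<eta> in lborel. norm (\<nu> \<eta> * g \<eta>) \<le> norm (complex_of_real c * indicator (ball 0 R) \<eta> *\<^sub>R g \<eta>)"
    proof (rule AE_I2)
      fix \<eta>
      have "norm (\<nu> \<eta>) * norm (g \<eta>) \<le> c * norm (g \<eta>)" using \<nu>(2) by (intro mult_right_mono) auto
      moreover have "\<nu> \<eta> = 0" if "\<eta> \<notin> ball 0 R" using that R unfolding S_def by auto
      ultimately show "norm (\<nu> \<eta> * g \<eta>) \<le> norm (complex_of_real c * indicator (ball 0 R) \<eta> *\<^sub>R g \<eta>)"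
        using c by (cases "\<eta> \<in> ball 0 R") (auto simp: norm_mult)
    qed
  qed
  have int1: "integrable lborel (\<lambda>\<eta>. indicator (X j) \<eta> *\<^sub>R \<nu> \<eta>)" for j
    using bounded_int[of "\<lambda>_. 1"] integrable_indicator_ball[of "\<lambda>_. 1::complex"]
    by (intro integrable_mult_indicator) auto
  have int2: "integrable lborel (\<lambda>\<eta>. indicator (X j) \<eta> *\<^sub>R (\<nu> \<eta> * (\<eta> - m j)))" for j
    by (intro integrable_mult_indicator bounded_int integrable_indicator_ball continuous_intros) auto
  show thesis
  proof
    show "poly_approximable K P"
      unfolding P_def
      by (intro poly_approximable_sum poly_approximable_add poly_approximable_mult poly_approximable_const G K) auto
    fix z assume z: "z \<in> K"
    have int3: "integrable lborel (\<lambda>\<eta>. \<nu> \<eta> / (z - \<eta>))"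
    proof -
      have "integrable lborel (\<lambda>\<eta>. indicator (ball 0 R) \<eta> *\<^sub>R (1 / (z - \<eta>)))"
      proof (rule Bochner_Integration.integrable_bound[OF integrable_ball_inverse_norm[OF R(1), of 0 z]])
        show "AE \<eta> in lborel. norm (indicator (ball 0 R) \<eta> *\<^sub>R (1 / (z - \<eta>))) \<le> norm (indicator (ball 0 R) \<eta> * (1 / norm (\<eta> - z)))"
          by (auto simp: norm_divide norm_minus_commute)
      qed measurable
      from bounded_int[OF this] show ?thesis by simp
    qed
    \<comment> \<open>The finite sum P is rewritten as the integral of \<open>Q\<close>, whose value
      at \<open>\<eta>\<close> involves only the piece containing \<open>\<eta>\<close>. This
      permits a pointwise comparison with the Cauchy kernel.\<close>
    define Q where "Q = (\<lambda>\<eta>. \<Sum>j<n. G j z * (indicator (X j) \<eta> *\<^sub>R \<nu> \<eta>) + (G j z)\<^sup>2 * (indicator (X j) \<eta> *\<^sub>R (\<nu> \<eta> * (\<eta> - m j))))"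
    note ints = Bochner_Integration.integrable_add integrable_mult_right int1 int2
    have intQ: "integrable lborel Q"
      unfolding Q_def by (intro Bochner_Integration.integrable_sum ints)
    have "(\<integral>\<eta>. Q \<eta> \<partial>lborel) = (\<Sum>j<n. G j z * \<alpha> j + (G j z)\<^sup>2 * \<beta> j)"
      unfolding Q_def \<alpha>_def \<beta>_def
      by (subst Bochner_Integration.integral_sum, intro ints, intro sum.cong refl,
          subst Bochner_Integration.integral_add, (intro ints)+, simp only: integral_mult_right_zero)
    then have PQ: "P z = (\<integral>\<eta>. Q \<eta> \<partial>lborel)"
      unfolding P_def by (simp add: power2_eq_square mult.commute)
    have kint: "integrable lborel (k z)" "(\<integral>\<eta>. k z \<eta> \<partial>lborel) \<le> 50000 * pi * (2 * \<delta>)"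
      using mergelyan_error_kernel[of "2 * \<delta>" z] \<delta> unfolding k_def by auto
    have "norm ((\<integral>\<eta>. \<nu> \<eta> / (z - \<eta>) \<partial>lborel) - P z) = norm (\<integral>\<eta>. \<nu> \<eta> / (z - \<eta>) - Q \<eta> \<partial>lborel)"
      unfolding PQ using int3 intQ by simp
    also have "\<dots> \<le> (\<integral>\<eta>. c * k z \<eta> \<partial>lborel)"
    proof (rule Bochner_Integration.integral_norm_bound_integral)
      fix \<eta>
      have k0: "k z \<eta> \<ge> 0" using \<delta> unfolding k_def by auto
      show "norm (\<nu> \<eta> / (z - \<eta>) - Q \<eta>) \<le> c * k z \<eta>"
      proof (cases "\<nu> \<eta> = 0")
        case True
        then show ?thesis using c k0 unfolding Q_def by simp
      next
        case False
        then obtain j where j: "j < n" "\<eta> \<in> X j" "\<And>i. i < n \<Longrightarrow> i \<noteq> j \<Longrightarrow> \<eta> \<notin> X i" using unique by blast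
        have "Q \<eta> = (\<Sum>i<n. if i = j then G j z * \<nu> \<eta> + (G j z)\<^sup>2 * (\<nu> \<eta> * (\<eta> - m j)) else 0)"
          unfolding Q_def by (intro sum.cong) (use j in auto)
        also have "\<dots> = G j z * \<nu> \<eta> + (G j z)\<^sup>2 * (\<nu> \<eta> * (\<eta> - m j))" using j(1) by simp
        finally have "\<nu> \<eta> / (z - \<eta>) - Q \<eta> = - (\<nu> \<eta> * (G j z + (\<eta> - m j) * (G j z)\<^sup>2 - 1 / (z - \<eta>)))"
          by (simp add: algebra_simps)
        then have "norm (\<nu> \<eta> / (z - \<eta>) - Q \<eta>) = norm (\<nu> \<eta>) * norm (G j z + (\<eta> - m j) * (G j z)\<^sup>2 - 1 / (z - \<eta>))"
          by (simp add: norm_mult)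
        also have "\<dots> \<le> c * k z \<eta>"
          using j z c by (intro mult_mono \<nu>(2) Gm) (auto simp: X_def)
        finally show ?thesis .
      qed
    qed (use int3 intQ kint in auto)
    also have "\<dots> = c * (\<integral>\<eta>. k z \<eta> \<partial>lborel)" by simp
    also have "\<dots> \<le> c * (50000 * pi * (2 * \<delta>))" using kint c by (intro mult_left_mono) auto
    finally show "norm ((\<integral>\<eta>. \<nu> \<eta> / (z - \<eta>) \<partial>lborel) - P z) \<le> 100000 * pi * c * \<delta>" by (simp add: mult_ac)
  qed
qed

text \<open>The smoothing radius cancels: the density is bounded by 2
  \<open>\<epsilon>\<close>/\<open>\<delta>\<close> and the kernel error integrates to a multiple of
  \<open>\<delta>\<close>. The total error is a multiple of \<open>\<epsilon>\<close>, however small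
  uniform continuity forces \<open>\<delta>\<close> to be.\<close>

theorem mergelyan:
  assumes K: "compact K" "connected (- K)" and f: "continuous_on K f" "f holomorphic_on interior K"
  shows "poly_approximable K f"
proof (rule poly_approximable_limit)
  fix e :: real assume e: "e > 0"
  obtain F R where F: "continuous_on UNIV F" "R > 0" "\<And>z. z \<in> K \<Longrightarrow> F z = f z" "\<And>z. R \<le> norm z \<Longrightarrow> F z = 0"
    "uniformly_continuous_on UNIV F"
    using compact_support_extension[OF K(1) f(1)] by metis
  \<comment> \<open>Smoothing costs \<open>\<epsilon>\<close> and replacing the kernel costs 200000
    pi \<open>\<epsilon>\<close>; the 2 in place of 1 makes the final inequality strict.\<close>
  define \<epsilon> where "\<epsilon> = e / (200000 * pi + 2)"
  have \<epsilon>: "\<epsilon> > 0" unfolding \<epsilon>_def using e by (simp add: add_pos_pos)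
  obtain \<delta> where \<delta>: "\<delta> > 0" "\<And>x y. norm (x - y) < \<delta> \<Longrightarrow> norm (F x - F y) \<le> \<epsilon>"
    using F(5) \<epsilon> unfolding uniformly_continuous_on_def dist_norm by (metis UNIV_I less_imp_le)
  obtain \<nu> where \<nu>: "\<nu> \<in> borel_measurable borel" "\<And>\<eta>. norm (\<nu> \<eta>) \<le> 2 * \<epsilon> / \<delta>"
    "\<And>\<eta>. F holomorphic_on ball \<eta> \<delta> \<Longrightarrow> \<nu> \<eta> = 0"
    "\<And>z. norm (F z - (\<integral>\<eta>. \<nu> \<eta> / (z - \<eta>) \<partial>lborel)) \<le> \<epsilon>"
    using cauchy_transform_smoothing[OF F(1) F(4) \<delta>] by metis
  have "{\<eta>. \<nu> \<eta> \<noteq> 0} \<subseteq> ball 0 (R + \<delta>)"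
  proof (rule ccontr)
    assume "\<not> ?thesis"
    then obtain \<eta> where \<eta>: "\<nu> \<eta> \<noteq> 0" "R + \<delta> \<le> norm \<eta>" by (auto simp: subset_eq not_less)
    have "F x = 0" if "x \<in> ball \<eta> \<delta>" for x
      using that \<eta>(2) F(4)[of x] norm_triangle_ineq2[of \<eta> x] by (simp add: dist_norm)
    then have "F holomorphic_on ball \<eta> \<delta>" by (metis holomorphic_on_const holomorphic_transform)
    then show False using \<nu>(3) \<eta>(1) by blast
  qed
  then have bdd: "bounded {\<eta>. \<nu> \<eta> \<noteq> 0}" using bounded_subset bounded_ball by blast
  \<comment> \<open>If the disc of radius \<open>\<delta>\<close> around \<open>\<eta>\<close> lay
    in \<open>K\<close>, it would lie in the interior, where F = f is holomorphic, and
    \<open>\<nu>\<close> would vanish at \<open>\<eta>\<close>.\<close>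
  have near: "\<exists>p. p \<notin> K \<and> p \<in> ball \<eta> \<delta>" if "\<nu> \<eta> \<noteq> 0" for \<eta>
  proof (rule ccontr)
    assume "\<not> ?thesis"
    then have "ball \<eta> \<delta> \<subseteq> interior K" by (intro interior_maximal) auto
    then have "f holomorphic_on ball \<eta> \<delta>" using f(2) holomorphic_on_subset by blast
    moreover have "F x = f x" if "x \<in> ball \<eta> \<delta>" for x
      using that F(3) \<open>ball \<eta> \<delta> \<subseteq> interior K\<close> interior_subset by blast
    ultimately have "F holomorphic_on ball \<eta> \<delta>" by (metis holomorphic_transform)
    then show False using \<nu>(3) that by blast
  qed
  have "2 * \<epsilon> / \<delta> \<ge> 0" using \<epsilon> \<delta> by simp
  then obtain P where P: "poly_approximable K P"
    "\<And>z. z \<in> K \<Longrightarrow> norm ((\<integral>\<eta>. \<nu> \<eta> / (z - \<eta>) \<partial>lborel) - P z) \<le> 100000 * pi * (2 * \<epsilon> / \<delta>) * \<delta>"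
    using cauchy_transform_poly_approximation[OF K \<delta>(1) _ \<nu>(1,2) bdd near] by metis
  have "norm (f z - P z) < e" if z: "z \<in> K" for z
  proof -
    have "norm (f z - P z) \<le> \<epsilon> + 100000 * pi * (2 * \<epsilon> / \<delta>) * \<delta>"
      using norm_triangle_ineq[of "F z - (\<integral>\<eta>. \<nu> \<eta> / (z - \<eta>) \<partial>lborel)" "(\<integral>\<eta>. \<nu> \<eta> / (z - \<eta>) \<partial>lborel) - P z"]
        \<nu>(4)[of z] P(2)[OF z] F(3)[OF z] by simp
    also have "\<dots> = (200000 * pi + 1) * \<epsilon>" using \<delta> by (simp add: algebra_simps)
    also have "\<dots> < (200000 * pi + 2) * \<epsilon>" using \<epsilon> by simp
    also have "\<dots> = e" unfolding \<epsilon>_def using pi_gt_zero by (simp add: add_nonneg_eq_0_iff)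
    finally show ?thesis .
  qed
  then show "\<exists>g. poly_approximable K g \<and> (\<forall>z\<in>K. norm (f z - g z) < e)" using P(1) by blast
qed

section \<open>Building blocks\<close>

text \<open>By Janiszewski's theorem the union of the disjoint compact sets
  \<open>cball 0 \<rho>\<close> and \<open>K\<close> does not separate the plane, so Mergelyan's
  theorem applies to the function that is 0 on the disc and 1 on \<open>K\<close>. Half of the error
  is reserved for subtracting the value at 0.\<close>

lemma separating_polynomial:
  fixes K :: "complex set"
  assumes K: "compact K" "K \<subseteq> - ball 0 1" "connected (- K)" and r: "r < 1" and d: "d > 0"
  obtains p where "poly p 0 = 0" "\<And>z. z \<in> cball 0 r \<Longrightarrow> norm (poly p z) \<le> d"
    "\<And>z. z \<in> K \<Longrightarrow> norm (poly p z - 1) \<le> d"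
proof -
  \<comment> \<open>The maximum keeps 0 in the disc when r is negative, as the normalisation at 0
    requires.\<close>
  define \<rho> where "\<rho> = max 0 r"
  define r' where "r' = (1 + \<rho>) / 2"
  have r': "\<rho> < r'" "r' < 1" "0 \<le> \<rho>" "r \<le> \<rho>" using r unfolding r'_def \<rho>_def by (auto simp: field_simps)
  define L where "L = cball 0 \<rho> \<union> K"
  define f where "f = (\<lambda>z::complex. if z \<in> ball 0 r' then 0 else 1 :: complex)"
  have disj: "cball 0 \<rho> \<inter> K = {}" using K(2) r' by (auto simp: subset_eq)
  have conn: "connected (- L)" unfolding L_def
  proof (rule Janiszewski_connected)
    show "connected (- cball (0::complex) \<rho>)"
      by (intro path_connected_imp_connected path_connected_complement_bounded_convex) auto
  qed (use K disj in \<open>auto intro: compact_imp_closed\<close>)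
  have holo: "f holomorphic_on (ball 0 r' \<union> - cball 0 r')"
  proof (rule holomorphic_on_Un)
    show "f holomorphic_on ball 0 r'"
      by (rule holomorphic_transform[of "\<lambda>_. 0"]) (auto simp: f_def)
    show "f holomorphic_on - cball 0 r'"
      by (rule holomorphic_transform[of "\<lambda>_. 1"]) (auto simp: f_def)
  qed auto
  have L: "L \<subseteq> ball 0 r' \<union> - cball 0 r'"
    unfolding L_def using K(2) r' by (fastforce simp: subset_eq)
  have "poly_approximable L f"
  proof (rule mergelyan)
    show "compact L" using K unfolding L_def by auto
    show "continuous_on L f"
      using holo L by (meson continuous_on_subset holomorphic_on_imp_continuous_on)
    show "f holomorphic_on interior L"
      using holo L interior_subset by (meson holomorphic_on_subset order_trans)
  qed (rule conn)
  then obtain q where q: "\<And>z. z \<in> L \<Longrightarrow> norm (f z - poly q z) < d / 2"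
    using d unfolding poly_approximable_def by (meson half_gt_zero)
  define p where "p = q - [:poly q 0:]"
  have q0: "norm (poly q 0) < d / 2"
    using q[of 0] r' unfolding L_def f_def by simp
  show thesis
  proof
    show "poly p 0 = 0" by (simp add: p_def)
    show "norm (poly p z) \<le> d" if "z \<in> cball 0 r" for z
    proof -
      have "norm (poly q z) < d / 2"
        using q[of z] that r' unfolding L_def f_def by simp
      then show ?thesis using q0 norm_triangle_ineq4[of "poly q z" "poly q 0"] by (simp add: p_def)
    qed
    show "norm (poly p z - 1) \<le> d" if "z \<in> K" for z
    proof -
      have "z \<notin> ball 0 r'" using that K(2) r' by auto
      then have "norm (1 - poly q z) < d / 2"
        using q[of z] that unfolding L_def f_def by simp
      moreover have "poly p z - 1 = - ((1 - poly q z) + poly q 0)" by (simp add: p_def)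
      ultimately have "norm (poly p z - 1) \<le> norm (1 - poly q z) + norm (poly q 0)"
        using norm_triangle_ineq[of "1 - poly q z" "poly q 0"] by (simp only: norm_minus_cancel)
      then show ?thesis using q0 \<open>norm (1 - poly q z) < d / 2\<close> by linarith
    qed
  qed
qed

text \<open>The polynomial \<open>w\<^sup>2 (3 - 2 w)\<close> has superattracting fixed points at 0 and 1, which are exchanged by \<open>w \<mapsto> 1 - w\<close>.\<close>

definition smoothstep :: "complex poly \<Rightarrow> complex poly" where
  "smoothstep p = p ^ 2 * ([:3:] - smult 2 p)"

lemma poly_smoothstep: "poly (smoothstep p) z = (poly p z)\<^sup>2 * (3 - 2 * poly p z)"
  by (simp add: smoothstep_def)

text \<open>For |w| <= 1/4 one has |w^2 (3 - 2 w)| <= 4 |w|^2. The bounds are the exact solution of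
  a_(i+1) = 4 a_i^2 with a_0 = 1/8.\<close>

lemma smoothstep_iterate_small:
  assumes "norm (poly p z) \<le> 1/8"
  shows "norm (poly ((smoothstep ^^ i) p) z) \<le> (1/2) ^ (2 ^ i) / 4"
proof (induction i)
  case 0
  then show ?case using assms by simp
next
  case (Suc i)
  define w where "w = poly ((smoothstep ^^ i) p) z"
  have w: "norm w \<le> (1/2) ^ (2 ^ i) / 4" using Suc unfolding w_def .
  also have "\<dots> \<le> 1/4" by (simp add: power_le_one)
  finally have "norm (3 - 2 * w) \<le> 4"
    using norm_triangle_ineq4[of 3 "2 * w"] by (simp add: norm_mult)
  moreover have "(norm w)\<^sup>2 \<le> ((1/2) ^ (2 ^ i) / 4)\<^sup>2" using w by (intro power_mono) auto
  ultimately have "(norm w)\<^sup>2 * norm (3 - 2 * w) \<le> ((1/2) ^ (2 ^ i) / 4)\<^sup>2 * 4"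
    by (intro mult_mono) auto
  also have "\<dots> = (1/2) ^ (2 ^ Suc i) / 4"
    by (simp add: power_divide power_mult[symmetric] power2_eq_square power_add[symmetric] mult.commute)
  finally show ?case
    by (simp add: poly_smoothstep w_def norm_mult norm_power)
qed

lemma smoothstep_iterate_symmetric: "(smoothstep ^^ i) (1 - p) = 1 - (smoothstep ^^ i) p"
proof (induction i)
  case (Suc i)
  have "smoothstep (1 - q) = 1 - smoothstep q" for q
  proof -
    have eq: "smoothstep q = q ^ 2 * (3 - 2 * q)" for q
      unfolding smoothstep_def by (simp add: numeral_poly)
    show ?thesis unfolding eq[of q] eq[of "1 - q"] by (simp add: algebra_simps power2_eq_square)
  qed
  then show ?case using Suc by simp
qed simp

lemma smoothstep_iterate_near_one:
  assumes "norm (poly p z - 1) \<le> 1/8"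
  shows "norm (1 - poly ((smoothstep ^^ i) p) z) \<le> (1/2) ^ (2 ^ i) / 4"
  using smoothstep_iterate_small[of "1 - p" z i] assms
  by (simp add: smoothstep_iterate_symmetric norm_minus_commute)

section \<open>Degree and valuation of the iterates\<close>

lemma degree_smoothstep_iterate: "degree ((smoothstep ^^ i) p) \<le> 3 ^ i * degree p"
proof (induction i)
  case (Suc i)
  have "degree (smoothstep q) \<le> 3 * degree q" for q
  proof -
    have "degree (smoothstep q) \<le> degree (q ^ 2) + degree ([:3:] - smult 2 q)"
      unfolding smoothstep_def by (rule degree_mult_le)
    moreover have "degree (q ^ 2) \<le> 2 * degree q" using degree_power_le[of q 2] by (simp add: mult.commute)
    moreover have "degree ([:3:] - smult 2 q) \<le> degree q"
      by (intro degree_diff_le) (auto simp: degree_smult_le)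
    ultimately show ?thesis by linarith
  qed
  from this[of "(smoothstep ^^ i) p"] show ?case using Suc by simp
qed simp

text \<open>The square factor in \<open>smoothstep\<close> doubles the order of vanishing at 0 in
  each step.\<close>

lemma monom_dvd_smoothstep_iterate:
  assumes "poly p 0 = 0"
  shows "monom 1 (2 ^ i) dvd (smoothstep ^^ i) p"
proof (induction i)
  case 0
  then show ?case using assms by (simp add: monom_1_dvd_iff' poly_0_coeff_0)
next
  case (Suc i)
  have "monom 1 (2 ^ i) ^ 2 dvd ((smoothstep ^^ i) p) ^ 2" using Suc by (rule dvd_power_same)
  moreover have "monom (1::complex) (2 ^ i) ^ 2 = monom 1 (2 ^ Suc i)"
    by (simp add: power2_eq_square mult_monom mult_2)
  ultimately show ?case by (simp add: smoothstep_def[of "(smoothstep ^^ i) p"])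
qed

section \<open>Coefficient and growth bounds for polynomials\<close>

lemma poly_coeff_cauchy_bound:
  fixes p :: "complex poly"
  assumes r: "r > 0" and b: "\<And>z. norm z = r \<Longrightarrow> norm (poly p z) \<le> B"
  shows "norm (coeff p k) \<le> B / r ^ k"
proof -
  have "(deriv ^^ k) (poly p) = poly ((pderiv ^^ k) p)"
  proof (induction k)
    case (Suc k)
    have "deriv (poly q) = poly (pderiv q)" for q :: "complex poly"
      by (rule ext) (intro DERIV_imp_deriv poly_DERIV)
    then show ?case by (simp add: Suc)
  qed simp
  then have "(deriv ^^ k) (poly p) 0 = fact k * coeff p k"
    by (simp add: poly_0_coeff_0 coeff_higher_pderiv pochhammer_fact)
  moreover have "norm ((deriv ^^ k) (poly p) 0) \<le> fact k * B / r ^ k"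
    by (rule Cauchy_inequality[OF _ _ r]) (use b in \<open>auto intro!: holomorphic_intros continuous_intros\<close>)
  ultimately have "fact k * norm (coeff p k) \<le> fact k * (B / r ^ k)"
    by (simp add: norm_mult)
  then show ?thesis by (simp only: mult_le_cancel_left_pos fact_gt_zero)
qed

text \<open>The growth is estimated from the degree and a coefficient bound alone. This allows the
  threshold \<open>e0\<close> in \<open>universal_block\<close> to be chosen before the partial sum
  S is known.\<close>

lemma norm_poly_le:
  fixes p :: "complex poly"
  assumes "degree p \<le> N" "\<And>k. norm (coeff p k) \<le> M * 2 ^ k" "norm z \<le> R" "R \<ge> 1"
  shows "norm (poly p z) \<le> M * real (N + 1) * (2 * R) ^ N"
proof -
  have M: "M \<ge> 0" using order_trans[OF norm_ge_zero assms(2)[of 0]] by simp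
  have "poly p z = (\<Sum>k\<le>N. coeff p k * z ^ k)"
    unfolding poly_altdef
    by (rule sum.mono_neutral_left) (use assms(1) in \<open>auto simp: coeff_eq_0\<close>)
  also have "norm \<dots> \<le> (\<Sum>k\<le>N. norm (coeff p k * z ^ k))" by (rule norm_sum)
  also have "\<dots> \<le> (\<Sum>k\<le>N. M * (2 * R) ^ N)"
  proof (rule sum_mono)
    fix k assume k: "k \<in> {..N}"
    have "norm (coeff p k * z ^ k) \<le> (M * 2 ^ k) * R ^ k"
      unfolding norm_mult norm_power using assms M by (intro mult_mono power_mono) auto
    also have "\<dots> = M * (2 * R) ^ k" by (simp add: power_mult_distrib)
    also have "\<dots> \<le> M * (2 * R) ^ N"
      using k assms(4) M by (intro mult_left_mono power_increasing) auto
    finally show "norm (coeff p k * z ^ k) \<le> M * (2 * R) ^ N" .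
  qed
  also have "\<dots> = M * real (N + 1) * (2 * R) ^ N" by simp
  finally show ?thesis .
qed

lemma eventually_nat_power_ge:
  assumes "a > (1::real)"
  shows "eventually (\<lambda>e. C \<le> a ^ e) sequentially"
proof -
  obtain n where "C < a ^ n" using real_arch_pow[OF assms] by blast
  moreover have "a ^ n \<le> a ^ e" if "n \<le> e" for e using that assms by (intro power_increasing) auto
  ultimately show ?thesis unfolding eventually_sequentially by (meson less_imp_le order_trans)
qed

text \<open>
  Writing \<open>N = 2 ^ e\<close>, the block \<open>P = (\<phi> - S) T\<close> has valuation at least \<open>N\<^sup>2\<close> and degree at most \<open>N\<^sup>4\<close>;
  here \<open>T\<close> is the \<open>2 e\<close>-fold iterate of \<open>smoothstep\<close> at a polynomial close to \<open>0\<close> on \<open>cball 0 r\<close> and to \<open>1\<close> on \<open>K\<close>.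
  The error \<open>2 ^ (- N\<^sup>2)\<close> of \<open>T\<close> beats the growth of \<open>\<phi> - S\<close>, which is only exponential in \<open>N\<close>.
\<close>

lemma universal_block:
  fixes K :: "complex set"
  assumes K: "compact K" "K \<subseteq> - ball 0 1" "connected (- K)" and r: "0 < r" "r < 1"
  shows "\<exists>e0. \<forall>e\<ge>e0. \<forall>S. degree S \<le> 2 ^ e \<longrightarrow> (\<forall>k. norm (coeff S k) \<le> M * 2 ^ k) \<longrightarrow>
     (\<exists>P. (\<forall>k<4 ^ e. coeff P k = 0) \<and> degree P \<le> 16 ^ e \<and> (\<forall>k. norm (coeff P k) \<le> 1 / r ^ k) \<and>
          (\<forall>z\<in>K. norm (poly (S + P) z - poly \<phi> z) \<le> 1 / 2 ^ e))"
proof -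
  have "(1/8::real) > 0" by simp
  from separating_polynomial[OF K r(2) this] obtain p where p: "poly p 0 = 0"
    "\<And>z. z \<in> cball 0 r \<Longrightarrow> norm (poly p z) \<le> 1/8" "\<And>z. z \<in> K \<Longrightarrow> norm (poly p z - 1) \<le> 1/8"
    by metis
  obtain R where R: "R \<ge> 1" "\<And>z. z \<in> K \<Longrightarrow> norm z \<le> R"
  proof -
    obtain B where "\<And>z. z \<in> K \<Longrightarrow> norm z \<le> B" using compact_imp_bounded[OF K(1)] unfolding bounded_iff by blast
    then show ?thesis by (intro that[of "max 1 B"]) force+
  qed
  define M' where "M' = (\<Sum>k\<le>degree \<phi>. norm (coeff \<phi> k))"
  have M': "norm (coeff \<phi> k) \<le> M' * 2 ^ k" for k
  proof -
    have "norm (coeff \<phi> k) \<le> M'"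
    proof (cases "k \<le> degree \<phi>")
      case True
      then show ?thesis unfolding M'_def by (intro member_le_sum) auto
    next
      case False
      then show ?thesis unfolding M'_def by (simp add: coeff_eq_0 sum_nonneg)
    qed
    also have "M' \<le> M' * 2 ^ k"
      using mult_left_mono[of 1 "2 ^ k" M'] unfolding M'_def by (simp add: sum_nonneg)
    finally show ?thesis .
  qed
  define C where "C = max 1 (M + M')"
  \<comment> \<open>The first condition gives degree at most N for the correction, the second drives
    the estimate \<open>main\<close>, and the third gives 2^e + 9^e * degree p <= 16^e.\<close>
  have "eventually (\<lambda>e. real (degree \<phi>) \<le> 2 ^ e \<and> 8 * R * C \<le> 2 ^ e \<and> real (degree p) + 1 \<le> (16/9) ^ e) sequentially"
    by (intro eventually_conj eventually_nat_power_ge) auto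
  then obtain e0 where e0: "\<And>e. e \<ge> e0 \<Longrightarrow> real (degree \<phi>) \<le> 2 ^ e \<and> 8 * R * C \<le> 2 ^ e \<and> real (degree p) + 1 \<le> (16/9) ^ e"
    unfolding eventually_sequentially by blast
  show ?thesis
  proof (intro exI[of _ e0] allI impI)
    fix e and S :: "complex poly" assume e: "e \<ge> e0" and S: "degree S \<le> 2 ^ e" "\<forall>k. norm (coeff S k) \<le> M * 2 ^ k"
    define N :: nat where "N = 2 ^ e"
    define T where "T = (smoothstep ^^ (2 * e)) p"
    define \<psi> where "\<psi> = \<phi> - S"
    have N2: "2 ^ (2 * e) = N * N" "N \<ge> 1" unfolding N_def by (simp_all add: mult_2 power_add)
    have "real (degree \<phi>) \<le> real N" using e0[OF e] unfolding N_def by simp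
    then have "degree \<phi> \<le> N" by simp
    then have deg\<psi>: "degree \<psi> \<le> N" unfolding \<psi>_def using S(1) N_def by (intro degree_diff_le) auto
    have coef\<psi>: "norm (coeff \<psi> k) \<le> C * 2 ^ k" for k
    proof -
      have "norm (coeff \<psi> k) \<le> M' * 2 ^ k + M * 2 ^ k"
        unfolding \<psi>_def using norm_triangle_ineq4[of "coeff \<phi> k" "coeff S k"] M'[of k] S(2)[rule_format, of k] by simp
      also have "\<dots> = (M + M') * 2 ^ k" by (simp add: algebra_simps)
      also have "\<dots> \<le> C * 2 ^ k" unfolding C_def by (intro mult_right_mono) auto
      finally show ?thesis .
    qed
    \<comment> \<open>With C, R fixed, (4 R C)^N 2^(-N^2) = (8 R C/2^N)^N 2^(-N). The estimate is
      applied twice: on the circle |z| = r with w = |T|, and on \<open>K\<close> with w = |1 -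
      T|.\<close>
    have main: "norm (poly \<psi> z) * w \<le> 1 / 2 ^ e" if z: "norm z \<le> R" and w: "0 \<le> w" "w \<le> (1/2) ^ (2 ^ (2 * e)) / 4" for z w
    proof -
      have pow4: "(4::real) ^ N = 2 ^ N * 2 ^ N" and pow8: "(8::real) ^ N = 4 ^ N * 2 ^ N"
        by (simp_all add: power_mult_distrib[symmetric])
      have "real (N + 1) \<le> 2 ^ N" using less_exp[of N] by (metis Suc_eq_plus1 Suc_leI of_nat_le_iff of_nat_numeral of_nat_power)
      then have "norm (poly \<psi> z) \<le> C * 2 ^ N * (2 * R) ^ N"
        using norm_poly_le[OF deg\<psi> coef\<psi> z R(1)] R(1) unfolding C_def
        by (smt (verit, ccfv_SIG) mult_left_mono mult_right_mono zero_le_power)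
      also have "\<dots> \<le> C ^ N * 2 ^ N * (2 * R) ^ N"
      proof (intro mult_right_mono)
        show "C \<le> C ^ N" using N2(2) by (intro self_le_power) (auto simp: C_def)
      qed (use R in auto)
      also have "\<dots> = (4 * R * C) ^ N" by (simp add: power_mult_distrib pow4)
      finally have "norm (poly \<psi> z) * w \<le> (4 * R * C) ^ N * ((1/2) ^ (N * N))"
        using w R unfolding N2 C_def by (intro mult_mono) (auto intro: order_trans)
      also have "\<dots> = (8 * R * C / 2 ^ N) ^ N * (1/2) ^ N"
        by (simp add: power_mult_distrib power_divide power_mult pow8)
      also have "\<dots> \<le> 1 * (1/2) ^ N"
      proof (intro mult_right_mono power_le_one)
        have "8 * R * C \<le> 2 ^ e" using e0[OF e] by blast
        also have "(2::real) ^ e \<le> 2 ^ N" unfolding N_def by (intro power_increasing) (auto simp: less_imp_le)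
        finally show "8 * R * C / 2 ^ N \<le> 1" by simp
      qed (use R in \<open>auto simp: C_def\<close>)
      also have "\<dots> \<le> 1 / 2 ^ e"
        unfolding N_def by (simp add: power_one_over divide_simps power_increasing less_imp_le)
      finally show ?thesis .
    qed
    show "\<exists>P. (\<forall>k<4 ^ e. coeff P k = 0) \<and> degree P \<le> 16 ^ e \<and> (\<forall>k. norm (coeff P k) \<le> 1 / r ^ k) \<and>
          (\<forall>z\<in>K. norm (poly (S + P) z - poly \<phi> z) \<le> 1 / 2 ^ e)"
    proof (intro exI[of _ "\<psi> * T"] conjI ballI)
      have "monom 1 (2 ^ (2 * e)) dvd \<psi> * T"
        unfolding T_def by (intro dvd_mult monom_dvd_smoothstep_iterate p)
      then show "\<forall>k<4 ^ e. coeff (\<psi> * T) k = 0" by (simp add: monom_1_dvd_iff' power_mult)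
      have "degree T \<le> 9 ^ e * degree p"
        using degree_smoothstep_iterate[of "2 * e" p] unfolding T_def by (simp add: power_mult)
      then have "degree (\<psi> * T) \<le> N + 9 ^ e * degree p"
        using degree_mult_le[of \<psi> T] deg\<psi> by linarith
      then have "real (degree (\<psi> * T)) \<le> real (N + 9 ^ e * degree p)"
        by (simp only: of_nat_le_iff)
      also have "\<dots> \<le> 9 ^ e * (real (degree p) + 1)"
      proof -
        have "(2::real) ^ e \<le> 9 ^ e" by (intro power_mono) auto
        then show ?thesis unfolding N_def by (simp add: algebra_simps)
      qed
      also have "\<dots> \<le> 9 ^ e * (16/9) ^ e" using e0[OF e] by (intro mult_left_mono) auto
      also have "\<dots> = real (16 ^ e)" by (simp add: power_mult_distrib[symmetric])
      finally show "degree (\<psi> * T) \<le> 16 ^ e" by (simp only: of_nat_le_iff)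
      show "\<forall>k. norm (coeff (\<psi> * T) k) \<le> 1 / r ^ k"
      proof (intro allI poly_coeff_cauchy_bound r)
        fix z :: complex assume z: "norm z = r"
        then have "norm (poly T z) \<le> (1/2) ^ (2 ^ (2 * e)) / 4"
          unfolding T_def by (intro smoothstep_iterate_small p) auto
        then have "norm (poly \<psi> z) * norm (poly T z) \<le> 1 / 2 ^ e" using z R r by (intro main) auto
        also have "\<dots> \<le> 1" by simp
        finally show "norm (poly (\<psi> * T) z) \<le> 1" by (simp add: norm_mult)
      qed
      fix z assume z: "z \<in> K"
      then have "norm (1 - poly T z) \<le> (1/2) ^ (2 ^ (2 * e)) / 4"
        unfolding T_def by (intro smoothstep_iterate_near_one p)
      then have "norm (poly \<psi> z) * norm (1 - poly T z) \<le> 1 / 2 ^ e" using R z by (intro main) auto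
      moreover have "poly (S + \<psi> * T) z - poly \<phi> z = - (poly \<psi> z * (1 - poly T z))"
        unfolding \<psi>_def by (simp add: algebra_simps)
      ultimately show "norm (poly (S + \<psi> * T) z - poly \<phi> z) \<le> 1 / 2 ^ e" by (simp add: norm_mult)
    qed
  qed
qed

section \<open>Countable families and logarithmic density\<close>

text \<open>A path in \<open>- K\<close> from 0 to the exterior of a disc containing
  \<open>K\<close> is covered by finitely many discs from a countable family. Together with the unit
  disc and the exterior they form a connected open set missing \<open>K\<close>, and its complement
  is one of countably many admissible compact sets.\<close>

lemma countable_exhausting_compacts:
  obtains \<K> :: "nat \<Rightarrow> complex set"
  where "\<And>n. compact (\<K> n)" "\<And>n. \<K> n \<subseteq> - ball 0 1" "\<And>n. connected (- \<K> n)"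
    "\<And>K. compact K \<Longrightarrow> K \<subseteq> - ball 0 1 \<Longrightarrow> connected (- K) \<Longrightarrow> \<exists>n. K \<subseteq> \<K> n"
proof -
  obtain D :: "complex set" where D: "countable D" "\<And>U. open U \<Longrightarrow> U \<noteq> {} \<Longrightarrow> \<exists>d\<in>D. d \<in> U"
    using countable_dense_setE by blast
  define B where "B = (\<lambda>(d, n). ball d (1 / real (Suc n))) ` (D \<times> (UNIV :: nat set))"
  have "countable B" unfolding B_def using D(1) by (intro countable_image countable_SIGMA) auto
  define W where "W = (\<lambda>(F, n). ball 0 1 \<union> - cball 0 (real n) \<union> \<Union>F :: complex set)"
  define I where "I = {F. finite F \<and> F \<subseteq> B} \<times> (UNIV :: nat set)"
  \<comment> \<open>Connectedness is imposed as a condition because an arbitrary finite family of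
    discs need not link the unit disc to the exterior.\<close>
  define \<C> where "\<C> = {K. \<exists>i\<in>I. K = - W i \<and> connected (W i)}"
  have "countable I" unfolding I_def
    using countable_Collect_finite_subset[OF \<open>countable B\<close>] by (intro countable_SIGMA) auto
  moreover have "\<C> \<subseteq> (\<lambda>i. - W i) ` I" unfolding \<C>_def by blast
  ultimately have "countable \<C>" by (meson countable_image countable_subset)
  have Wopen: "open (W i)" if "i \<in> I" for i
    using that unfolding I_def W_def B_def by (auto intro!: open_Un open_Compl open_Union)
  have good: "compact K" "K \<subseteq> - ball 0 1" "connected (- K)" if K: "K \<in> \<C>" for K
  proof -
    obtain i where i: "i \<in> I" "K = - W i" "connected (W i)" using K unfolding \<C>_def by blast
    have "K \<subseteq> cball 0 (real (snd i))" unfolding i(2) W_def by (auto simp: case_prod_unfold)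
    then show "compact K"
      unfolding i(2) using Wopen[OF i(1)] by (simp add: compact_eq_bounded_closed closed_Compl bounded_subset[OF bounded_cball])
    show "K \<subseteq> - ball 0 1" unfolding i(2) W_def by (auto simp: case_prod_unfold)
    show "connected (- K)" using i by simp
  qed
  have sup: "\<exists>K'\<in>\<C>. K \<subseteq> K'" if K: "compact K" "K \<subseteq> - ball 0 1" "connected (- K)" for K
  proof -
    obtain n where n: "K \<subseteq> cball 0 (real n)"
    proof -
      obtain b where "\<And>z. z \<in> K \<Longrightarrow> norm z \<le> b" using compact_imp_bounded[OF K(1)] unfolding bounded_iff by blast
      moreover obtain n where "b \<le> real n" using real_arch_simple by blast
      ultimately show ?thesis by (intro that[of n]) force
    qed
    have opK: "open (- K)" using K(1) by (simp add: compact_imp_closed open_Compl)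
    have out: "complex_of_real (real (Suc n)) \<in> - K"
      using n by (auto simp: subset_eq simp del: of_nat_Suc)
    have "path_connected (- K)" using K(3) opK by (simp add: connected_open_path_connected)
    moreover have "0 \<in> - K" using K(2) by auto
    ultimately obtain g where g: "path g" "path_image g \<subseteq> - K" "pathstart g = 0" "pathfinish g = complex_of_real (real (Suc n))"
      using out unfolding path_connected_def by blast
    have cover: "\<exists>b\<in>B. x \<in> b \<and> b \<subseteq> - K" if x: "x \<in> path_image g" for x
    proof -
      obtain e where e: "e > 0" "ball x e \<subseteq> - K" using x g(2) opK open_contains_ball by (meson subsetD)
      obtain k where k: "2 / real (Suc k) < e"
        using reals_Archimedean[of "e / 2"] e(1) by (auto simp: field_simps)
      obtain d where d: "d \<in> D" "d \<in> ball x (1 / real (Suc k))" using D(2)[of "ball x (1 / real (Suc k))"] by auto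
      have "ball d (1 / real (Suc k)) \<subseteq> ball x e"
      proof
        fix y assume "y \<in> ball d (1 / real (Suc k))"
        then have "dist x y < 1 / real (Suc k) + 1 / real (Suc k)"
          using d(2) dist_triangle[of x y d] by (simp only: mem_ball)
        also have "\<dots> = 2 / real (Suc k)" by simp
        finally show "y \<in> ball x e" using k by simp
      qed
      moreover have "ball d (1 / real (Suc k)) \<in> B" unfolding B_def using d(1) by force
      ultimately show ?thesis using d(2) e(2) by (metis dist_commute mem_ball order_trans)
    qed
    have "compact (path_image g)" using g(1) by (rule compact_path_image)
    moreover have "path_image g \<subseteq> \<Union>{b \<in> B. b \<subseteq> - K \<and> b \<inter> path_image g \<noteq> {}}"
      using cover by blast
    moreover have "open b" if "b \<in> {b \<in> B. b \<subseteq> - K \<and> b \<inter> path_image g \<noteq> {}}" for b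
      using that unfolding B_def by auto
    ultimately obtain F where F: "F \<subseteq> {b \<in> B. b \<subseteq> - K \<and> b \<inter> path_image g \<noteq> {}}" "finite F" "path_image g \<subseteq> \<Union>F"
      by (rule compactE)
    \<comment> \<open>Every chosen disc meets the path, so the discs hang together along the
      connected path, which their union contains.\<close>
    have conF: "connected (\<Union>F)"
    proof -
      have "connected (\<Union>((\<lambda>b. path_image g \<union> b) ` F))"
      proof (rule connected_Union)
        fix s assume "s \<in> (\<lambda>b. path_image g \<union> b) ` F"
        then obtain b where b: "b \<in> F" "s = path_image g \<union> b" by blast
        then have "b \<in> B" "b \<inter> path_image g \<noteq> {}" using F(1) by auto
        then show "connected s" unfolding b(2) B_def
          by (intro connected_Un connected_path_image g) auto
      next
        have "pathstart g \<in> \<Inter>((\<lambda>b. path_image g \<union> b) ` F)" by auto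
        then show "\<Inter>((\<lambda>b. path_image g \<union> b) ` F) \<noteq> {}" by blast
      qed
      moreover have "\<Union>((\<lambda>b. path_image g \<union> b) ` F) = \<Union>F" using F(3) g(3) pathstart_in_path_image[of g] by auto
      ultimately show ?thesis by simp
    qed
    have ends: "0 \<in> \<Union>F" "complex_of_real (real (Suc n)) \<in> \<Union>F"
      using F(3) g(3,4) pathstart_in_path_image[of g] pathfinish_in_path_image[of g] by (auto simp del: of_nat_Suc)
    have "connected ((ball 0 1 \<union> \<Union>F) \<union> - cball 0 (real n))"
    proof (rule connected_Un)
      show "connected (ball 0 1 \<union> \<Union>F)"
      proof (intro connected_Un conF)
        have "0 \<in> ball 0 1 \<inter> \<Union>F" using ends(1) by simp
        then show "ball 0 1 \<inter> \<Union>F \<noteq> {}" by blast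
      qed simp
      show "connected (- cball (0::complex) (real n))"
        by (intro path_connected_imp_connected path_connected_complement_bounded_convex) auto
      have "complex_of_real (real (Suc n)) \<in> - cball 0 (real n)" by (simp del: of_nat_Suc)
      then show "(ball 0 1 \<union> \<Union>F) \<inter> - cball 0 (real n) \<noteq> {}" using ends(2) by blast
    qed
    then have "connected (W (F, n))" unfolding W_def by (simp add: Un_ac)
    moreover have "(F, n) \<in> I" using F unfolding I_def by auto
    ultimately have "- W (F, n) \<in> \<C>" unfolding \<C>_def by blast
    moreover have "K \<subseteq> - W (F, n)" using F(1) n K(2) unfolding W_def by auto
    ultimately show ?thesis by blast
  qed
  have ne: "\<C> \<noteq> {}" using sup[of "{}"] by auto
  show thesis
  proof
    fix n
    have "from_nat_into \<C> n \<in> \<C>" using ne by (rule from_nat_into)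
    then show "compact (from_nat_into \<C> n)" "from_nat_into \<C> n \<subseteq> - ball 0 1" "connected (- from_nat_into \<C> n)"
      using good by auto
  next
    fix K :: "complex set" assume "compact K" "K \<subseteq> - ball 0 1" "connected (- K)"
    then obtain K' where "K' \<in> \<C>" "K \<subseteq> K'" using sup by blast
    then show "\<exists>n. K \<subseteq> from_nat_into \<C> n" using from_nat_into_surj[OF \<open>countable \<C>\<close>] by metis
  qed
qed

lemma countable_dense_polynomials:
  obtains \<Phi> :: "nat \<Rightarrow> complex poly"
  where "\<And>p R e. e > 0 \<Longrightarrow> \<exists>n. \<forall>z\<in>cball 0 R. norm (poly (\<Phi> n) z - poly p z) < e"
proof -
  obtain D :: "complex set" where D: "countable D" "\<And>U. open U \<Longrightarrow> U \<noteq> {} \<Longrightarrow> \<exists>d\<in>D. d \<in> U"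
    using countable_dense_setE by blast
  define \<P> where "\<P> = Poly ` lists D"
  have ex: "\<exists>q\<in>\<P>. \<forall>z\<in>cball 0 R. norm (poly q z - poly p z) < e" if "e > 0" for p R e
    using that
  proof (induction p arbitrary: e)
    case 0
    have "Poly [] \<in> \<P>" unfolding \<P>_def by blast
    then show ?case using 0 by force
  next
    case (pCons a p)
    \<comment> \<open>In Horner form the error of q is multiplied by |z| <= B; it therefore gets the
      share e/(2 B), and the constant coefficient gets e/2.\<close>
    define B where "B = \<bar>R\<bar> + 1"
    have B: "B > 0" unfolding B_def by simp
    then have "e / (2 * B) > 0" using pCons.prems by simp
    from pCons.IH[OF this] obtain q where q: "q \<in> \<P>" "\<And>z. z \<in> cball 0 R \<Longrightarrow> norm (poly q z - poly p z) < e / (2 * B)"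
      by blast
    obtain d where d: "d \<in> D" "norm (d - a) < e / 2"
      using D(2)[of "ball a (e/2)"] pCons.prems by (auto simp: dist_norm norm_minus_commute)
    obtain xs where xs: "xs \<in> lists D" "q = Poly xs" using q(1) unfolding \<P>_def by blast
    have "pCons d q \<in> \<P>" unfolding \<P>_def using d(1) xs by (intro image_eqI[of _ _ "d # xs"]) auto
    moreover have "norm (poly (pCons d q) z - poly (pCons a p) z) < e" if z: "z \<in> cball 0 R" for z
    proof -
      have "norm z \<le> B" using z unfolding B_def by auto
      then have "norm z * norm (poly q z - poly p z) \<le> B * (e / (2 * B))"
        using q(2)[OF z] B by (intro mult_mono) auto
      also have "\<dots> = e / 2" using B by simp
      finally have "norm (z * (poly q z - poly p z)) \<le> e / 2" by (simp add: norm_mult)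
      moreover have "poly (pCons d q) z - poly (pCons a p) z = (d - a) + z * (poly q z - poly p z)"
        by (simp add: algebra_simps)
      then have "norm (poly (pCons d q) z - poly (pCons a p) z) \<le> norm (d - a) + norm (z * (poly q z - poly p z))"
        by (simp only: norm_triangle_ineq)
      ultimately show ?thesis using d(2) by linarith
    qed
    ultimately show ?case by blast
  qed
  have "countable \<P>" unfolding \<P>_def using D(1) by (intro countable_image countable_lists)
  moreover have "\<P> \<noteq> {}" unfolding \<P>_def by blast
  ultimately show thesis
    using that[of "from_nat_into \<P>"] ex from_nat_into_surj by metis
qed

text \<open>The numbers of 2-adic valuation exactly l form an arithmetic progression with step
  2^(l+1), so infinitely many values can all recur with bounded gaps.\<close>

lemma ruler_sequence:
  obtains \<rho> :: "nat \<Rightarrow> nat" where "\<And>l. \<exists>p>0. \<forall>n. \<exists>j. n \<le> j \<and> j < n + p \<and> \<rho> j = l"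
proof (rule that[of "multiplicity 2"])
  fix l :: nat
  show "\<exists>p>0. \<forall>n. \<exists>j. n \<le> j \<and> j < n + p \<and> multiplicity (2::nat) j = l"
  proof (rule exI[of _ "2 ^ (l + 2)"], intro conjI allI)
    fix n :: nat
    define m where "m = n div 2 ^ (l + 1) + 1"
    \<comment> \<open>An odd multiple of 2^l placed after the next multiple of 2^(l+1) beyond n,
      hence less than 2^(l+2) past n.\<close>
    define j where "j = 2 ^ l * (2 * (n div 2 ^ (l + 1)) + 3)"
    have jj: "j = 2 ^ (l + 1) * m + 2 ^ l" unfolding j_def m_def by (simp add: algebra_simps)
    have n: "n = 2 ^ (l + 1) * (n div 2 ^ (l + 1)) + n mod 2 ^ (l + 1)" by simp
    have lt: "n mod 2 ^ (l + 1) < 2 ^ (l + 1)" by simp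
    have j2: "j = 2 ^ (l + 1) * (n div 2 ^ (l + 1)) + 2 ^ (l + 1) + 2 ^ l" unfolding jj m_def by (simp add: algebra_simps)
    have "n \<le> j" using n lt j2 by linarith
    moreover have "j < n + 2 ^ (l + 2)"
    proof -
      have "(2::nat) ^ (l + 2) = 2 ^ (l + 1) + 2 ^ (l + 1)" "(2::nat) ^ l < 2 ^ (l + 1)" by simp_all
      then show ?thesis using n j2 by linarith
    qed
    moreover have "multiplicity 2 j = l"
    proof (rule multiplicity_eqI)
      show "2 ^ l dvd j" unfolding j_def by simp
      show "\<not> 2 ^ Suc l dvd j" unfolding j_def by (simp add: mult.commute[of 2])
    qed
    ultimately show "\<exists>j. n \<le> j \<and> j < n + 2 ^ (l + 2) \<and> multiplicity 2 j = l" by blast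
  qed simp
qed

text \<open>A diagonal choice: the parameter \<open>\<sigma> j\<close> rises to a new value only
  when the threshold \<open>J\<close> of that value has been passed, yet tends to infinity.\<close>

lemma slow_sequence:
  fixes J :: "nat \<Rightarrow> nat"
  obtains \<sigma> where "filterlim \<sigma> at_top sequentially" "\<And>j. J 0 \<le> j \<Longrightarrow> J (\<sigma> j) \<le> j"
proof -
  \<comment> \<open>The condition s <= j makes the set finite and the inserted 0 makes it nonempty,
    so that \<open>Max\<close> is meaningful.\<close>
  define A where "A = (\<lambda>j. insert 0 {s. s \<le> j \<and> J s \<le> j})"
  define \<sigma> where "\<sigma> = (\<lambda>j. Max (A j))"
  have fin: "finite (A j)" "A j \<noteq> {}" for j unfolding A_def by auto
  show thesis
  proof
    show "J (\<sigma> j) \<le> j" if "J 0 \<le> j" for j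
      using Max_in[OF fin, of j] that unfolding \<sigma>_def A_def by auto
    show "filterlim \<sigma> at_top sequentially"
      unfolding filterlim_at_top eventually_sequentially
    proof
      fix s
      have "s \<le> \<sigma> j" if "max s (J s) \<le> j" for j
        unfolding \<sigma>_def using that by (intro Max_ge fin) (auto simp: A_def)
      then show "\<exists>N. \<forall>n\<ge>N. s \<le> \<sigma> n" by blast
    qed
  qed
qed

section \<open>Harmonic sums and lower logarithmic density\<close>

lemma harmonic_gap_lower:
  assumes "N \<ge> (1::nat)"
  shows "ln (real N) \<le> (\<Sum>k\<in>{N..<N\<^sup>2}. 1 / real k)"
proof -
  have "ln (real n) - ln (real N) \<le> (\<Sum>k\<in>{N..<n}. 1 / real k)" if "N \<le> n" for n
    using that
  proof (induction n rule: dec_induct)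
    case (step n)
    have n: "n \<ge> 1" using step assms by simp
    have "ln (real (Suc n)) - ln (real n) = ln (real (Suc n) / real n)"
      using n by (simp add: ln_div)
    also have "real (Suc n) / real n = 1 + 1 / real n" using n by (simp add: field_simps)
    also have "ln (1 + 1 / real n) \<le> 1 / real n" using n by (intro ln_add_one_self_le_self) auto
    finally show ?case using step by simp
  qed simp
  from this[of "N\<^sup>2"] assms show ?thesis
    by (simp add: power2_eq_square ln_mult)
qed

lemma harmonic_upper:
  assumes "n \<ge> (1::nat)"
  shows "(\<Sum>k=1..n. 1 / real k) \<le> 1 + ln (real n)"
  using assms
proof (induction n rule: dec_induct)
  case (step n)
  have "ln (real n / real (Suc n)) \<le> real n / real (Suc n) - 1"
    using step by (intro ln_le_minus_one) auto
  also have "\<dots> = - (1 / real (Suc n))" by (simp add: field_simps)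
  finally have "1 / real (Suc n) \<le> ln (real (Suc n)) - ln (real n)"
    using step by (simp add: ln_div)
  then show ?case using step by simp
qed simp

text \<open>Before n there is a complete gap from M to M^2 with an index in \<open>J\<close> at most
  a bounded number of steps back. Its logarithmic length ln M is a fixed fraction of ln n, because
  each step back divides the logarithm only by 4.\<close>

lemma lower_log_density_pos:
  assumes p: "p > 0" and syn: "\<And>n. \<exists>j. n \<le> j \<and> j < n + p \<and> j \<in> J"
    and E: "\<And>j n. j \<in> J \<Longrightarrow> j1 \<le> j \<Longrightarrow> 2 ^ 4 ^ (j+1) \<le> n \<Longrightarrow> n < (2 ^ 4 ^ (j+1))\<^sup>2 \<Longrightarrow> n \<in> E"
  shows "lower_log_density E > 0"
proof -
  define N :: "nat \<Rightarrow> nat" where "N = (\<lambda>j. 2 ^ 4 ^ j)"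
  \<comment> \<open>The harmonic sum up to n is at most 1 + 8 * 4^p ln M, and 1 <= 2 * 4^p ln M
    since M >= 2; the sum is 10 * 4^p ln M.\<close>
  define c where "c = 1 / (10 * 4 ^ p :: real)"
  have c: "c > 0" unfolding c_def by simp
  have N1: "N j \<ge> 2" for j unfolding N_def using power_increasing[of 1 "4 ^ j" "2::nat"] by simp
  have lnN: "ln (real (N j)) = 4 ^ j * ln 2" for j unfolding N_def by (simp add: ln_realpow)
  have bound: "c \<le> (\<Sum>k\<in>{1..n} \<inter> E. 1 / real k) / (\<Sum>k=1..n. 1 / real k)" if n: "(N (j1 + p + 1))\<^sup>2 \<le> n" for n
  proof -
    define i where "i = (LEAST i. n < (N (i + p + 1))\<^sup>2)"
    have Nmono: "i \<le> N i" for i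
    proof -
      have "i < 2 ^ i" "i < 4 ^ i" by (simp_all add: less_exp[of i] order_less_le_trans[OF less_exp power_mono])
      then show ?thesis unfolding N_def by (meson less_exp less_imp_le order_trans)
    qed
    have "n < (N (n + p + 1))\<^sup>2"
    proof -
      have "n < n + p + 1" by simp
      also have "\<dots> \<le> N (n + p + 1)" by (rule Nmono)
      also have "\<dots> \<le> (N (n + p + 1))\<^sup>2" by (simp add: power2_eq_square)
      finally show ?thesis .
    qed
    then have iup: "n < (N (i + p + 1))\<^sup>2" unfolding i_def by (rule LeastI)
    have inc: "(N a)\<^sup>2 \<le> (N b)\<^sup>2" if "a \<le> b" for a b
      unfolding N_def using that by (intro power_mono power_increasing) auto
    have "\<not> i \<le> j1"
    proof
      assume "i \<le> j1"
      then have "(N (i + p + 1))\<^sup>2 \<le> (N (j1 + p + 1))\<^sup>2" by (intro inc) auto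
      then show False using iup n by linarith
    qed
    then obtain i' where i': "i = Suc i'" "j1 \<le> i'" by (metis less_imp_Suc_add not_less le_add1 add.commute)
    have ilow: "(N (i' + p + 1))\<^sup>2 \<le> n"
      using not_less_Least[of i' "\<lambda>i. n < (N (i + p + 1))\<^sup>2"] i'(1) unfolding i_def by (simp add: not_less)
    \<comment> \<open>From j + 1 <= i' + p it follows that the gap belonging to j ends no later than
      n, and j >= i' keeps it from being too old.\<close>
    obtain j where j: "i' \<le> j" "j < i' + p" "j \<in> J" using syn by blast
    define M where "M = N (j + 1)"
    have Mn: "M\<^sup>2 \<le> n"
      unfolding M_def by (rule order_trans[OF inc ilow]) (use j(2) in simp)
    have M1: "M \<ge> 2" unfolding M_def by (rule N1)
    have lnM: "ln (real M) \<ge> ln 2" using M1 by simp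
    have sub: "{M..<M\<^sup>2} \<subseteq> {1..n} \<inter> E"
    proof
      fix k assume k: "k \<in> {M..<M\<^sup>2}"
      then have "k \<in> E" using E[of j k] j i' unfolding M_def N_def by auto
      then show "k \<in> {1..n} \<inter> E" using k Mn M1 by auto
    qed
    have num: "ln (real M) \<le> (\<Sum>k\<in>{1..n} \<inter> E. 1 / real k)"
    proof -
      have "ln (real M) \<le> (\<Sum>k\<in>{M..<M\<^sup>2}. 1 / real k)" using M1 by (intro harmonic_gap_lower) auto
      also have "\<dots> \<le> (\<Sum>k\<in>{1..n} \<inter> E. 1 / real k)" using sub by (intro sum_mono2) auto
      finally show ?thesis .
    qed
    have n1: "n \<ge> 1" using Mn M1 by (metis le_trans one_le_numeral one_le_power)
    have "(\<Sum>k=1..n. 1 / real k) \<le> 1 + ln (real n)" by (rule harmonic_upper[OF n1])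
    also have "ln (real n) \<le> ln (real ((N (i + p + 1))\<^sup>2))"
    proof (rule ln_mono)
      show "real n \<le> real ((N (i + p + 1))\<^sup>2)" using iup by (simp only: of_nat_le_iff less_imp_le)
    qed (use n1 in simp)
    also have "\<dots> = 2 * (4 ^ (i + p + 1) * ln 2)" using lnN by (simp add: ln_realpow)
    also have "4 ^ (i + p + 1) * ln 2 \<le> 4 ^ p * (4 * ln (real M))"
    proof -
      have "(4::real) ^ (i + p + 1) \<le> 4 ^ (p + 1) * 4 ^ (j + 1)"
        unfolding power_add[symmetric] using i'(1) j(1) by (intro power_increasing) auto
      then have "4 ^ (i + p + 1) * ln 2 \<le> 4 ^ (p + 1) * 4 ^ (j + 1) * ln (2::real)"
        by (intro mult_right_mono) auto
      then show ?thesis unfolding M_def lnN by simp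
    qed
    also have "1 + 2 * (4 ^ p * (4 * ln (real M))) \<le> 4 ^ p * (10 * ln (real M))"
    proof -
      have "1/2 \<le> ln (2::real)"
        using ln2_ge_two_thirds by linarith
      then have "1 \<le> 2 * ln (real M)" using lnM by linarith
      also have "\<dots> \<le> 4 ^ p * (2 * ln (real M))"
        using mult_right_mono[of 1 "4 ^ p" "2 * ln (real M)"] \<open>1 \<le> 2 * ln (real M)\<close> by simp
      finally show ?thesis by (simp add: algebra_simps)
    qed
    finally have den: "(\<Sum>k=1..n. 1 / real k) \<le> 4 ^ p * (10 * ln (real M))" by simp
    have pos: "(\<Sum>k=1..n. 1 / real k) > 0" using n1 by (intro sum_pos) auto
    have lnpos: "ln (real M) > 0" using M1 by simp
    have "c \<le> ln (real M) / (4 ^ p * (10 * ln (real M)))" unfolding c_def using lnpos by simp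
    also have "\<dots> \<le> (\<Sum>k\<in>{1..n} \<inter> E. 1 / real k) / (\<Sum>k=1..n. 1 / real k)"
      using num den pos lnpos by (intro frac_le) auto
    finally show ?thesis .
  qed
  have "ereal c \<le> lower_log_density E"
    unfolding lower_log_density_def
    by (intro Liminf_bounded eventually_sequentiallyI[of "(N (j1 + p + 1))\<^sup>2"]) (use bound in simp)
  then show ?thesis using c by (metis ereal_less(2) order_less_le_trans)
qed

section \<open>The universal series\<close>

text \<open>Polynomials are chosen recursively, each adding at most one block. Coefficients below
  the valuation of the block are frozen, and new ones are bounded by radii tending to 1, so the
  limit series converges in the unit disc. Starting at a late index \<open>j0\<close> keeps the sum
  of all blocks small on the disc of radius \<open>r1\<close>.\<close>

lemma universal_coefficients:
  fixes \<K> :: "nat \<Rightarrow> complex set" and \<phi> :: "nat \<Rightarrow> complex poly" and \<rho> :: "nat \<Rightarrow> nat" and q :: "complex poly"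
  assumes \<K>: "\<And>l. compact (\<K> l)" "\<And>l. \<K> l \<subseteq> - ball 0 1" "\<And>l. connected (- \<K> l)"
    and r1: "r1 < 1" and e: "e > 0"
  obtains c :: "nat \<Rightarrow> complex" where
    "\<forall>r. 0 < r \<and> r < 1 \<longrightarrow> eventually (\<lambda>k. norm (c k) \<le> 1 / r ^ k) sequentially"
    "\<forall>z. norm z \<le> r1 \<longrightarrow> norm ((\<Sum>k. c k * z ^ k) - poly q z) < e"
    "\<forall>l. eventually (\<lambda>j. \<rho> j = l \<longrightarrow> (\<forall>n. 2 ^ 4 ^ (j+1) \<le> n \<and> n < (2 ^ 4 ^ (j+1))\<^sup>2 \<longrightarrow>
        (\<forall>z\<in>\<K> l. norm ((\<Sum>k\<le>n. c k * z ^ k) - poly (\<phi> l) z) \<le> 1 / 2 ^ 4 ^ j))) sequentially"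
proof -
  define N :: "nat \<Rightarrow> nat" where "N = (\<lambda>j. 2 ^ 4 ^ j)"
  have N2: "(N j)\<^sup>2 = 4 ^ 4 ^ j" for j unfolding N_def by (simp add: power2_eq_square power_mult_distrib[symmetric])
  have NSuc: "N (Suc j) = 16 ^ 4 ^ j" for j unfolding N_def by (simp add: power_mult)
  have Nlt: "N j < (N j)\<^sup>2" and NSq: "(N j)\<^sup>2 \<le> (N (Suc j))\<^sup>2" and NleSuc: "N j \<le> N (Suc j)" for j
  proof -
    show "N j < (N j)\<^sup>2" unfolding N2 unfolding N_def by (intro power_strict_mono) auto
    show "N j \<le> N (Suc j)" unfolding N_def by (intro power_increasing) auto
    then show "(N j)\<^sup>2 \<le> (N (Suc j))\<^sup>2" by (intro power_mono) auto
  qed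
  have Nge: "j < N j" for j
  proof -
    have "j < 4 ^ j" by (rule less_le_trans[OF less_exp power_mono]) auto
    also have "4 ^ j < N j" unfolding N_def by (rule less_exp)
    finally show ?thesis .
  qed
  \<comment> \<open>The radii increase to 1 but never fall below 1/2, which keeps the invariant
    bound \<open>real Mq * 2 ^ k\<close> valid after every block.\<close>
  define rs :: "nat \<Rightarrow> real" where "rs = (\<lambda>s. 1 - 1 / (real s + 2))"
  have rs: "rs s \<ge> 1/2" "rs s < 1" "rs s > 0" for s unfolding rs_def by (auto simp: field_simps)
  have rs_mono: "rs s \<le> rs t" if "s \<le> t" for s t
    unfolding rs_def using that by (simp add: frac_le)
  have rs_ex: "\<exists>s. r \<le> rs s" if "r < 1" for r
  proof -
    obtain s where "1 / (1 - r) \<le> real s" using real_arch_simple by blast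
    then have "1 / (1 - r) \<le> real s + 2" by linarith
    then have "1 / (real s + 2) \<le> 1 - r" using that by (simp add: field_simps)
    then show ?thesis unfolding rs_def by (intro exI[of _ s]) linarith
  qed
  define block where "block = (\<lambda>l s e (S :: complex poly) P. (\<forall>k<4 ^ e. coeff P k = 0) \<and> degree P \<le> 16 ^ e \<and>
      (\<forall>k. norm (coeff P k) \<le> 1 / rs s ^ k) \<and> (\<forall>z\<in>\<K> l. norm (poly (S + P) z - poly (\<phi> l) z) \<le> 1 / 2 ^ e))"
  \<comment> \<open>The parameter s is both the index of the radius and the coefficient bound of
    \<open>universal_block\<close>, so a single sequence tending to infinity handles both.\<close>
  define ready where "ready = (\<lambda>l s e0. \<forall>e\<ge>e0. \<forall>S. degree S \<le> 2 ^ e \<longrightarrow>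
      (\<forall>k. norm (coeff S k) \<le> real s * 2 ^ k) \<longrightarrow> (\<exists>P. block l s e S P))"
  have "\<exists>e0. ready l s e0" for l s
    unfolding ready_def block_def by (rule universal_block[OF \<K> rs(3,2)])
  then obtain E where "\<And>l s. ready l s (E l s)" by metis
  then have E: "\<exists>P. block l s e S P"
    if "E l s \<le> e" "degree S \<le> 2 ^ e" "\<And>k. norm (coeff S k) \<le> real s * 2 ^ k" for l s e S
    using that unfolding ready_def by blast
  \<comment> \<open>The sum dominates the thresholds of all jobs l <= s at once.\<close>
  define J where "J = (\<lambda>s. \<Sum>l\<le>s. E l s)"
  have EJ: "E l s \<le> J s" if "l \<le> s" for l s
    unfolding J_def using that by (intro member_le_sum) auto
  obtain \<sigma> where \<sigma>: "filterlim \<sigma> at_top sequentially" "\<And>j. J 0 \<le> j \<Longrightarrow> J (\<sigma> j) \<le> j"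
    using slow_sequence[of J] by metis
  have \<sigma>_ev: "eventually (\<lambda>j. s \<le> \<sigma> j) sequentially" for s
    using \<sigma>(1) unfolding filterlim_at_top by blast
  obtain Mq :: nat where Mq: "Mq \<ge> 1" "\<And>k. norm (coeff q k) \<le> real Mq * 2 ^ k"
  proof -
    obtain B where B: "\<And>k. norm (coeff q k) \<le> B"
    proof -
      have "norm (coeff q k) \<le> (\<Sum>k\<le>degree q. norm (coeff q k))" for k
        by (cases "k \<le> degree q") (auto intro: member_le_sum simp: coeff_eq_0 sum_nonneg)
      then show ?thesis using that by blast
    qed
    obtain n where n: "B \<le> real n" using real_arch_simple by blast
    show ?thesis
    proof (rule that[of "Suc n"])
      fix k
      have "norm (coeff q k) \<le> real (Suc n) * 1" using B[of k] n by simp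
      also have "\<dots> \<le> real (Suc n) * 2 ^ k" by (intro mult_left_mono) auto
      finally show "norm (coeff q k) \<le> real (Suc n) * 2 ^ k" .
    qed simp
  qed
  \<comment> \<open>Coefficients bounded by 1/\<open>r2\<close>^k on a disc of the smaller radius
    \<open>r1'\<close> give a tail dominated by the geometric series in x =
    \<open>r1'\<close>/\<open>r2\<close>.\<close>
  define r1' where "r1' = max 0 r1"
  define r2 where "r2 = (1 + r1') / 2"
  have r2: "0 \<le> r1'" "r1' < r2" "r2 < 1" "r2 > 0" "r1 \<le> r1'" using r1 unfolding r1'_def r2_def by (auto simp: field_simps)
  define x where "x = r1' / r2"
  have x: "0 \<le> x" "x < 1" using r2 unfolding x_def by auto
  obtain s2 where s2: "r2 \<le> rs s2" using rs_ex[OF r2(3)] by blast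
  have "(\<lambda>n. x ^ n / (1 - x)) \<longlonglongrightarrow> 0 / (1 - x)"
    using x by (intro tendsto_divide LIMSEQ_power_zero tendsto_const) auto
  then have "eventually (\<lambda>n. x ^ n / (1 - x) < e) sequentially"
    using e by (auto dest: order_tendstoD(2))
  then obtain n1 where n1: "\<And>n. n \<ge> n1 \<Longrightarrow> x ^ n / (1 - x) < e" unfolding eventually_sequentially by blast
  \<comment> \<open>From \<open>j0\<close> on, \<open>\<sigma>\<close> dominates the coefficient
    bound of q and provides radii at least \<open>r2\<close>, the thresholds \<open>J\<close> apply,
    q satisfies the initial degree bound, and the geometric tail is below e.\<close>
  obtain j0 where j0: "\<And>j. j \<ge> j0 \<Longrightarrow> max Mq s2 \<le> \<sigma> j" "J 0 \<le> j0" "degree q \<le> j0" "n1 \<le> j0"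
  proof -
    obtain j0 where "\<And>j. j \<ge> j0 \<Longrightarrow> max Mq s2 \<le> \<sigma> j" using \<sigma>_ev unfolding eventually_sequentially by blast
    then show ?thesis by (intro that[of "j0 + J 0 + degree q + n1"]) auto
  qed
  define Inv where "Inv = (\<lambda>j (S :: complex poly). degree S \<le> N (j0 + j) \<and> (\<forall>k. norm (coeff S k) \<le> real Mq * 2 ^ k))"
  \<comment> \<open>A job whose number exceeds \<open>\<sigma>\<close> is skipped and the polynomial
    stays as it is. As \<open>\<sigma>\<close> tends to infinity, each job is skipped at only
    finitely many indices.\<close>
  define Rel where "Rel = (\<lambda>j (S :: complex poly) S'. (\<forall>k<(N (j0 + j))\<^sup>2. coeff S' k = coeff S k) \<and>
      (\<forall>k\<ge>(N (j0 + j))\<^sup>2. norm (coeff S' k) \<le> 1 / rs (\<sigma> (j0 + j)) ^ k) \<and>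
      (\<rho> (j0 + j) \<le> \<sigma> (j0 + j) \<longrightarrow> (\<forall>z\<in>\<K> (\<rho> (j0 + j)). norm (poly S' z - poly (\<phi> (\<rho> (j0 + j))) z) \<le> 1 / 2 ^ 4 ^ (j0 + j))))"
  have Inv0: "Inv 0 q"
    unfolding Inv_def using j0(3) Nge[of j0] Mq by auto
  have step: "\<exists>S'. Inv (Suc j) S' \<and> Rel j S S'" if S: "Inv j S" for j S
  proof -
    define i where "i = j0 + j"
    have deg: "degree S \<le> N i" and co: "\<And>k. norm (coeff S k) \<le> real Mq * 2 ^ k"
      using S unfolding Inv_def i_def by auto
    have high: "coeff S k = 0" if "k \<ge> (N i)\<^sup>2" for k
      using that Nlt[of i] deg by (intro coeff_eq_0) linarith
    have \<sigma>i: "Mq \<le> \<sigma> i" "J (\<sigma> i) \<le> i" using j0(1)[of i] \<sigma>(2)[of i] j0(2) unfolding i_def by auto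
    show ?thesis
    proof (cases "\<rho> i \<le> \<sigma> i")
      case False
      have "Inv (Suc j) S" using S NleSuc[of i] deg unfolding Inv_def i_def by auto
      moreover have "Rel j S S" using False high rs(3)[of "\<sigma> i"] unfolding Rel_def i_def[symmetric] by (simp add: less_imp_le)
      ultimately show ?thesis by blast
    next
      case True
      \<comment> \<open>The block is used with exponent 4^i, since N i = 2 ^ 4 ^ i, and 4^i >= i >=
        J (\<open>\<sigma>\<close> i).\<close>
      have "E (\<rho> i) (\<sigma> i) \<le> 4 ^ i"
        using EJ[OF True] \<sigma>i(2) less_le_trans[OF less_exp[of i] power_mono[of 2 4 i]] by linarith
      moreover have "norm (coeff S k) \<le> real (\<sigma> i) * 2 ^ k" for k
        using co[of k] mult_right_mono[of "real Mq" "real (\<sigma> i)" "2 ^ k"] \<sigma>i(1) by (simp add: order.trans)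
      ultimately obtain P where "block (\<rho> i) (\<sigma> i) (4 ^ i) S P"
        using E deg unfolding N_def by blast
      then have P: "\<And>k. k < (N i)\<^sup>2 \<Longrightarrow> coeff P k = 0" "degree P \<le> N (Suc i)" "\<And>k. norm (coeff P k) \<le> 1 / rs (\<sigma> i) ^ k"
        "\<And>z. z \<in> \<K> (\<rho> i) \<Longrightarrow> norm (poly (S + P) z - poly (\<phi> (\<rho> i)) z) \<le> 1 / 2 ^ 4 ^ i"
        unfolding block_def N2 NSuc by auto
      have "Rel j S (S + P)"
        unfolding Rel_def i_def[symmetric] using P high by auto
      moreover have "Inv (Suc j) (S + P)"
      proof -
        have "degree (S + P) \<le> N (Suc i)" using deg NleSuc[of i] P(2) by (intro degree_add_le) auto
        moreover have "norm (coeff (S + P) k) \<le> real Mq * 2 ^ k" for k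
        proof (cases "k < (N i)\<^sup>2")
          case True
          then show ?thesis using co P(1) by simp
        next
          case False
          then have "norm (coeff (S + P) k) \<le> 1 / rs (\<sigma> i) ^ k" using high P(3) by simp
          also have "\<dots> \<le> 1 / (1/2) ^ k" using rs[of "\<sigma> i"] by (intro divide_left_mono power_mono) auto
          also have "\<dots> = 1 * 2 ^ k" by (simp add: power_one_over)
          also have "\<dots> \<le> real Mq * 2 ^ k" using Mq(1) by (intro mult_right_mono) auto
          finally show ?thesis .
        qed
        ultimately show ?thesis unfolding Inv_def i_def by simp
      qed
      ultimately show ?thesis by blast
    qed
  qed
  have "\<exists>S. S 0 = q \<and> (\<forall>j. Inv j (S j) \<and> Rel j (S j) (S (Suc j)))"
  proof -
    have "\<exists>S. \<forall>j. (Inv j (S j) \<and> (j = 0 \<longrightarrow> S j = q)) \<and> Rel j (S j) (S (Suc j))"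
      by (rule dependent_nat_choice) (use Inv0 step in auto)
    then show ?thesis by blast
  qed
  then obtain S where S0: "S 0 = q" and Inv: "\<And>j. Inv j (S j)" and Rel: "\<And>j. Rel j (S j) (S (Suc j))" by blast
  \<comment> \<open>At stage k the coefficient of index k is already final, because k is below the
    square of N (j0 + k).\<close>
  define c where "c = (\<lambda>k. coeff (S k) k)"
  have Nmono: "(N i)\<^sup>2 \<le> (N j)\<^sup>2" if "i \<le> j" for i j
    using lift_Suc_mono_le[of "\<lambda>j. (N j)\<^sup>2"] NSq that by blast
  have stable: "coeff (S j') k = coeff (S j) k" if "j \<le> j'" "k < (N (j0 + j))\<^sup>2" for j j' k
    using that(1)
  proof (induction j' rule: dec_induct)
    case (step j')
    have "k < (N (j0 + j'))\<^sup>2" using less_le_trans[OF that(2) Nmono[of "j0 + j" "j0 + j'"]] step(1) by simp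
    then show ?case using Rel[of j'] step unfolding Rel_def by simp
  qed simp
  have c: "c k = coeff (S j) k" if "k < (N (j0 + j))\<^sup>2" for j k
  proof (cases "j \<le> k")
    case True
    then show ?thesis unfolding c_def using stable that by blast
  next
    case False
    have "k < N (j0 + k)" using Nge[of "j0 + k"] by linarith
    then have "k < (N (j0 + k))\<^sup>2" using Nlt[of "j0 + k"] by linarith
    then show ?thesis unfolding c_def using stable[of k j k] False by simp
  qed
  have bound: "norm (c k) \<le> 1 / r ^ k"
    if r: "r > 0" "\<And>i. j0 + j1 \<le> i \<Longrightarrow> r \<le> rs (\<sigma> i)" and k: "(N (j0 + j1))\<^sup>2 \<le> k" for r j1 k
  proof -
    \<comment> \<open>A coefficient in this range is either covered by the induction hypothesis or
      belongs to the latest block, whose radius is at least r.\<close>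
    have "(N (j0 + j1))\<^sup>2 \<le> k \<longrightarrow> k < (N (j0 + (j1 + d)))\<^sup>2 \<longrightarrow> norm (coeff (S (j1 + d)) k) \<le> 1 / r ^ k" for d
    proof (induction d)
      case (Suc d)
      show ?case
      proof (intro impI)
        assume k1: "(N (j0 + j1))\<^sup>2 \<le> k"
        have Rel': "Rel (j1 + d) (S (j1 + d)) (S (j1 + Suc d))" using Rel[of "j1 + d"] by simp
        show "norm (coeff (S (j1 + Suc d)) k) \<le> 1 / r ^ k"
        proof (cases "k < (N (j0 + (j1 + d)))\<^sup>2")
          case True
          then show ?thesis using Rel' Suc k1 unfolding Rel_def by simp
        next
          case False
          then have "norm (coeff (S (j1 + Suc d)) k) \<le> 1 / rs (\<sigma> (j0 + (j1 + d))) ^ k"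
            using Rel' unfolding Rel_def by simp
          also have "\<dots> \<le> 1 / r ^ k"
            using r(1) r(2)[of "j0 + (j1 + d)"] rs(3) by (intro divide_left_mono power_mono mult_pos_pos zero_less_power) auto
          finally show ?thesis .
        qed
      qed
    qed simp
    moreover have "k < (N (j0 + (j1 + k)))\<^sup>2"
      using Nge[of "j0 + (j1 + k)"] Nlt[of "j0 + (j1 + k)"] by linarith
    ultimately show ?thesis using k c by metis
  qed
  show thesis
  proof (rule that[of c]; intro allI impI)
    fix r :: real assume "0 < r \<and> r < 1"
    then have r: "0 < r" "r < 1" by auto
    obtain s where s: "r \<le> rs s" using rs_ex r by blast
    obtain j1 where j1: "\<And>j. j \<ge> j1 \<Longrightarrow> s \<le> \<sigma> j" using \<sigma>_ev unfolding eventually_sequentially by blast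
    have "norm (c k) \<le> 1 / r ^ k" if "(N (j0 + j1))\<^sup>2 \<le> k" for k
      using bound[OF r(1) _ that] s rs_mono[OF j1] by (meson add_leE order_trans)
    then show "eventually (\<lambda>k. norm (c k) \<le> 1 / r ^ k) sequentially"
      unfolding eventually_sequentially by blast
  next
    fix z :: complex assume z: "norm z \<le> r1"
    define n0 where "n0 = (N j0)\<^sup>2"
    have tail: "norm (c k * z ^ k) \<le> x ^ k" if "n0 \<le> k" for k
    proof -
      have "norm (c k) \<le> 1 / r2 ^ k"
        by (rule bound[of _ 0]) (use r2 that s2 rs_mono j0(1) in \<open>auto simp: n0_def intro: order_trans\<close>)
      then have "norm (c k) * norm z ^ k \<le> (1 / r2 ^ k) * r1' ^ k"
        using z r2 by (intro mult_mono power_mono) auto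
      then show ?thesis unfolding x_def by (simp add: norm_mult norm_power power_divide)
    qed
    have sx: "summable (\<lambda>k. x ^ (k + n0))" "(\<Sum>k. x ^ (k + n0)) = x ^ n0 / (1 - x)"
    proof -
      have "(\<lambda>k. x ^ n0 * x ^ k) sums (x ^ n0 * (1 / (1 - x)))"
        using x by (intro sums_mult geometric_sums) auto
      then have "(\<lambda>k. x ^ (k + n0)) sums (x ^ n0 / (1 - x))" by (simp add: power_add mult.commute)
      then show "summable (\<lambda>k. x ^ (k + n0))" "(\<Sum>k. x ^ (k + n0)) = x ^ n0 / (1 - x)"
        by (auto simp: sums_iff)
    qed
    have s1: "summable (\<lambda>k. c (k + n0) * z ^ (k + n0))"
      by (rule summable_comparison_test'[OF sx(1), of 0]) (use tail in auto)
    then have s0: "summable (\<lambda>k. c k * z ^ k)" by (subst (asm) summable_iff_shift)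
    have "poly q z = (\<Sum>k<n0. c k * z ^ k)"
    proof -
      have "degree q < n0" using j0(3) Nge[of j0] Nlt[of j0] unfolding n0_def by linarith
      then have "poly q z = (\<Sum>k<n0. coeff q k * z ^ k)"
        unfolding poly_altdef by (intro sum.mono_neutral_left) (auto simp: coeff_eq_0)
      also have "\<dots> = (\<Sum>k<n0. c k * z ^ k)"
        using c[of _ 0] S0 unfolding n0_def by (intro sum.cong) auto
      finally show ?thesis .
    qed
    then have "(\<Sum>k. c k * z ^ k) - poly q z = (\<Sum>k. c (k + n0) * z ^ (k + n0))"
      using suminf_split_initial_segment[OF s0, of n0] by simp
    also have "norm \<dots> \<le> (\<Sum>k. x ^ (k + n0))"
      by (rule norm_suminf_le) (use tail sx in auto)
    also have "\<dots> < e"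
      unfolding sx(2) using j0(4) Nge[of j0] Nlt[of j0] unfolding n0_def by (intro n1) linarith
    finally show "norm ((\<Sum>k. c k * z ^ k) - poly q z) < e" .
  next
    fix l
    obtain j1 where j1: "\<And>j. j \<ge> j1 \<Longrightarrow> l \<le> \<sigma> j" using \<sigma>_ev unfolding eventually_sequentially by blast
    have "norm ((\<Sum>k\<le>n. c k * z ^ k) - poly (\<phi> l) z) \<le> 1 / 2 ^ 4 ^ j"
      if j: "j0 + j1 \<le> j" "\<rho> j = l" and n: "N (j + 1) \<le> n" "n < (N (j + 1))\<^sup>2" and z: "z \<in> \<K> l" for j n z
    proof -
      define i where "i = j - j0"
      have i: "j = j0 + i" using j unfolding i_def by simp
      \<comment> \<open>The polynomial after block j has degree at most N (j+1) and agrees with the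
        series below the square of N (j+1). For n in the gap it therefore is the n-th partial
        sum.\<close>
      have deg: "degree (S (Suc i)) \<le> n" using Inv[of "Suc i"] n unfolding Inv_def i by simp
      have "(\<Sum>k\<le>n. c k * z ^ k) = (\<Sum>k\<le>n. coeff (S (Suc i)) k * z ^ k)"
        using c[of _ "Suc i"] n(2) unfolding i by (intro sum.cong) auto
      also have "\<dots> = poly (S (Suc i)) z"
        unfolding poly_altdef using deg by (intro sum.mono_neutral_right) (auto simp: coeff_eq_0)
      finally show ?thesis using Rel[of i] j z j1[of j] unfolding Rel_def i by auto
    qed
    then show "eventually (\<lambda>j. \<rho> j = l \<longrightarrow> (\<forall>n. 2 ^ 4 ^ (j+1) \<le> n \<and> n < (2 ^ 4 ^ (j+1))\<^sup>2 \<longrightarrow>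
        (\<forall>z\<in>\<K> l. norm ((\<Sum>k\<le>n. c k * z ^ k) - poly (\<phi> l) z) \<le> 1 / 2 ^ 4 ^ j))) sequentially"
      unfolding N_def eventually_sequentially by blast
  qed
qed

section \<open>Passage from coefficients to the function spaces\<close>

lemma taylor_series_in_holo_space:
  fixes c :: "nat \<Rightarrow> complex"
  assumes c: "\<And>r. 0 < r \<Longrightarrow> r < 1 \<Longrightarrow> eventually (\<lambda>k. norm (c k) \<le> 1 / r ^ k) sequentially"
  defines "f \<equiv> restrict (\<lambda>z. \<Sum>k. c k * z ^ k) (ball 0 1)"
  shows "f \<in> holo_space (ball 0 1)" "taylor_sum K n f = restrict (\<lambda>z. \<Sum>k\<le>n. c k * z ^ k) K"
proof -
  define F where "F = Abs_fps c"
  have radius: "fps_conv_radius F \<ge> 1"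
    unfolding fps_conv_radius_def
  proof (rule conv_radius_geI_ex)
    fix r :: real assume r: "0 < r" "ereal r < 1"
    define s where "s = (1 + r) / 2"
    have s: "r < s" "s < 1" "s > 0" using r unfolding s_def by auto
    have "eventually (\<lambda>k. norm (c k * complex_of_real r ^ k) \<le> (r / s) ^ k) sequentially"
      using c[OF s(3,2)]
    proof eventually_elim
      case (elim k)
      then have "norm (c k) * r ^ k \<le> 1 / s ^ k * r ^ k" using r by (intro mult_right_mono) auto
      then show ?case using r by (simp add: norm_mult norm_power power_divide)
    qed
    moreover have "summable (\<lambda>k. (r / s) ^ k)" using r s by (intro summable_geometric) auto
    ultimately have "summable (\<lambda>k. c k * complex_of_real r ^ k)"
      by (rule summable_comparison_test_ev)
    then show "\<exists>z. norm z = r \<and> summable (\<lambda>n. fps_nth F n * z ^ n)"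
      using r by (intro exI[of _ "complex_of_real r"]) (simp add: F_def)
  qed
  have f: "f z = eval_fps F z" if "z \<in> ball 0 1" for z
    using that unfolding f_def F_def eval_fps_def by simp
  have "eval_fps F holomorphic_on ball 0 1"
  proof (rule holomorphic_on_eval_fps)
    show "ball 0 1 \<subseteq> eball 0 (fps_conv_radius F)"
      using eball_mono[OF radius, of 0] by (simp add: one_ereal_def)
  qed
  then have "f holomorphic_on ball 0 1" by (rule holomorphic_transform) (use f in auto)
  then show "f \<in> holo_space (ball 0 1)" unfolding holo_space_def f_def by simp
  have "eventually (\<lambda>z. f z = eval_fps F z) (nhds 0)"
    unfolding eventually_nhds using f by (intro exI[of _ "ball 0 1"]) auto
  moreover have "eval_fps F has_fps_expansion F"
    by (rule eval_fps_has_fps_expansion[OF less_le_trans[OF _ radius]]) simp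
  ultimately have "f has_fps_expansion F" using has_fps_expansion_cong by blast
  then have "fps_expansion f 0 = F" by (rule fps_expansion_eqI)
  then show "taylor_sum K n f = restrict (\<lambda>z. \<Sum>k\<le>n. c k * z ^ k) K"
    unfolding taylor_sum_def by (simp add: F_def)
qed

lemma openin_A_space_contains_ball:
  assumes K: "compact K" and U: "openin (mtopology_of (A_space K)) U" "h \<in> U"
  obtains r where "r > 0"
    "\<And>g. g \<in> mspace (A_space K) \<Longrightarrow> (\<And>z. z \<in> K \<Longrightarrow> norm (g z - h z) \<le> r) \<Longrightarrow> g \<in> U"
proof -
  interpret A: Metric_space "mspace (A_space K)" "mdist (A_space K)" by simp
  have UM: "U \<subseteq> mspace (A_space K)" and "\<exists>r>0. A.mball h r \<subseteq> U"
    using U unfolding mtopology_of_def A.openin_mtopology by auto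
  then obtain r where r: "r > 0" "A.mball h r \<subseteq> U" by blast
  have h: "h \<in> mspace (A_space K)" using UM U(2) by blast
  show thesis
  \<comment> \<open>Half the radius turns the nonstrict pointwise bound into membership in the open
    metric ball.\<close>
  proof (rule that[of "r / 2"])
    fix g assume g: "g \<in> mspace (A_space K)" and close: "\<And>z. z \<in> K \<Longrightarrow> norm (g z - h z) \<le> r / 2"
    show "g \<in> U"
    proof (cases "K = {}")
      case True
      then have "g = h" using g h by (simp add: mspace_A_space extensional_def fun_eq_iff)
      then show ?thesis using U(2) by simp
    next
      case False
      have "mdist (A_space K) h g = (SUP z\<in>K. norm (h z - g z))"
        by (rule mdist_A_space[OF K False h g])
      also have "\<dots> \<le> r / 2"
        using False close by (intro cSUP_least) (auto simp: norm_minus_commute)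
      finally have "mdist (A_space K) h g < r" using r(1) by simp
      then show ?thesis using r(2) g h by (auto simp: A.in_mball)
    qed
  qed (use r in simp)
qed

theorem theoremA:
  shows "\<exists>X. X \<subseteq> holo_space (ball 0 1) \<and>
           holo_topology (ball 0 1) closure_of X = holo_space (ball 0 1) \<and>
           (\<forall>f\<in>X. \<forall>K. compact K \<and> K \<subseteq> - ball 0 1 \<and> connected (- K) \<longrightarrow>
              (\<forall>U. openin (mtopology_of (A_space K)) U \<and> U \<noteq> {} \<longrightarrow>
                 lower_log_density {n. taylor_sum K n f \<in> U} > 0))"
proof -
  define univ where "univ = (\<lambda>f. \<forall>K. compact K \<and> K \<subseteq> - ball 0 1 \<and> connected (- K) \<longrightarrow>
              (\<forall>U. openin (mtopology_of (A_space K)) U \<and> U \<noteq> {} \<longrightarrow>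
                 lower_log_density {n. taylor_sum K n f \<in> U} > 0))"
  obtain \<K> :: "nat \<Rightarrow> complex set"
    where \<K>: "\<And>n. compact (\<K> n)" "\<And>n. \<K> n \<subseteq> - ball 0 1" "\<And>n. connected (- \<K> n)"
      and \<K>_ex: "\<And>K. compact K \<Longrightarrow> K \<subseteq> - ball 0 1 \<Longrightarrow> connected (- K) \<Longrightarrow> \<exists>n. K \<subseteq> \<K> n"
    using countable_exhausting_compacts by metis
  obtain \<Phi> :: "nat \<Rightarrow> complex poly"
    where \<Phi>: "\<And>p R e. e > 0 \<Longrightarrow> \<exists>n. \<forall>z\<in>cball 0 R. norm (poly (\<Phi> n) z - poly p z) < e"
    using countable_dense_polynomials by metis
  obtain \<rho> :: "nat \<Rightarrow> nat" where \<rho>: "\<And>l. \<exists>p>0. \<forall>n. \<exists>j. n \<le> j \<and> j < n + p \<and> \<rho> j = l"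
    using ruler_sequence by metis
  \<comment> \<open>A job number l encodes a pair consisting of a compact set and a polynomial
    target.\<close>
  define \<K>' where "\<K>' = (\<lambda>l. \<K> (fst (prod_decode l)))"
  define \<phi> where "\<phi> = (\<lambda>l. \<Phi> (snd (prod_decode l)))"
  have dense: "\<exists>g \<in> {f \<in> holo_space (ball 0 1). univ f}. \<forall>z\<in>L. dist (g z) (f z) < e"
    if f: "f \<in> holo_space (ball 0 1)" and L: "compact L" "L \<subseteq> ball 0 1" and e: "0 < e" for f L e
  proof -
    obtain r1 where r1: "r1 < 1" "L \<subseteq> cball 0 r1"
    proof (cases "L = {}")
      case False
      then obtain x where "x \<in> L" "\<And>y. y \<in> L \<Longrightarrow> norm y \<le> norm x"
        using continuous_attains_sup[OF L(1) False continuous_on_norm_id] by blast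
      then show ?thesis using L(2) by (intro that[of "norm x"]) auto
    qed (use that[of 0] in simp)
    have "f holomorphic_on ball 0 1" using f unfolding holo_space_def by simp
    then have "poly_approximable (cball 0 r1) f" by (rule holomorphic_on_ball_poly_approximable[OF _ r1(1)])
    then obtain q where q: "\<And>z. z \<in> cball 0 r1 \<Longrightarrow> norm (f z - poly q z) < e / 2"
      using e unfolding poly_approximable_def by (meson half_gt_zero)
    have \<K>': "\<And>l. compact (\<K>' l)" "\<And>l. \<K>' l \<subseteq> - ball 0 1" "\<And>l. connected (- \<K>' l)"
      unfolding \<K>'_def using \<K> by auto
    have e2: "e / 2 > 0" using e by simp
    obtain c where
      c: "\<forall>r. 0 < r \<and> r < 1 \<longrightarrow> eventually (\<lambda>k. norm (c k) \<le> 1 / r ^ k) sequentially"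
      and near: "\<forall>z. norm z \<le> r1 \<longrightarrow> norm ((\<Sum>k. c k * z ^ k) - poly q z) < e / 2"
      and gaps: "\<forall>l. eventually (\<lambda>j. \<rho> j = l \<longrightarrow> (\<forall>n. 2 ^ 4 ^ (j+1) \<le> n \<and> n < (2 ^ 4 ^ (j+1))\<^sup>2 \<longrightarrow>
        (\<forall>z\<in>\<K>' l. norm ((\<Sum>k\<le>n. c k * z ^ k) - poly (\<phi> l) z) \<le> 1 / 2 ^ 4 ^ j))) sequentially"
      by (rule universal_coefficients[where \<K> = \<K>' and \<rho> = \<rho> and \<phi> = \<phi> and q = q, OF \<K>' r1(1) e2])
    define g where "g = restrict (\<lambda>z. \<Sum>k. c k * z ^ k) (ball 0 1)"
    have g: "g \<in> holo_space (ball 0 1)" "\<And>K n. taylor_sum K n g = restrict (\<lambda>z. \<Sum>k\<le>n. c k * z ^ k) K"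
      unfolding g_def using taylor_series_in_holo_space[of c] c by auto
    have "univ g" unfolding univ_def
    proof (intro allI impI)
      fix K and U :: "(complex \<Rightarrow> complex) set"
      assume K: "compact K \<and> K \<subseteq> - ball 0 1 \<and> connected (- K)"
        and U: "openin (mtopology_of (A_space K)) U \<and> U \<noteq> {}"
      from U obtain h where h: "h \<in> U" by auto
      have "h \<in> mspace (A_space K)"
        using U h openin_subset[of "mtopology_of (A_space K)" U] by auto
      then have hK: "continuous_on K h" "h holomorphic_on interior K"
        using K by (simp_all add: mspace_A_space)
      obtain r where r: "r > 0"
        "\<And>g. g \<in> mspace (A_space K) \<Longrightarrow> (\<And>z. z \<in> K \<Longrightarrow> norm (g z - h z) \<le> r) \<Longrightarrow> g \<in> U"
        by (rule openin_A_space_contains_ball[of K U h]) (use K U h in simp_all)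
      \<comment> \<open>Three errors are added on \<open>K\<close>: partial sum against
        \<open>\<Phi> n\<close>, \<open>\<Phi> n\<close> against p, and p against h. Mergelyan's
        theorem controls the last one on \<open>K\<close> itself, while the first is controlled on
        the larger set \<open>\<K> m\<close>.\<close>
      have r3: "r / 3 > 0" using r by simp
      have "poly_approximable K h" using K hK by (intro mergelyan) auto
      then obtain p where p: "\<And>z. z \<in> K \<Longrightarrow> norm (h z - poly p z) < r / 3"
        using r3 unfolding poly_approximable_def by meson
      obtain R where R: "K \<subseteq> cball 0 R"
        using K by (meson ball_subset_cball bounded_subset_ballD compact_imp_bounded order_trans)
      obtain n where n: "\<And>z. z \<in> cball 0 R \<Longrightarrow> norm (poly (\<Phi> n) z - poly p z) < r / 3"
        using \<Phi>[OF r3] by meson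
      obtain m where m: "K \<subseteq> \<K> m" using \<K>_ex K by blast
      define l where "l = prod_encode (m, n)"
      have l: "\<K>' l = \<K> m" "\<phi> l = \<Phi> n" unfolding \<K>'_def \<phi>_def l_def by simp_all
      have "(\<lambda>j. inverse (2 ^ j) :: real) \<longlonglongrightarrow> 0" by (rule LIMSEQ_inverse_realpow_zero) simp
      then have "eventually (\<lambda>j. inverse (2 ^ j) < r / 3) sequentially"
        using r3 by (rule order_tendstoD(2))
      with gaps[rule_format, of l] have "eventually (\<lambda>j. \<rho> j = l \<longrightarrow> (\<forall>n. 2 ^ 4 ^ (j+1) \<le> n \<and> n < (2 ^ 4 ^ (j+1))\<^sup>2 \<longrightarrow>
          taylor_sum K n g \<in> U)) sequentially"
      proof eventually_elim
        case (elim j)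
        show ?case
        proof (intro impI allI r(2))
          fix i :: nat and z assume j: "\<rho> j = l" and i: "2 ^ 4 ^ (j+1) \<le> i \<and> i < (2 ^ 4 ^ (j+1))\<^sup>2" and z: "z \<in> K"
          have "j \<le> 4 ^ j" using less_le_trans[OF less_exp[of j] power_mono[of 2 4 j]] by simp
          then have "(1::real) / 2 ^ 4 ^ j \<le> inverse (2 ^ j)" by (simp add: divide_simps power_increasing)
          then have "norm ((\<Sum>k\<le>i. c k * z ^ k) - poly (\<Phi> n) z) < r / 3"
            using elim j i z m l by fastforce
          moreover have "taylor_sum K i g z = (\<Sum>k\<le>i. c k * z ^ k)" using z by (simp add: g(2))
          moreover have "norm (poly (\<Phi> n) z - poly p z) < r / 3" "norm (h z - poly p z) < r / 3"
            using n[of z] p[of z] z R by auto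
          ultimately show "norm (taylor_sum K i g z - h z) \<le> r"
            using norm_triangle_ineq[of "taylor_sum K i g z - poly (\<Phi> n) z" "poly (\<Phi> n) z - poly p z"]
              norm_triangle_ineq4[of "taylor_sum K i g z - poly p z" "h z - poly p z"] by simp
        qed (use K in \<open>auto intro: taylor_sum_in_A_space\<close>)
      qed
      then obtain j1 where j1: "\<And>j i. j \<ge> j1 \<Longrightarrow> \<rho> j = l \<Longrightarrow> 2 ^ 4 ^ (j+1) \<le> i \<Longrightarrow> i < (2 ^ 4 ^ (j+1))\<^sup>2 \<Longrightarrow>
          taylor_sum K i g \<in> U" unfolding eventually_sequentially by blast
      obtain s where "s > 0" "\<And>n. \<exists>j. n \<le> j \<and> j < n + s \<and> \<rho> j = l" using \<rho>[of l] by auto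
      then show "lower_log_density {n. taylor_sum K n g \<in> U} > 0"
        using j1 by (intro lower_log_density_pos[of s "{j. \<rho> j = l}" j1]) auto
    qed
    moreover have "dist (g z) (f z) < e" if z: "z \<in> L" for z
    proof -
      have z1: "norm z \<le> r1" using z r1 by auto
      then have "norm (g z - poly q z) < e / 2" using near[rule_format, OF z1] r1 by (simp add: g_def)
      moreover have "norm (f z - poly q z) < e / 2" using q z1 by simp
      ultimately show ?thesis
        using norm_triangle_ineq4[of "g z - poly q z" "f z - poly q z"] by (simp add: dist_norm)
    qed
    ultimately show ?thesis using g(1) by blast
  qed
  show ?thesis
  proof (intro exI[of _ "{f \<in> holo_space (ball 0 1). univ f}"] conjI ballI)
    show "holo_topology (ball 0 1) closure_of {f \<in> holo_space (ball 0 1). univ f} = holo_space (ball 0 1)"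
    proof (rule set_eqI)
      fix f
      show "f \<in> holo_topology (ball 0 1) closure_of {f \<in> holo_space (ball 0 1). univ f} \<longleftrightarrow> f \<in> holo_space (ball 0 1)"
        unfolding in_closure_of_holo_topology using dense[of f] by (metis (lifting) Int_iff mem_Collect_eq)
    qed
  qed (auto simp: univ_def)
qed

end
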